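(* Let $E$ be an exact Courant algebroid over a smooth manifold $M$ and let $\mathcal G$ be a (semi-Riemannian) generalised metric on $E$. For any divergence operator $\mathrm{div}:\Gamma(E)\to C^\infty(M)$ there exists a canonical generalised Levi-Civita connection $D=D^{\mathcal G,\mathrm{div}}$ of $(E,\mathcal G)$ such that $\mathrm{div}^D=\mathrm{div}$. (The meaning of "canonical" is spelled out at the end of the context.)
   Context: **Setting.** $(E,\pi,\langle\cdot,\cdot\rangle,[\cdot,\cdot])$ is an exact Courant algebroid over $M$: the bracket is the Dorfman bracket and $0\to T^*M\to E\xrightarrow{\pi}TM\to0$ is exact. A (semi-Riemannian) generalised metric is a nondegenerate symmetric bilinear form $\mathcal G$ on $E$ such that the endomorphism $\mathcal G^{\mathrm{End}}$ defined by $\langle\mathcal G^{\mathrm{End}}u,v\rangle=\mathcal G(u,v)$ is an involution and $\mathcal G|_{T^*M}$ is nondegenerate. $E_\pm$ are the $\pm1$-eigenbundles of $\mathcal G^{\mathrm{End}}$, so $E=E_+\oplus E_-$ orthogonally and $\mathcal G=\pm\langle\cdot,\cdot\rangle$ on $E_\pm$. The maps $\pi_\pm=\pi|_{E_\pm}:E_\pm\to TM$ are isomorphisms, and $g$ is the semi-Riemannian metric on $M$ with $(\pi_\pm)^*g=\mathcal G|_{E_\pm\times E_\pm}$. $\nabla$ is the Levi-Civita connection of $g$. The scalar product is normalised so that $E$ is identified with $TM\oplus T^*M$ with $\langle X+\xi,Y+\zeta\rangle=\frac12(\xi(Y)+\zeta(X))$ and Dorfman bracket twisted by a closed three-form $H$,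 via the isomorphism $\phi$ with $\phi|_{E_\pm}=(1\pm g)\circ\pi_\pm$. **Generalised connections.** A generalised connection is an $\mathbb R$-bilinear map $D:\Gamma(E)\times\Gamma(E)\to\Gamma(E)$, $(u,v)\mapsto D_uv$, $C^\infty(M)$-linear in $u$, with $D_u(fv)=(\pi(u)f)v+fD_uv$ and $\pi(u)\langle v,w\rangle=\langle D_uv,w\rangle+\langle v,D_uw\rangle$. Its torsion is $T(u,v,w)=\langle D_uv-D_vu-[u,v],w\rangle+\langle D_wu,v\rangle$. It is metric if $D\mathcal G=0$ (equivalently $D$ preserves $E_\pm$); a generalised Levi-Civita connection is a torsion-free metric generalised connection. A divergence operator is an $\mathbb R$-linear map $\mathrm{div}:\Gamma(E)\to C^\infty(M)$ with $\mathrm{div}(fv)=\pi(v)f+f\,\mathrm{div}(v)$; a generalised connection $D$ has the divergence operator $\mathrm{div}^D(v)=\mathrm{tr}(u\mapsto D_uv)$. The metric divergence operator is $\mathrm{div}^{\mathcal G}=\mathrm{div}^g\circ\pi$, with $\mathrm{div}^g$ the divergence of $g$ on vector fields. **The connection $D^0$.** Let $\widetilde D$ be the metric generalised connection with $\widetilde D_u=\pi_\pm^{-1}\circ\nabla_{\pi(u)}\circ\pi_\pm$ on $\Gamma(E_\pm)$ for $u\in\Gamma(E_\pm)$, and $\widetilde D_u=[u,\cdot]_\mp$ on $\Gamma(E_\mp)$ for $u\in\Gamma(E_\pm)$ (subscripts on brackets denote projection to $E_\mp$). Let $\widetilde T$ be its torsion (which is totally skew) and define $D^0$ by $\langle D^0_uv,w\rangle=\langle\widetilde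 D_uv,w\rangle-\frac13\widetilde T(u,v,w)$. This is a generalised Levi-Civita connection with $\mathrm{div}^{D^0}=\mathrm{div}^{\mathcal G}$. **Prolongation and trace.** $\mathfrak{so}(E)_{\mathcal G}$ is the stabiliser of $\mathcal G$ in $\mathfrak{so}(E)$ (skew endomorphisms preserving $E_\pm$), and $\mathfrak{so}(E)_{\mathcal G}^{\langle1\rangle}$ is the bundle of all $S\in E^*\otimes\mathfrak{so}(E)_{\mathcal G}$ with $\sum_{\mathrm{cycl}}S(u,v,w)=0$, where $S(u,v,w)=\langle S_uv,w\rangle$. The trace map $\mathrm{tr}:\mathfrak{so}(E)_{\mathcal G}^{\langle1\rangle}\to E^*$ is $\mathrm{tr}(S)(v)=\mathrm{tr}(u\mapsto S_uv)$. **Meaning of "canonical".** The connection is constructed geometrically from the pair $(\mathcal G,\mathrm{div})$ alone, with no further choices: $D^{\mathcal G,\mathrm{div}}$ is the generalised Levi-Civita connection characterised by having divergence operator $\mathrm{div}$ and by the property that the tensor $D^{\mathcal G,\mathrm{div}}-D^0$ is, at every point, perpendicular (with respect to the scalar product induced by $\langle\cdot,\cdot\rangle$) to the kernel of the trace map. In particular $D^{\mathcal G,\mathrm{div}^{\mathcal G}}=D^0$.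
   Formalization: The formal theorem assumes dim M ≥ 2: for dim M = 1 the bundles E_± are line bundles, so D^0 is the only generalised Levi-Civita connection and only div = div^G can be realised; the trivial case dim M = 0 is also left out. *)

theory Defs
  imports "HOL-Analysis.Analysis" "HOL-Library.Function_Algebras"
begin

text \<open>
  Real-valued functions, sections and tangent vectors are plain functions; the pointwise real
  vector space structure makes \<^const>\<open>span\<close>, \<^const>\<open>independent\<close> etc. available for them.
\<close>

instantiation "fun" :: (type, real_vector) real_vector
begin

definition scaleR_fun :: "real \<Rightarrow> ('a \<Rightarrow> 'b) \<Rightarrow> 'a \<Rightarrow> 'b" where
  "scaleR_fun r f = (\<lambda>x. r *\<^sub>R f x)"

instance
  by standard (auto simp: scaleR_fun_def fun_eq_iff algebra_simps)

end


section \<open>Linear algebra on subspaces\<close>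

definition linear_on :: "'v::real_vector set \<Rightarrow> ('v \<Rightarrow> 'w::real_vector) \<Rightarrow> bool" where
  "linear_on V f \<longleftrightarrow>
     (\<forall>a\<in>V. \<forall>b\<in>V. f (a + b) = f a + f b) \<and> (\<forall>a\<in>V. \<forall>r. f (r *\<^sub>R a) = r *\<^sub>R f a)"

definition bilinear_on :: "'v::real_vector set \<Rightarrow> ('v \<Rightarrow> 'v \<Rightarrow> 'w::real_vector) \<Rightarrow> bool" where
  "bilinear_on V f \<longleftrightarrow> (\<forall>a\<in>V. linear_on V (f a)) \<and> (\<forall>b\<in>V. linear_on V (\<lambda>a. f a b))"

definition nondegenerate_on :: "'v::real_vector set \<Rightarrow> ('v \<Rightarrow> 'v \<Rightarrow> real) \<Rightarrow> bool" where
  "nondegenerate_on V q \<longleftrightarrow> (\<forall>a\<in>V. (\<forall>b\<in>V. q a b = 0) \<longrightarrow> a = 0)"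

definition is_basis :: "'v::real_vector set \<Rightarrow> 'v set \<Rightarrow> bool" where
  "is_basis V B \<longleftrightarrow> B \<subseteq> V \<and> independent B \<and> V \<subseteq> span B"

definition some_basis :: "'v::real_vector set \<Rightarrow> 'v set" where
  "some_basis V = (SOME B. is_basis V B)"

definition trace_on :: "'v::real_vector set \<Rightarrow> ('v \<Rightarrow> 'v) \<Rightarrow> real" where
  "trace_on V f = (let B = some_basis V in \<Sum>b\<in>B. representation B (f b) b)"

definition dual_basis_vector ::
    "'v::real_vector set \<Rightarrow> ('v \<Rightarrow> 'v \<Rightarrow> real) \<Rightarrow> 'v set \<Rightarrow> 'v \<Rightarrow> 'v" where
  "dual_basis_vector V q B b = (THE d. d \<in> V \<and> (\<forall>c\<in>B. q d c = (if c = b then 1 else 0)))"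


section \<open>Smooth manifolds\<close>

fun Ck_on :: "nat \<Rightarrow> 'a::real_normed_vector set \<Rightarrow> ('a \<Rightarrow> 'b::real_normed_vector) \<Rightarrow> bool" where
  "Ck_on 0 S f \<longleftrightarrow> continuous_on S f"
| "Ck_on (Suc k) S f \<longleftrightarrow>
     (\<forall>x\<in>S. f differentiable (at x)) \<and> (\<forall>v. Ck_on k S (\<lambda>x. frechet_derivative f (at x) v))"

text \<open>Only used for open sets \<open>S\<close>.\<close>

definition smooth_on :: "'a::real_normed_vector set \<Rightarrow> ('a \<Rightarrow> 'b::real_normed_vector) \<Rightarrow> bool" where
  "smooth_on S f \<longleftrightarrow> (\<forall>k. Ck_on k S f)"

text \<open>
  The underlying set of the manifold is the whole type \<open>'m\<close>; its topology is Hausdorff and second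
  countable by the sort constraint. A chart is a pair of its domain and its coordinate map, and
  the dimension is \<open>DIM('a)\<close>. The atlas is not required to be maximal.
\<close>

type_synonym ('m, 'a) atlas = "('m set \<times> ('m \<Rightarrow> 'a)) set"

definition smooth_manifold ::
    "('m::{t2_space, second_countable_topology}, 'a::euclidean_space) atlas \<Rightarrow> bool" where
  "smooth_manifold A \<longleftrightarrow>
     (\<Union>(U, \<phi>)\<in>A. U) = UNIV \<and>
     (\<forall>(U, \<phi>)\<in>A. open U \<and> open (\<phi> ` U) \<and> homeomorphism U (\<phi> ` U) \<phi> (inv_into U \<phi>)) \<and>
     (\<forall>(U, \<phi>)\<in>A. \<forall>(V, \<psi>)\<in>A. smooth_on (\<phi> ` (U \<inter> V)) (\<psi> \<circ> inv_into U \<phi>))"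

definition smooth_fun_on :: "('m, 'a::euclidean_space) atlas \<Rightarrow> 'm set \<Rightarrow> ('m \<Rightarrow> real) \<Rightarrow> bool" where
  "smooth_fun_on A W f \<longleftrightarrow> (\<forall>(U, \<phi>)\<in>A. smooth_on (\<phi> ` (U \<inter> W)) (f \<circ> inv_into U \<phi>))"

definition smooth_functions :: "('m, 'a::euclidean_space) atlas \<Rightarrow> ('m \<Rightarrow> real) set" where
  "smooth_functions A = {f. smooth_fun_on A UNIV f}"

text \<open>
  Tangent vectors at \<open>p\<close> are the derivations at \<open>p\<close> of the algebra of smooth functions, set to
  \<open>0\<close> on non-smooth functions, so that they form a linear subspace.
\<close>

type_synonym 'm tangent = "('m \<Rightarrow> real) \<Rightarrow> real"

definition tangent_space :: "('m, 'a::euclidean_space) atlas \<Rightarrow> 'm \<Rightarrow> 'm tangent set" where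
  "tangent_space A p = {x. linear_on (smooth_functions A) x \<and>
     (\<forall>f\<in>smooth_functions A. \<forall>h\<in>smooth_functions A. x (\<lambda>q. f q * h q) = x f * h p + f p * x h) \<and>
     (\<forall>f. f \<notin> smooth_functions A \<longrightarrow> x f = 0)}"

definition cotangent_space :: "('m, 'a::euclidean_space) atlas \<Rightarrow> 'm \<Rightarrow> ('m tangent \<Rightarrow> real) set" where
  "cotangent_space A p = {\<xi>. \<xi> \<in> extensional (tangent_space A p) \<and> linear_on (tangent_space A p) \<xi>}"

definition vector_fields :: "('m, 'a::euclidean_space) atlas \<Rightarrow> ('m \<Rightarrow> 'm tangent) set" where
  "vector_fields A = {X. (\<forall>p. X p \<in> tangent_space A p) \<and>
     (\<forall>f\<in>smooth_functions A. (\<lambda>p. X p f) \<in> smooth_functions A)}"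

definition derivative_along :: "('m \<Rightarrow> 'm tangent) \<Rightarrow> ('m \<Rightarrow> real) \<Rightarrow> 'm \<Rightarrow> real" where
  "derivative_along X f = (\<lambda>p. X p f)"

definition lie_bracket ::
    "('m, 'a::euclidean_space) atlas \<Rightarrow> ('m \<Rightarrow> 'm tangent) \<Rightarrow> ('m \<Rightarrow> 'm tangent) \<Rightarrow> 'm \<Rightarrow> 'm tangent" where
  "lie_bracket A X Y = (\<lambda>p f. if f \<in> smooth_functions A
     then X p (derivative_along Y f) - Y p (derivative_along X f) else 0)"

definition fscale :: "('m \<Rightarrow> real) \<Rightarrow> ('m \<Rightarrow> 'v::real_vector) \<Rightarrow> 'm \<Rightarrow> 'v" where
  "fscale f s = (\<lambda>p. f p *\<^sub>R s p)"

text \<open>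
  For \<open>op\<close> linear over the smooth functions on a module \<open>\<Gamma>\<close> of sections, \<open>value_at \<Gamma> op p a\<close> is
  the induced map of fibres over \<open>p\<close>, evaluated at \<open>a\<close>.
\<close>

definition value_at :: "('m \<Rightarrow> 'v) set \<Rightarrow> (('m \<Rightarrow> 'v) \<Rightarrow> 'm \<Rightarrow> 'w) \<Rightarrow> 'm \<Rightarrow> 'v \<Rightarrow> 'w" where
  "value_at \<Gamma> op p a = op (SOME s. s \<in> \<Gamma> \<and> s p = a) p"


section \<open>Levi-Civita connection and divergence of a metric\<close>

definition affine_levi_civita :: "('m, 'a::euclidean_space) atlas \<Rightarrow>
    ('m \<Rightarrow> 'm tangent \<Rightarrow> 'm tangent \<Rightarrow> real) \<Rightarrow>
    (('m \<Rightarrow> 'm tangent) \<Rightarrow> ('m \<Rightarrow> 'm tangent) \<Rightarrow> 'm \<Rightarrow> 'm tangent) \<Rightarrow> bool" where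
  "affine_levi_civita A g nab \<longleftrightarrow>
     (let \<XX> = vector_fields A; C = smooth_functions A in
       (\<forall>X\<in>\<XX>. \<forall>Y\<in>\<XX>. nab X Y \<in> \<XX>) \<and>
       bilinear_on \<XX> nab \<and>
       (\<forall>f\<in>C. \<forall>X\<in>\<XX>. \<forall>Y\<in>\<XX>. nab (fscale f X) Y = fscale f (nab X Y)) \<and>
       (\<forall>f\<in>C. \<forall>X\<in>\<XX>. \<forall>Y\<in>\<XX>.
          nab X (fscale f Y) = fscale (derivative_along X f) Y + fscale f (nab X Y)) \<and>
       (\<forall>X\<in>\<XX>. \<forall>Y\<in>\<XX>. \<forall>Z\<in>\<XX>. \<forall>p.
          derivative_along X (\<lambda>q. g q (Y q) (Z q)) p
            = g p (nab X Y p) (Z p) + g p (Y p) (nab X Z p)) \<and>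
       (\<forall>X\<in>\<XX>. \<forall>Y\<in>\<XX>. nab X Y - nab Y X = lie_bracket A X Y))"

text \<open>On vector fields the choice is unique, by the fundamental theorem of semi-Riemannian geometry.\<close>

definition levi_civita :: "('m, 'a::euclidean_space) atlas \<Rightarrow>
    ('m \<Rightarrow> 'm tangent \<Rightarrow> 'm tangent \<Rightarrow> real) \<Rightarrow>
    ('m \<Rightarrow> 'm tangent) \<Rightarrow> ('m \<Rightarrow> 'm tangent) \<Rightarrow> 'm \<Rightarrow> 'm tangent" where
  "levi_civita A g = (SOME nab. affine_levi_civita A g nab)"

text \<open>\<open>div\<^sup>g X = tr (\<nabla>X)\<close>\<close>

definition metric_div :: "('m, 'a::euclidean_space) atlas \<Rightarrow>
    ('m \<Rightarrow> 'm tangent \<Rightarrow> 'm tangent \<Rightarrow> real) \<Rightarrow> ('m \<Rightarrow> 'm tangent) \<Rightarrow> 'm \<Rightarrow> real" where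
  "metric_div A g X = (\<lambda>p. trace_on (tangent_space A p)
     (value_at (vector_fields A) (\<lambda>Y. levi_civita A g Y X) p))"


section \<open>Vector bundles\<close>

text \<open>
  The fibres are subspaces of one real vector space \<open>'e\<close> (for an arbitrary bundle one may take
  the direct sum of all its fibres). Neither this space nor the way the fibres sit in it has any
  geometric meaning: the smooth structure is given by the local frames \<open>e 0, ..., e (rk - 1)\<close>
  over open sets.
\<close>

record ('m, 'a, 'e) vbundle =
  base :: "('m, 'a) atlas"
  fibre :: "'m \<Rightarrow> 'e set"
  rk :: nat
  frames :: "('m set \<times> (nat \<Rightarrow> 'm \<Rightarrow> 'e)) set"

definition smooth_on_frame ::
    "('m, 'a::euclidean_space, 'e::real_vector, 'z) vbundle_scheme \<Rightarrow> 'm set \<Rightarrow>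
     'm set \<times> (nat \<Rightarrow> 'm \<Rightarrow> 'e) \<Rightarrow> ('m \<Rightarrow> 'e) \<Rightarrow> bool" where
  "smooth_on_frame E W F s \<longleftrightarrow> (case F of (U, e) \<Rightarrow>
     \<exists>c. (\<forall>i<rk E. smooth_fun_on (base E) (U \<inter> W) (c i)) \<and>
         (\<forall>p\<in>U \<inter> W. s p = (\<Sum>i<rk E. c i p *\<^sub>R e i p)))"

definition vector_bundle ::
    "('m::{t2_space, second_countable_topology}, 'a::euclidean_space, 'e::real_vector, 'z) vbundle_scheme
      \<Rightarrow> bool" where
  "vector_bundle E \<longleftrightarrow>
     smooth_manifold (base E) \<and>
     (\<forall>p. subspace (fibre E p)) \<and>
     (\<Union>(U, e)\<in>frames E. U) = UNIV \<and>
     (\<forall>(U, e)\<in>frames E. open U \<and>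
        (\<forall>p\<in>U. inj_on (\<lambda>i. e i p) {..<rk E} \<and> is_basis (fibre E p) ((\<lambda>i. e i p) ` {..<rk E}))) \<and>
     (\<forall>F\<in>frames E. \<forall>(V, e)\<in>frames E. \<forall>i<rk E. smooth_on_frame E V F (e i))"

definition sections ::
    "('m, 'a::euclidean_space, 'e::real_vector, 'z) vbundle_scheme \<Rightarrow> ('m \<Rightarrow> 'e) set" where
  "sections E = {s. (\<forall>p. s p \<in> fibre E p) \<and> (\<forall>F\<in>frames E. smooth_on_frame E UNIV F s)}"

definition fibre_metric ::
    "('m, 'a::euclidean_space, 'e::real_vector, 'z) vbundle_scheme \<Rightarrow> ('m \<Rightarrow> 'e \<Rightarrow> 'e \<Rightarrow> real) \<Rightarrow> bool" where
  "fibre_metric E q \<longleftrightarrow>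
     (\<forall>p. bilinear_on (fibre E p) (q p) \<and>
          (\<forall>a\<in>fibre E p. \<forall>b\<in>fibre E p. q p a b = q p b a) \<and>
          nondegenerate_on (fibre E p) (q p)) \<and>
     (\<forall>u\<in>sections E. \<forall>v\<in>sections E. (\<lambda>p. q p (u p) (v p)) \<in> smooth_functions (base E))"


section \<open>Exact Courant algebroids\<close>

record ('m, 'a, 'e) courant = "('m, 'a, 'e) vbundle" +
  pairing :: "'m \<Rightarrow> 'e \<Rightarrow> 'e \<Rightarrow> real"
  anchor :: "'m \<Rightarrow> 'e \<Rightarrow> 'm tangent"
  dorfman :: "('m \<Rightarrow> 'e) \<Rightarrow> ('m \<Rightarrow> 'e) \<Rightarrow> 'm \<Rightarrow> 'e"

definition pair_sections ::
    "('m, 'a, 'e) courant \<Rightarrow> ('m \<Rightarrow> 'e) \<Rightarrow> ('m \<Rightarrow> 'e) \<Rightarrow> 'm \<Rightarrow> real" where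
  "pair_sections E u v = (\<lambda>p. pairing E p (u p) (v p))"

definition anchor_section :: "('m, 'a, 'e) courant \<Rightarrow> ('m \<Rightarrow> 'e) \<Rightarrow> 'm \<Rightarrow> 'm tangent" where
  "anchor_section E u = (\<lambda>p. anchor E p (u p))"

text \<open>\<open>\<pi>(u) f\<close>\<close>

definition act :: "('m, 'a, 'e) courant \<Rightarrow> ('m \<Rightarrow> 'e) \<Rightarrow> ('m \<Rightarrow> real) \<Rightarrow> 'm \<Rightarrow> real" where
  "act E u f = derivative_along (anchor_section E u) f"

definition courant_algebroid ::
    "('m::{t2_space, second_countable_topology}, 'a::euclidean_space, 'e::real_vector) courant \<Rightarrow> bool" where
  "courant_algebroid E \<longleftrightarrow>
     vector_bundle E \<and>
     fibre_metric E (pairing E) \<and>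
     (\<forall>p. linear_on (fibre E p) (anchor E p) \<and> anchor E p ` fibre E p \<subseteq> tangent_space (base E) p) \<and>
     (\<forall>u\<in>sections E. anchor_section E u \<in> vector_fields (base E)) \<and>
     (\<forall>u\<in>sections E. \<forall>v\<in>sections E. dorfman E u v \<in> sections E) \<and>
     bilinear_on (sections E) (dorfman E) \<and>
     (\<forall>u\<in>sections E. \<forall>v\<in>sections E. \<forall>w\<in>sections E.
        dorfman E u (dorfman E v w) = dorfman E (dorfman E u v) w + dorfman E v (dorfman E u w)) \<and>
     (\<forall>u\<in>sections E. \<forall>v\<in>sections E.
        anchor_section E (dorfman E u v)
          = lie_bracket (base E) (anchor_section E u) (anchor_section E v)) \<and>
     (\<forall>u\<in>sections E. \<forall>v\<in>sections E. \<forall>f\<in>smooth_functions (base E).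
        dorfman E u (fscale f v) = fscale (act E u f) v + fscale f (dorfman E u v)) \<and>
     (\<forall>u\<in>sections E. \<forall>v\<in>sections E. \<forall>w\<in>sections E.
        act E u (pair_sections E v w)
          = pair_sections E (dorfman E u v) w + pair_sections E v (dorfman E u w)) \<and>
     (\<forall>u\<in>sections E. \<forall>v\<in>sections E. \<forall>w\<in>sections E.
        pair_sections E (dorfman E u v + dorfman E v u) w = act E w (pair_sections E u v))"

text \<open>
  The map \<open>T\<^sup>*M \<rightarrow> E\<close>; the factor is the one of the pairing
  \<open>\<langle>X + \<xi>, Y + \<zeta>\<rangle> = 1/2 (\<xi>(Y) + \<zeta>(X))\<close>.
\<close>

definition coanchor ::
    "('m, 'a::euclidean_space, 'e::real_vector) courant \<Rightarrow> 'm \<Rightarrow> ('m tangent \<Rightarrow> real) \<Rightarrow> 'e" where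
  "coanchor E p \<xi> = (THE a. a \<in> fibre E p \<and>
     (\<forall>b\<in>fibre E p. pairing E p a b = (1/2) * \<xi> (anchor E p b)))"

definition exact_courant_algebroid ::
    "('m::{t2_space, second_countable_topology}, 'a::euclidean_space, 'e::real_vector) courant \<Rightarrow> bool" where
  "exact_courant_algebroid E \<longleftrightarrow>
     courant_algebroid E \<and>
     (\<forall>p. inj_on (coanchor E p) (cotangent_space (base E) p) \<and>
          coanchor E p ` cotangent_space (base E) p = {a \<in> fibre E p. anchor E p a = 0} \<and>
          anchor E p ` fibre E p = tangent_space (base E) p)"


section \<open>Generalised metrics\<close>

definition metric_end ::
    "('m, 'a, 'e::real_vector) courant \<Rightarrow> ('m \<Rightarrow> 'e \<Rightarrow> 'e \<Rightarrow> real) \<Rightarrow> 'm \<Rightarrow> 'e \<Rightarrow> 'e" where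
  "metric_end E G p a = (THE b. b \<in> fibre E p \<and> (\<forall>c\<in>fibre E p. pairing E p b c = G p a c))"

definition generalised_metric ::
    "('m, 'a::euclidean_space, 'e::real_vector) courant \<Rightarrow> ('m \<Rightarrow> 'e \<Rightarrow> 'e \<Rightarrow> real) \<Rightarrow> bool" where
  "generalised_metric E G \<longleftrightarrow>
     fibre_metric E G \<and>
     (\<forall>p. \<forall>a\<in>fibre E p. metric_end E G p (metric_end E G p a) = a) \<and>
     (\<forall>p. nondegenerate_on (coanchor E p ` cotangent_space (base E) p) (G p))"

text \<open>
  In the following the argument \<open>s\<close> is one of the signs \<open>1\<close> and \<open>-1\<close>, distinguishing \<open>E\<^sub>+\<close>
  and \<open>E\<^sub>-\<close>.
\<close>

definition eigenbundle ::
    "('m, 'a, 'e::real_vector) courant \<Rightarrow> ('m \<Rightarrow> 'e \<Rightarrow> 'e \<Rightarrow> real) \<Rightarrow> real \<Rightarrow> 'm \<Rightarrow> 'e set" where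
  "eigenbundle E G s p = {a \<in> fibre E p. metric_end E G p a = s *\<^sub>R a}"

definition proj ::
    "('m, 'a, 'e::real_vector) courant \<Rightarrow> ('m \<Rightarrow> 'e \<Rightarrow> 'e \<Rightarrow> real) \<Rightarrow> real \<Rightarrow> ('m \<Rightarrow> 'e) \<Rightarrow> 'm \<Rightarrow> 'e" where
  "proj E G s u = (\<lambda>p. (1/2) *\<^sub>R (u p + s *\<^sub>R metric_end E G p (u p)))"

text \<open>The inverse of the isomorphism \<open>\<pi>\<^sub>\<plusminus>\<close> obtained by restricting the anchor to \<open>E\<^sub>\<plusminus>\<close>\<close>

definition lift ::
    "('m, 'a, 'e::real_vector) courant \<Rightarrow> ('m \<Rightarrow> 'e \<Rightarrow> 'e \<Rightarrow> real) \<Rightarrow> real \<Rightarrow> 'm \<Rightarrow> 'm tangent \<Rightarrow> 'e" where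
  "lift E G s p x = (THE a. a \<in> eigenbundle E G s p \<and> anchor E p a = x)"

text \<open>
  The metric on the base whose pullback along \<open>\<pi>\<^sub>+\<close> is the restriction of \<open>G\<close>. The kernel of the
  anchor being isotropic, \<open>\<pi>\<^sub>-\<close> yields the same metric.
\<close>

definition base_metric ::
    "('m, 'a, 'e::real_vector) courant \<Rightarrow> ('m \<Rightarrow> 'e \<Rightarrow> 'e \<Rightarrow> real) \<Rightarrow> 'm \<Rightarrow> 'm tangent \<Rightarrow> 'm tangent \<Rightarrow> real" where
  "base_metric E G p x y = G p (lift E G 1 p x) (lift E G 1 p y)"


section \<open>Generalised connections and divergence operators\<close>

type_synonym ('m, 'e) gen_connection = "('m \<Rightarrow> 'e) \<Rightarrow> ('m \<Rightarrow> 'e) \<Rightarrow> 'm \<Rightarrow> 'e"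

definition generalised_connection ::
    "('m, 'a::euclidean_space, 'e::real_vector) courant \<Rightarrow> ('m, 'e) gen_connection \<Rightarrow> bool" where
  "generalised_connection E D \<longleftrightarrow>
     (\<forall>u\<in>sections E. \<forall>v\<in>sections E. D u v \<in> sections E) \<and>
     bilinear_on (sections E) D \<and>
     (\<forall>f\<in>smooth_functions (base E). \<forall>u\<in>sections E. \<forall>v\<in>sections E.
        D (fscale f u) v = fscale f (D u v)) \<and>
     (\<forall>f\<in>smooth_functions (base E). \<forall>u\<in>sections E. \<forall>v\<in>sections E.
        D u (fscale f v) = fscale (act E u f) v + fscale f (D u v)) \<and>
     (\<forall>u\<in>sections E. \<forall>v\<in>sections E. \<forall>w\<in>sections E.
        act E u (pair_sections E v w) = pair_sections E (D u v) w + pair_sections E v (D u w))"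

definition gen_torsion ::
    "('m, 'a, 'e::real_vector) courant \<Rightarrow> ('m, 'e) gen_connection \<Rightarrow>
     ('m \<Rightarrow> 'e) \<Rightarrow> ('m \<Rightarrow> 'e) \<Rightarrow> ('m \<Rightarrow> 'e) \<Rightarrow> 'm \<Rightarrow> real" where
  "gen_torsion E D u v w =
     pair_sections E (D u v - D v u - dorfman E u v) w + pair_sections E (D w u) v"

definition metric_connection ::
    "('m, 'a::euclidean_space, 'e::real_vector) courant \<Rightarrow> ('m \<Rightarrow> 'e \<Rightarrow> 'e \<Rightarrow> real) \<Rightarrow>
     ('m, 'e) gen_connection \<Rightarrow> bool" where
  "metric_connection E G D \<longleftrightarrow>
     (\<forall>u\<in>sections E. \<forall>v\<in>sections E. \<forall>w\<in>sections E. \<forall>p.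
        act E u (\<lambda>q. G q (v q) (w q)) p = G p (D u v p) (w p) + G p (v p) (D u w p))"

definition generalised_levi_civita ::
    "('m, 'a::euclidean_space, 'e::real_vector) courant \<Rightarrow> ('m \<Rightarrow> 'e \<Rightarrow> 'e \<Rightarrow> real) \<Rightarrow>
     ('m, 'e) gen_connection \<Rightarrow> bool" where
  "generalised_levi_civita E G D \<longleftrightarrow>
     generalised_connection E D \<and> metric_connection E G D \<and>
     (\<forall>u\<in>sections E. \<forall>v\<in>sections E. \<forall>w\<in>sections E. gen_torsion E D u v w = 0)"

definition divergence_operator ::
    "('m, 'a::euclidean_space, 'e::real_vector) courant \<Rightarrow> (('m \<Rightarrow> 'e) \<Rightarrow> 'm \<Rightarrow> real) \<Rightarrow> bool" where
  "divergence_operator E dv \<longleftrightarrow>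
     (\<forall>v\<in>sections E. dv v \<in> smooth_functions (base E)) \<and>
     linear_on (sections E) dv \<and>
     (\<forall>f\<in>smooth_functions (base E). \<forall>v\<in>sections E.
        dv (fscale f v) = act E v f + fscale f (dv v))"

definition divergence_of ::
    "('m, 'a::euclidean_space, 'e::real_vector) courant \<Rightarrow> ('m, 'e) gen_connection \<Rightarrow>
     ('m \<Rightarrow> 'e) \<Rightarrow> 'm \<Rightarrow> real" where
  "divergence_of E D v = (\<lambda>p. trace_on (fibre E p) (value_at (sections E) (\<lambda>u. D u v) p))"

definition metric_divergence ::
    "('m, 'a::euclidean_space, 'e::real_vector) courant \<Rightarrow> ('m \<Rightarrow> 'e \<Rightarrow> 'e \<Rightarrow> real) \<Rightarrow>
     ('m \<Rightarrow> 'e) \<Rightarrow> 'm \<Rightarrow> real" where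
  "metric_divergence E G v = metric_div (base E) (base_metric E G) (anchor_section E v)"


section \<open>The connection \<open>D\<^sup>0\<close>\<close>

definition D_tilde ::
    "('m, 'a::euclidean_space, 'e::real_vector) courant \<Rightarrow> ('m \<Rightarrow> 'e \<Rightarrow> 'e \<Rightarrow> real) \<Rightarrow>
     ('m, 'e) gen_connection" where
  "D_tilde E G u v = (\<lambda>p. \<Sum>s\<in>{1, -1}.
     lift E G s p (levi_civita (base E) (base_metric E G)
       (anchor_section E (proj E G s u)) (anchor_section E (proj E G s v)) p)
     + proj E G (- s) (dorfman E (proj E G s u) (proj E G (- s) v)) p)"

definition D_zero ::
    "('m, 'a::euclidean_space, 'e::real_vector) courant \<Rightarrow> ('m \<Rightarrow> 'e \<Rightarrow> 'e \<Rightarrow> real) \<Rightarrow>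
     ('m, 'e) gen_connection" where
  "D_zero E G u v = (THE z. z \<in> sections E \<and> (\<forall>w\<in>sections E. \<forall>p.
     pair_sections E z w p =
       pair_sections E (D_tilde E G u v) w p - (1/3) * gen_torsion E (D_tilde E G) u v w p))"


section \<open>The first prolongation and the canonical connection\<close>

text \<open>
  \<open>so_prolongation E G p\<close> is the fibre over \<open>p\<close> of the first prolongation of \<open>so(E)\<^sub>G\<close>; the
  element \<open>S a\<close> of \<open>so(E)\<^sub>G\<close> is written as a function on the fibre. Values outside the fibre are
  irrelevant.
\<close>

definition so_prolongation ::
    "('m, 'a, 'e::real_vector) courant \<Rightarrow> ('m \<Rightarrow> 'e \<Rightarrow> 'e \<Rightarrow> real) \<Rightarrow> 'm \<Rightarrow> ('e \<Rightarrow> 'e \<Rightarrow> 'e) set" where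
  "so_prolongation E G p = {S.
     (\<forall>a\<in>fibre E p. \<forall>b\<in>fibre E p. S a b \<in> fibre E p) \<and>
     bilinear_on (fibre E p) S \<and>
     (\<forall>a\<in>fibre E p. \<forall>b\<in>fibre E p. \<forall>c\<in>fibre E p.
        pairing E p (S a b) c + pairing E p b (S a c) = 0 \<and>
        G p (S a b) c + G p b (S a c) = 0 \<and>
        pairing E p (S a b) c + pairing E p (S b c) a + pairing E p (S c a) b = 0)}"

text \<open>
  On a one-dimensional base \<open>E\<^sub>+\<close> and \<open>E\<^sub>-\<close> are line bundles, so \<open>so(E)\<^sub>G = 0\<close> and the trace map is not
  onto \<open>E\<^sup>*\<close>: the only metric connection is \<open>D\<^sup>0\<close>, whatever the divergence operator. Dimension one
  must therefore be excluded in the theorem.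
\<close>

definition trace_map ::
    "('m, 'a, 'e::real_vector) courant \<Rightarrow> 'm \<Rightarrow> ('e \<Rightarrow> 'e \<Rightarrow> 'e) \<Rightarrow> 'e \<Rightarrow> real" where
  "trace_map E p S b = trace_on (fibre E p) (\<lambda>a. S a b)"

definition trace_kernel ::
    "('m, 'a, 'e::real_vector) courant \<Rightarrow> ('m \<Rightarrow> 'e \<Rightarrow> 'e \<Rightarrow> real) \<Rightarrow> 'm \<Rightarrow> ('e \<Rightarrow> 'e \<Rightarrow> 'e) set" where
  "trace_kernel E G p = {S \<in> so_prolongation E G p. \<forall>b\<in>fibre E p. trace_map E p S b = 0}"

text \<open>
  The scalar product induced by the pairing on \<open>E\<^sup>* \<otimes> E\<^sup>* \<otimes> E\<close>, computed in a basis \<open>e\<^sub>i\<close> and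
  its dual basis \<open>e\<^sup>i\<close> as the sum of all \<open>\<langle>S e\<^sub>i e\<^sub>j, K e\<^sup>i e\<^sup>j\<rangle>\<close>.
\<close>

definition tensor_product ::
    "('m, 'a, 'e::real_vector) courant \<Rightarrow> 'm \<Rightarrow> ('e \<Rightarrow> 'e \<Rightarrow> 'e) \<Rightarrow> ('e \<Rightarrow> 'e \<Rightarrow> 'e) \<Rightarrow> real" where
  "tensor_product E p S K =
     (let V = fibre E p; q = pairing E p; B = some_basis V; d = dual_basis_vector V q B
      in \<Sum>a\<in>B. \<Sum>b\<in>B. q (S a b) (K (d a) (d b)))"

text \<open>\<open>S\<close> is the tensor field \<open>D - D'\<close>.\<close>

definition difference_tensor ::
    "('m, 'a::euclidean_space, 'e::real_vector) courant \<Rightarrow> ('m, 'e) gen_connection \<Rightarrow>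
     ('m, 'e) gen_connection \<Rightarrow> ('m \<Rightarrow> 'e \<Rightarrow> 'e \<Rightarrow> 'e) \<Rightarrow> bool" where
  "difference_tensor E D D' S \<longleftrightarrow>
     (\<forall>u\<in>sections E. \<forall>v\<in>sections E. \<forall>p. D u v p - D' u v p = S p (u p) (v p))"

definition canonical_connection ::
    "('m, 'a::euclidean_space, 'e::real_vector) courant \<Rightarrow> ('m \<Rightarrow> 'e \<Rightarrow> 'e \<Rightarrow> real) \<Rightarrow>
     (('m \<Rightarrow> 'e) \<Rightarrow> 'm \<Rightarrow> real) \<Rightarrow> ('m, 'e) gen_connection \<Rightarrow> bool" where
  "canonical_connection E G dv D \<longleftrightarrow>
     generalised_levi_civita E G D \<and>
     (\<forall>v\<in>sections E. divergence_of E D v = dv v) \<and>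
     (\<exists>S. difference_tensor E D (D_zero E G) S \<and>
        (\<forall>p. S p \<in> so_prolongation E G p \<and>
             (\<forall>K\<in>trace_kernel E G p. tensor_product E p (S p) K = 0)))"

end

theory Submission
  imports Defs
begin

text \<open>
  Torsion-free metric generalised connections form an affine space over the sections of the first
  prolongation \<open>\<Sigma>\<close> of \<open>so(E)\<^sub>G\<close>, and \<open>D\<^sup>0\<close> lies in it because the torsion of the auxiliary connection is
  totally skew and of pure type. For \<open>z\<close> in \<open>E\<close> the tensor
  \<open>\<chi>\<^sub>z(a, b) = \<Sum>\<^sub>\<plusminus> \<langle>a\<^sub>\<plusminus>, b\<^sub>\<plusminus>\<rangle> z\<^sub>\<plusminus> - \<langle>z\<^sub>\<plusminus>, b\<^sub>\<plusminus>\<rangle> a\<^sub>\<plusminus>\<close> lies in \<open>\<Sigma>\<close>, has trace \<open>(1 - n) \<langle>z, -\<rangle>\<close> and satisfies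
  \<open>\<langle>\<chi>\<^sub>z, K\<rangle> = -2 tr K(z)\<close>. For \<open>n \<noteq> 1\<close> the \<open>\<chi>\<^sub>z\<close> therefore form the orthogonal complement of the kernel
  of the trace map and realise every trace exactly once. The scalar product on \<open>\<Sigma>\<close> is nondegenerate
  since \<open>\<Sigma>\<close> is spanned by projected decomposable tensors.

  The Levi-Civita connection of \<open>g\<close> is obtained without the Koszul formula, as the mean of the two
  metric connections \<open>\<pi>([X\<^sub>\<mp>, Y\<^sub>\<plusminus>]\<^sub>\<plusminus>)\<close>. Smoothness of pointwise constructions is reduced to one principle:
  a section is smooth if enough smooth covectors, separating the points of the fibre, are smooth on it.
\<close>

section \<open>Finite-dimensional subspaces\<close>

text \<open>The obstacle is that the pairing and \<open>G\<close> may be indefinite. A subspace may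
  then meet its orthogonal complement, so perpendicularity to the kernel of the trace map does not
  by itself pin down a tensor. Uniqueness is rescued by two formulas: a tensor that lies in the
  kernel and is perpendicular to it is also perpendicular to every \<chi>, by the contraction
  formula, and the kernel together with the \<chi> fills the prolongation when n is not 1.
  Nondegeneracy there makes the tensor zero. The factor 1 - n is a rank-one trace minus the rank n
  of an eigenbundle, n being half the rank of E. The constant 1/3 in D^0 has a similar origin: a
  totally skew tensor is invariant under cyclic permutation, so adding c times the torsion to a
  connection changes its torsion by 3c times itself. Fibres are subspaces of a space without
  topology, and traces, duals and lifts are defined point by point, by choice or description; each
  such construction therefore needs its own proof of smoothness. Tangent vectors are derivations,
  and their finite dimension is read off from the surjective anchor.\<close>

lemma linear_onI:
  assumes "\<And>a b. a \<in> V \<Longrightarrow> b \<in> V \<Longrightarrow> f (a + b) = f a + f b"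
    and "\<And>a r. a \<in> V \<Longrightarrow> f (r *\<^sub>R a) = r *\<^sub>R f a"
  shows "linear_on V f"
  using assms by (auto simp: linear_on_def)

lemma linear_on_add: "linear_on V f \<Longrightarrow> a \<in> V \<Longrightarrow> b \<in> V \<Longrightarrow> f (a + b) = f a + f b"
  by (auto simp: linear_on_def)

lemma linear_on_scale: "linear_on V f \<Longrightarrow> a \<in> V \<Longrightarrow> f (r *\<^sub>R a) = r *\<^sub>R f a"
  by (auto simp: linear_on_def)

lemma linear_on_minus: "linear_on V f \<Longrightarrow> a \<in> V \<Longrightarrow> f (- a) = - f a"
  using linear_on_scale[of V f a "-1"] by simp

lemma linear_on_zero: "linear_on V f \<Longrightarrow> subspace V \<Longrightarrow> f 0 = 0"
  using linear_on_scale[of V f 0 0] by (simp add: subspace_0)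

lemma linear_on_diff:
  "linear_on V f \<Longrightarrow> subspace V \<Longrightarrow> a \<in> V \<Longrightarrow> b \<in> V \<Longrightarrow> f (a - b) = f a - f b"
  using linear_on_add[of V f a "- b"] linear_on_minus[of V f b] by (simp add: subspace_neg)

lemma linear_on_sum:
  assumes "linear_on V f" "subspace V" "\<And>i. i \<in> I \<Longrightarrow> x i \<in> V"
  shows "f (sum x I) = (\<Sum>i\<in>I. f (x i))"
  using assms(3)
  by (induction I rule: infinite_finite_induct)
    (auto simp: linear_on_zero[OF assms(1,2)] linear_on_add[OF assms(1)] subspace_sum[OF assms(2)])

lemma linear_on_lincomb:
  assumes "linear_on V f" "subspace V" "\<And>i. i \<in> I \<Longrightarrow> x i \<in> V"
  shows "f (\<Sum>i\<in>I. c i *\<^sub>R x i) = (\<Sum>i\<in>I. c i *\<^sub>R f (x i))"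
  using assms by (subst linear_on_sum[OF assms(1,2)]) (auto simp: linear_on_scale subspace_scale)

lemma bilinear_onD:
  assumes "bilinear_on V f" "a \<in> V"
  shows "linear_on V (f a)" "linear_on V (\<lambda>b. f b a)"
  using assms by (auto simp: bilinear_on_def)

text \<open>The ambient types (functions on functions, an arbitrary space containing the fibres) may
  be infinite-dimensional, so finiteness is made a property of the subspace
  \<open>V\<close>.\<close>

locale findim =
  fixes V :: "'v::real_vector set"
  assumes subspace: "subspace V"
    and finite_basis: "\<exists>B. finite B \<and> is_basis V B"
begin

lemma basis_finite:
  assumes "is_basis V B" shows "finite B"
proof -
  obtain B0 where "finite B0" "is_basis V B0" using finite_basis by blast
  then show ?thesis using assms independent_span_bound[of B0 B] unfolding is_basis_def by blast
qed

lemma some_basis: "is_basis V (some_basis V)" "finite (some_basis V)"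
proof -
  show "is_basis V (some_basis V)"
    using finite_basis someI_ex[of "is_basis V"] by (auto simp: some_basis_def)
  then show "finite (some_basis V)" by (rule basis_finite)
qed

lemma some_basis_mem: "b \<in> some_basis V \<Longrightarrow> b \<in> V"
  using some_basis(1) by (auto simp: is_basis_def)

lemma span_basis: "is_basis V B \<Longrightarrow> span B = V"
  using subspace by (auto simp: is_basis_def span_minimal subset_antisym)

lemma linear_on_representation:
  assumes "is_basis V B"
  shows "linear_on V (\<lambda>x. representation B x b)"
  using assms span_basis[OF assms]
  by (intro linear_onI) (auto simp: is_basis_def representation_add representation_scale)

lemma basis_sum:
  assumes "is_basis V B" "x \<in> V"
  shows "(\<Sum>b\<in>B. representation B x b *\<^sub>R b) = x"
  using assms basis_finite[OF assms(1)] by (intro sum_representation_eq) (auto simp: is_basis_def)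

text \<open>Expanding basis vectors in the family and images of the family in the basis gives the
  same double sum. In this generality it covers local frames, the chosen basis and the dual basis
  alike, and so frees the trace from the choice in \<open>some_basis\<close>.\<close>

lemma trace_on_family:
  assumes f: "linear_on V f" "\<And>x. x \<in> V \<Longrightarrow> f x \<in> V"
    and e: "\<And>i. i \<in> I \<Longrightarrow> e i \<in> V"
    and eps: "\<And>i. i \<in> I \<Longrightarrow> linear_on V (eps i)"
    and resolution: "\<And>x. x \<in> V \<Longrightarrow> x = (\<Sum>i\<in>I. eps i x *\<^sub>R e i)"
  shows "trace_on V f = (\<Sum>i\<in>I. eps i (f (e i)))"
proof -
  let ?B = "some_basis V"
  let ?r = "\<lambda>x b. representation ?B x b"
  note B = some_basis(1)
  have "trace_on V f = (\<Sum>b\<in>?B. ?r (f b) b)" by (simp add: trace_on_def Let_def)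
  also have "\<dots> = (\<Sum>b\<in>?B. \<Sum>i\<in>I. eps i b * ?r (f (e i)) b)"
  proof (intro sum.cong refl)
    fix b assume "b \<in> ?B"
    then have b: "b \<in> V" by (rule some_basis_mem)
    have "f b = f (\<Sum>i\<in>I. eps i b *\<^sub>R e i)" using resolution[OF b] by simp
    also have "\<dots> = (\<Sum>i\<in>I. eps i b *\<^sub>R f (e i))" by (rule linear_on_lincomb[OF f(1) subspace e])
    finally show "?r (f b) b = (\<Sum>i\<in>I. eps i b * ?r (f (e i)) b)"
      by (simp add: linear_on_lincomb[OF linear_on_representation[OF B] subspace] f(2) e)
  qed
  also have "\<dots> = (\<Sum>i\<in>I. \<Sum>b\<in>?B. ?r (f (e i)) b * eps i b)"
    by (subst sum.swap) (simp add: mult.commute)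
  also have "\<dots> = (\<Sum>i\<in>I. eps i (f (e i)))"
  proof (intro sum.cong refl)
    fix i assume i: "i \<in> I"
    have "eps i (f (e i)) = eps i (\<Sum>b\<in>?B. ?r (f (e i)) b *\<^sub>R b)"
      by (simp add: basis_sum[OF B] f(2) e i)
    also have "\<dots> = (\<Sum>b\<in>?B. ?r (f (e i)) b * eps i b)"
      by (subst linear_on_lincomb[OF eps[OF i] subspace]) (auto simp: some_basis_mem)
    finally show "(\<Sum>b\<in>?B. ?r (f (e i)) b * eps i b) = eps i (f (e i))" by simp
  qed
  finally show ?thesis .
qed

lemma trace_on_cong: "(\<And>x. x \<in> V \<Longrightarrow> f x = g x) \<Longrightarrow> trace_on V f = trace_on V g"
  by (auto simp: trace_on_def Let_def some_basis_mem intro!: sum.cong)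

lemma trace_on_add:
  assumes "\<And>x. x \<in> V \<Longrightarrow> f x \<in> V" "\<And>x. x \<in> V \<Longrightarrow> g x \<in> V"
  shows "trace_on V (\<lambda>x. f x + g x) = trace_on V f + trace_on V g"
  using assms linear_on_add[OF linear_on_representation[OF some_basis(1)]]
  by (auto simp: trace_on_def Let_def sum.distrib[symmetric] some_basis_mem intro!: sum.cong)

lemma trace_on_scale:
  assumes "\<And>x. x \<in> V \<Longrightarrow> f x \<in> V"
  shows "trace_on V (\<lambda>x. r *\<^sub>R f x) = r * trace_on V f"
  using assms linear_on_scale[OF linear_on_representation[OF some_basis(1)]]
  by (auto simp: trace_on_def Let_def sum_distrib_left some_basis_mem intro!: sum.cong)

lemma trace_on_zero: "trace_on V (\<lambda>x. 0) = 0"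
  by (simp add: trace_on_def Let_def real_vector.representation_zero)

lemma trace_on_sum:
  assumes "finite I" "\<And>i x. i \<in> I \<Longrightarrow> x \<in> V \<Longrightarrow> f i x \<in> V"
  shows "trace_on V (\<lambda>x. \<Sum>i\<in>I. f i x) = (\<Sum>i\<in>I. trace_on V (f i))"
  using assms
  by (induction I rule: finite_induct)
    (auto simp: trace_on_zero trace_on_add subspace_sum[OF subspace])

lemma trace_on_id: "trace_on V (\<lambda>x. x) = card (some_basis V)"
  using some_basis by (simp add: trace_on_def Let_def is_basis_def representation_basis)

lemma trace_on_rank_one:
  assumes "linear_on V l" "v \<in> V"
  shows "trace_on V (\<lambda>x. l x *\<^sub>R v) = l v"
proof -
  let ?B = "some_basis V"
  have "trace_on V (\<lambda>x. l x *\<^sub>R v) = (\<Sum>b\<in>?B. representation ?B v b * l b)"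
    using linear_on_scale[OF linear_on_representation[OF some_basis(1)]] assms(2)
    by (auto simp: trace_on_def Let_def mult.commute intro!: sum.cong)
  also have "\<dots> = l (\<Sum>b\<in>?B. representation ?B v b *\<^sub>R b)"
    by (subst linear_on_lincomb[OF assms(1) subspace]) (auto simp: some_basis_mem)
  finally show ?thesis by (simp add: basis_sum[OF some_basis(1) assms(2)])
qed

end

text \<open>Both sides are the same double sum of matrix entries. It moves traces between a fibre of
  E and a tangent space, and shows that an endomorphism which vanishes on an eigenbundle containing
  its image is traceless.\<close>

lemma trace_on_comp_commute:
  assumes "findim V" "findim W"
    and f: "linear_on V f" "\<And>x. x \<in> V \<Longrightarrow> f x \<in> W"
    and h: "linear_on W h" "\<And>x. x \<in> W \<Longrightarrow> h x \<in> V"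
  shows "trace_on V (\<lambda>x. h (f x)) = trace_on W (\<lambda>x. f (h x))"
proof -
  interpret V: findim V by fact
  interpret W: findim W by fact
  let ?B = "some_basis V" and ?C = "some_basis W"
  have "trace_on V (\<lambda>x. h (f x)) = (\<Sum>b\<in>?B. \<Sum>c\<in>?C. representation ?C (f b) c * representation ?B (h c) b)"
    unfolding trace_on_def Let_def
  proof (intro sum.cong refl)
    fix b assume b: "b \<in> ?B"
    have "h (f b) = h (\<Sum>c\<in>?C. representation ?C (f b) c *\<^sub>R c)"
      using b by (simp add: W.basis_sum[OF W.some_basis(1)] f V.some_basis_mem)
    also have "\<dots> = (\<Sum>c\<in>?C. representation ?C (f b) c *\<^sub>R h c)"
      by (rule linear_on_lincomb[OF h(1) W.subspace]) (auto simp: W.some_basis_mem)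
    finally show "representation ?B (h (f b)) b
        = (\<Sum>c\<in>?C. representation ?C (f b) c * representation ?B (h c) b)"
      by (simp add: linear_on_lincomb[OF V.linear_on_representation[OF V.some_basis(1)] V.subspace]
          h W.some_basis_mem)
  qed
  also have "\<dots> = (\<Sum>c\<in>?C. \<Sum>b\<in>?B. representation ?B (h c) b * representation ?C (f b) c)"
    by (subst sum.swap) (simp add: mult.commute)
  also have "\<dots> = trace_on W (\<lambda>x. f (h x))"
    unfolding trace_on_def Let_def
  proof (intro sum.cong refl)
    fix c assume c: "c \<in> ?C"
    have "f (h c) = f (\<Sum>b\<in>?B. representation ?B (h c) b *\<^sub>R b)"
      using c by (simp add: V.basis_sum[OF V.some_basis(1)] h W.some_basis_mem)
    also have "\<dots> = (\<Sum>b\<in>?B. representation ?B (h c) b *\<^sub>R f b)"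
      by (rule linear_on_lincomb[OF f(1) V.subspace]) (auto simp: V.some_basis_mem)
    finally show "(\<Sum>b\<in>?B. representation ?B (h c) b * representation ?C (f b) c)
        = representation ?C (f (h c)) c"
      by (simp add: linear_on_lincomb[OF W.linear_on_representation[OF W.some_basis(1)] W.subspace]
          f V.some_basis_mem)
  qed
  finally show ?thesis .
qed

section \<open>Nondegenerate symmetric forms: Riesz representation and dual bases\<close>

locale inner_findim = findim V for V :: "'v::real_vector set" +
  fixes q :: "'v \<Rightarrow> 'v \<Rightarrow> real"
  assumes bilinear: "bilinear_on V q"
    and sym: "\<And>a b. a \<in> V \<Longrightarrow> b \<in> V \<Longrightarrow> q a b = q b a"
    and nondegenerate: "nondegenerate_on V q"
begin

lemmas q_right = bilinear_onD(1)[OF bilinear]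
lemmas q_left = bilinear_onD(2)[OF bilinear]

lemma add_right: "a \<in> V \<Longrightarrow> b \<in> V \<Longrightarrow> c \<in> V \<Longrightarrow> q a (b + c) = q a b + q a c"
  by (rule linear_on_add[OF q_right])

lemma add_left: "a \<in> V \<Longrightarrow> b \<in> V \<Longrightarrow> c \<in> V \<Longrightarrow> q (b + c) a = q b a + q c a"
  by (rule linear_on_add[OF q_left])

lemma diff_right: "a \<in> V \<Longrightarrow> b \<in> V \<Longrightarrow> c \<in> V \<Longrightarrow> q a (b - c) = q a b - q a c"
  by (rule linear_on_diff[OF q_right subspace])

lemma diff_left: "a \<in> V \<Longrightarrow> b \<in> V \<Longrightarrow> c \<in> V \<Longrightarrow> q (b - c) a = q b a - q c a"
  by (rule linear_on_diff[OF q_left subspace])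

lemma scale_right: "a \<in> V \<Longrightarrow> b \<in> V \<Longrightarrow> q a (r *\<^sub>R b) = r * q a b"
  using linear_on_scale[OF q_right] by simp

lemma scale_left: "a \<in> V \<Longrightarrow> b \<in> V \<Longrightarrow> q (r *\<^sub>R b) a = r * q b a"
  using linear_on_scale[OF q_left] by simp

lemma zero_right: "a \<in> V \<Longrightarrow> q a 0 = 0"
  by (rule linear_on_zero[OF q_right subspace])

lemma zero_left: "a \<in> V \<Longrightarrow> q 0 a = 0"
  by (rule linear_on_zero[OF q_left subspace])

lemma eqI:
  assumes "a \<in> V" "b \<in> V" "\<And>c. c \<in> V \<Longrightarrow> q a c = q b c"
  shows "a = b"
proof -
  have "a - b \<in> V" using assms subspace by (simp add: subspace_diff)
  moreover have "q (a - b) c = 0" if "c \<in> V" for c using assms that by (simp add: diff_left)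
  ultimately have "a - b = 0" using nondegenerate unfolding nondegenerate_on_def by blast
  then show ?thesis by simp
qed

text \<open>
  The functionals \<open>q b\<close> for \<open>b\<close> in a basis \<open>B\<close>, restricted to \<open>B\<close>, are independent; adjoining a
  functional outside their span would exceed the dimension of the functions on \<open>B\<close>.
\<close>

lemma riesz:
  assumes f: "linear_on V f"
  shows "\<exists>y\<in>V. \<forall>x\<in>V. q y x = f x"
proof -
  let ?B = "some_basis V"
  note B = some_basis
  define \<Phi> where "\<Phi> y = (\<lambda>b. if b \<in> ?B then q y b else 0)" for y
  have B': "independent ?B" using B(1) by (simp add: is_basis_def)
  define \<phi> where "\<phi> = (\<lambda>b. if b \<in> ?B then f b else 0)"
  let ?\<delta> = "\<lambda>b c. if c = b then 1 else (0::real)"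
  have expand: "g \<in> span (?\<delta> ` ?B)" if "\<And>b. b \<notin> ?B \<Longrightarrow> g b = 0" for g :: "'v \<Rightarrow> real"
  proof -
    have app: "(\<Sum>b\<in>A. g b *\<^sub>R ?\<delta> b) c = (if c \<in> A then g c else 0)" if "finite A" for A c
      using that by (induction A rule: finite_induct) (auto simp: scaleR_fun_def)
    have "g = (\<Sum>b\<in>?B. g b *\<^sub>R ?\<delta> b)"
      using that by (auto simp: fun_eq_iff app[OF B(2)])
    moreover have "(\<Sum>b\<in>?B. g b *\<^sub>R ?\<delta> b) \<in> span (?\<delta> ` ?B)"
      by (intro span_sum span_scale span_base imageI)
    ultimately show ?thesis by simp
  qed
  have Phi_add: "\<Phi> (x + y) = \<Phi> x + \<Phi> y" if "x \<in> V" "y \<in> V" for x y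
    using that by (auto simp: \<Phi>_def fun_eq_iff add_left some_basis_mem)
  have Phi_scale: "\<Phi> (r *\<^sub>R x) = r *\<^sub>R \<Phi> x" if "x \<in> V" for x r
    using that by (auto simp: \<Phi>_def fun_eq_iff scale_left some_basis_mem scaleR_fun_def)
  have Phi_lin: "linear_on V \<Phi>" by (intro linear_onI Phi_add Phi_scale)
  have Phi0: "x = 0" if x: "x \<in> V" "\<Phi> x = 0" for x
  proof -
    have b: "q x b = 0" if "b \<in> ?B" for b using fun_cong[OF x(2), of b] that by (simp add: \<Phi>_def)
    have "q x y = 0" if "y \<in> V" for y
    proof -
      have "q x y = q x (\<Sum>b\<in>?B. representation ?B y b *\<^sub>R b)" by (simp add: basis_sum[OF B(1) that])
      also have "\<dots> = 0"
        by (subst linear_on_lincomb[OF q_right[OF x(1)] subspace]) (auto simp: some_basis_mem b)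
      finally show ?thesis .
    qed
    then show ?thesis using x(1) nondegenerate unfolding nondegenerate_on_def by blast
  qed
  have "inj_on \<Phi> V"
  proof (rule inj_onI)
    fix x y assume xy: "x \<in> V" "y \<in> V" "\<Phi> x = \<Phi> y"
    then have "\<Phi> (x - y) = 0" using linear_on_diff[OF Phi_lin subspace] by simp
    then show "x = y" using Phi0[of "x - y"] xy subspace by (simp add: subspace_diff)
  qed
  then have inj: "inj_on \<Phi> ?B" by (rule inj_on_subset) (auto simp: some_basis_mem)
  have ind: "independent (\<Phi> ` ?B)"
  proof
    assume "dependent (\<Phi> ` ?B)"
    then obtain u where u: "\<exists>v\<in>\<Phi> ` ?B. u v \<noteq> 0" "(\<Sum>v\<in>\<Phi> ` ?B. u v *\<^sub>R v) = 0"
      using B(2) by (auto simp: dependent_finite)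
    have "0 = (\<Sum>b\<in>?B. u (\<Phi> b) *\<^sub>R \<Phi> b)" using u(2) by (simp add: sum.reindex[OF inj])
    also have "\<dots> = \<Phi> (\<Sum>b\<in>?B. u (\<Phi> b) *\<^sub>R b)"
      by (rule linear_on_lincomb[OF Phi_lin subspace, symmetric]) (auto simp: some_basis_mem)
    finally have "\<Phi> (\<Sum>b\<in>?B. u (\<Phi> b) *\<^sub>R b) = 0" by simp
    then have "(\<Sum>b\<in>?B. u (\<Phi> b) *\<^sub>R b) = 0"
      by (intro Phi0 subspace_sum[OF subspace] subspace_scale[OF subspace]) (auto simp: some_basis_mem)
    then have "u (\<Phi> b) = 0" if "b \<in> ?B" for b
      by (rule independentD[OF B' B(2) subset_refl _ that])
    then show False using u(1) by blast
  qed
  have "\<phi> \<in> span (\<Phi> ` ?B)"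
  proof (rule ccontr)
    assume n: "\<phi> \<notin> span (\<Phi> ` ?B)"
    then have "\<phi> \<notin> \<Phi> ` ?B" using span_base[of \<phi> "\<Phi> ` ?B"] by auto
    then have c: "card (insert \<phi> (\<Phi> ` ?B)) = Suc (card ?B)"
      using B(2) by (simp add: card_image[OF inj])
    have "insert \<phi> (\<Phi> ` ?B) \<subseteq> span (?\<delta> ` ?B)"
      by (intro insert_subsetI image_subsetI expand) (auto simp: \<phi>_def \<Phi>_def)
    then have "card (insert \<phi> (\<Phi> ` ?B)) \<le> card (?\<delta> ` ?B)"
      by (rule conjunct2[OF independent_span_bound[OF finite_imageI[OF B(2)] independent_insertI[OF n ind]]])
    also have "\<dots> \<le> card ?B" by (rule card_image_le[OF B(2)])
    finally show False using c by linarith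
  qed
  then obtain u where u: "\<phi> = (\<Sum>v\<in>\<Phi> ` ?B. u v *\<^sub>R v)"
    using span_finite[of "\<Phi> ` ?B"] B(2) by auto
  define y where "y = (\<Sum>b\<in>?B. u (\<Phi> b) *\<^sub>R b)"
  have y: "y \<in> V" unfolding y_def
    by (intro subspace_sum[OF subspace] subspace_scale[OF subspace]) (auto simp: some_basis_mem)
  have "\<Phi> y = \<phi>"
    unfolding y_def u sum.reindex[OF inj] o_def
    by (rule linear_on_lincomb[OF Phi_lin subspace]) (auto simp: some_basis_mem)
  then have "\<Phi> y b = \<phi> b" for b by (rule fun_cong)
  then have b: "q y b = f b" if "b \<in> ?B" for b
    using that unfolding \<Phi>_def \<phi>_def by (metis (full_types))
  have "q y x = f x" if "x \<in> V" for x
  proof -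
    have "q y x = q y (\<Sum>b\<in>?B. representation ?B x b *\<^sub>R b)" by (simp add: basis_sum[OF B(1) that])
    also have "\<dots> = (\<Sum>b\<in>?B. representation ?B x b *\<^sub>R q y b)"
      by (rule linear_on_lincomb[OF q_right[OF y] subspace]) (rule some_basis_mem)
    also have "\<dots> = (\<Sum>b\<in>?B. representation ?B x b *\<^sub>R f b)"
      by (intro sum.cong) (auto simp: b)
    also have "\<dots> = f (\<Sum>b\<in>?B. representation ?B x b *\<^sub>R b)"
      by (rule linear_on_lincomb[OF f subspace, symmetric]) (rule some_basis_mem)
    finally show ?thesis by (simp add: basis_sum[OF B(1) that])
  qed
  then show ?thesis using y by blast
qed

lemma riesz_unique:
  assumes "linear_on V f"
  shows "\<exists>!y. y \<in> V \<and> (\<forall>x\<in>V. q y x = f x)"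
  using riesz[OF assms] by (auto intro!: eqI)

text \<open>A proper subspace is annihilated by a nonzero functional, whose Riesz representative is
  a nonzero vector orthogonal to it. This takes the place of a dimension count when the kernel of
  the anchor and an eigenbundle are shown to span the fibre.\<close>

lemma subspace_eq_whole:
  assumes W: "subspace W" "W \<subseteq> V"
    and perp: "\<And>y. y \<in> V \<Longrightarrow> (\<And>w. w \<in> W \<Longrightarrow> q y w = 0) \<Longrightarrow> y = 0"
  shows "W = V"
proof (rule ccontr)
  assume "W \<noteq> V"
  then obtain v where v: "v \<in> V" "v \<notin> W" using W by blast
  obtain B where B: "B \<subseteq> W" "independent B" "W \<subseteq> span B" by (rule maximal_independent_subset)
  have span: "span B = W" using B W span_minimal[of B W] by blast
  have "independent (insert v B)" using B v span by (simp add: independent_insertI)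
  then obtain f :: "'v \<Rightarrow> real" where f: "linear f" "\<forall>x\<in>insert v B. f x = (if x = v then 1 else 0)"
    using linear_independent_extend[of "insert v B" "\<lambda>x. if x = v then 1 else 0 :: real"] by blast
  have "v \<notin> B" using v B by blast
  have f0: "f w = 0" if "w \<in> W" for w
  proof (rule linear_eq_on[OF f(1), of "\<lambda>_. 0" w B])
    show "linear (\<lambda>_. 0 :: real)" by (simp add: linear_iff)
    show "w \<in> span B" using that span by simp
    show "f b = 0" if "b \<in> B" for b using that f(2) \<open>v \<notin> B\<close> by auto
  qed
  have "linear_on V f" using f(1) by (auto simp: linear_on_def linear_iff)
  then obtain y where y: "y \<in> V" "\<forall>x\<in>V. q y x = f x" using riesz by blast
  then have "y = 0" using perp[of y] f0 W by (simp add: subset_iff)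
  then have "f v = 0" using y v zero_left by auto
  then show False using f by auto
qed

definition dual :: "'v \<Rightarrow> 'v" where
  "dual = dual_basis_vector V q (some_basis V)"

text \<open>The Riesz representative of the coordinate functional at \<open>b\<close> meets the
  condition in \<open>dual_basis_vector\<close>, and any other solution agrees with it on all of
  \<open>V\<close> by expansion in the basis. Thus the definite description is well defined.\<close>

lemma dual: "b \<in> some_basis V \<Longrightarrow> dual b \<in> V"
  "b \<in> some_basis V \<Longrightarrow> c \<in> some_basis V \<Longrightarrow> q (dual b) c = (if c = b then 1 else 0)"
  "b \<in> some_basis V \<Longrightarrow> x \<in> V \<Longrightarrow> q (dual b) x = representation (some_basis V) x b"
proof -
  let ?B = "some_basis V"
  assume b: "b \<in> ?B"
  have lin: "linear_on V (\<lambda>x. representation ?B x b)"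
    by (rule linear_on_representation[OF some_basis(1)])
  obtain y where y: "y \<in> V" "\<forall>x\<in>V. q y x = representation ?B x b" using riesz[OF lin] by blast
  have rep: "representation ?B c b = (if c = b then 1 else 0)" if "c \<in> ?B" for c
    using that some_basis(1) by (auto simp: is_basis_def representation_basis)
  have "dual b = y"
    unfolding dual_def dual_basis_vector_def
  proof (rule the_equality)
    show "y \<in> V \<and> (\<forall>c\<in>?B. q y c = (if c = b then 1 else 0))"
      using y rep by (auto simp: some_basis_mem)
  next
    fix d assume d: "d \<in> V \<and> (\<forall>c\<in>?B. q d c = (if c = b then 1 else 0))"
    show "d = y"
    proof (rule eqI)
      fix x assume x: "x \<in> V"
      have "q d x = q d (\<Sum>c\<in>?B. representation ?B x c *\<^sub>R c)"
        by (simp add: basis_sum[OF some_basis(1) x])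
      also have "\<dots> = (\<Sum>c\<in>?B. representation ?B x c *\<^sub>R q d c)"
        using d by (intro linear_on_lincomb[OF q_right subspace]) (auto simp: some_basis_mem)
      also have "\<dots> = (\<Sum>c\<in>?B. if c = b then representation ?B x c else 0)"
        using d by (intro sum.cong) auto
      also have "\<dots> = representation ?B x b"
        using b some_basis(2) by simp
      finally show "q d x = q y x" using y x by simp
    qed (use d y in auto)
  qed
  then show "dual b \<in> V" "c \<in> ?B \<Longrightarrow> q (dual b) c = (if c = b then 1 else 0)"
    "x \<in> V \<Longrightarrow> q (dual b) x = representation ?B x b"
    using y rep by (auto simp: some_basis_mem)
qed

lemma expand_basis: "x \<in> V \<Longrightarrow> x = (\<Sum>b\<in>some_basis V. q (dual b) x *\<^sub>R b)"
  using basis_sum[OF some_basis(1)] by (simp add: dual)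

lemma expand_dual:
  assumes x: "x \<in> V" shows "x = (\<Sum>b\<in>some_basis V. q b x *\<^sub>R dual b)"
proof (rule eqI)
  show "(\<Sum>b\<in>some_basis V. q b x *\<^sub>R dual b) \<in> V"
    by (intro subspace_sum[OF subspace] subspace_scale[OF subspace]) (auto simp: dual)
next
  fix c assume c: "c \<in> V"
  have "q x c = q x (\<Sum>b\<in>some_basis V. q (dual b) c *\<^sub>R b)"
    using expand_basis[OF c] by simp
  also have "\<dots> = (\<Sum>b\<in>some_basis V. q (dual b) c *\<^sub>R q x b)"
    by (intro linear_on_lincomb[OF q_right subspace]) (auto simp: some_basis_mem x)
  also have "\<dots> = (\<Sum>b\<in>some_basis V. q b x *\<^sub>R q (dual b) c)"
    by (intro sum.cong) (auto simp: sym[OF x] some_basis_mem)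
  also have "\<dots> = q (\<Sum>b\<in>some_basis V. q b x *\<^sub>R dual b) c"
    by (intro linear_on_lincomb[OF q_left subspace, symmetric]) (auto simp: dual c)
  finally show "q x c = q (\<Sum>b\<in>some_basis V. q b x *\<^sub>R dual b) c" .
qed fact

lemma trace_eq_basis:
  assumes "linear_on V f" "\<And>x. x \<in> V \<Longrightarrow> f x \<in> V"
  shows "trace_on V f = (\<Sum>b\<in>some_basis V. q (dual b) (f b))"
  using assms expand_basis
  by (intro trace_on_family[where e = "\<lambda>b. b"]) (auto simp: some_basis_mem dual intro: q_right)

lemma trace_eq_dual:
  assumes "linear_on V f" "\<And>x. x \<in> V \<Longrightarrow> f x \<in> V"
  shows "trace_on V f = (\<Sum>b\<in>some_basis V. q b (f (dual b)))"
  using assms expand_dual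
  by (intro trace_on_family[where e = dual]) (auto simp: some_basis_mem dual intro: q_right)

text \<open>The trace can be computed with the dual basis on either side of \<open>f\<close>;
  skewness turns one formula into the negative of the other.\<close>

lemma trace_skew:
  assumes "linear_on V f" "\<And>x. x \<in> V \<Longrightarrow> f x \<in> V"
    and skew: "\<And>x y. x \<in> V \<Longrightarrow> y \<in> V \<Longrightarrow> q x (f y) = - q y (f x)"
  shows "trace_on V f = 0"
proof -
  have "trace_on V f = (\<Sum>b\<in>some_basis V. q (dual b) (f b))"
    by (rule trace_eq_basis[OF assms(1,2)])
  also have "\<dots> = - (\<Sum>b\<in>some_basis V. q b (f (dual b)))"
    unfolding sum_negf[symmetric] by (intro sum.cong refl skew) (auto simp: some_basis_mem dual)
  also have "\<dots> = - trace_on V f"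
    by (simp add: trace_eq_dual[OF assms(1,2)])
  finally have "trace_on V f = - trace_on V f" .
  then show ?thesis by simp
qed

end

section \<open>Smooth functions on Euclidean spaces\<close>

lemma frechet_derivative_cong_open:
  assumes "open S" "x \<in> S" "\<And>y. y \<in> S \<Longrightarrow> f y = g y"
  shows "f differentiable (at x) \<longleftrightarrow> g differentiable (at x)"
    and "frechet_derivative f (at x) = frechet_derivative g (at x)"
proof -
  have "(f has_derivative D) (at x) \<longleftrightarrow> (g has_derivative D) (at x)" for D
    using has_derivative_transform_within_open[OF _ assms(1,2), of f D UNIV g]
      has_derivative_transform_within_open[OF _ assms(1,2), of g D UNIV f] assms(3) by auto
  then show "f differentiable (at x) \<longleftrightarrow> g differentiable (at x)"
    and "frechet_derivative f (at x) = frechet_derivative g (at x)"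
    by (simp_all add: differentiable_def frechet_derivative_def)
qed

lemma Ck_on_cong:
  assumes "open S" "\<And>y. y \<in> S \<Longrightarrow> f y = g y"
  shows "Ck_on k S f \<longleftrightarrow> Ck_on k S g"
  using assms(2)
proof (induction k arbitrary: f g)
  case 0
  then show ?case by (simp cong: continuous_on_cong)
next
  case (Suc k)
  have "Ck_on k S (\<lambda>x. frechet_derivative f (at x) v) \<longleftrightarrow> Ck_on k S (\<lambda>x. frechet_derivative g (at x) v)" for v
    by (rule Suc.IH) (use frechet_derivative_cong_open(2)[OF assms(1)] Suc.prems in metis)
  moreover have "(\<forall>x\<in>S. f differentiable (at x)) \<longleftrightarrow> (\<forall>x\<in>S. g differentiable (at x))"
    using frechet_derivative_cong_open(1)[OF assms(1), of _ f g] Suc.prems by auto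
  ultimately show ?case by simp
qed

lemma Ck_on_subset: "Ck_on k T f \<Longrightarrow> S \<subseteq> T \<Longrightarrow> Ck_on k S f"
  by (induction k arbitrary: f) (auto intro: continuous_on_subset)

lemma Ck_on_local:
  assumes "\<And>x. x \<in> S \<Longrightarrow> \<exists>T. open T \<and> x \<in> T \<and> Ck_on k T f"
  shows "Ck_on k S f"
  using assms
proof (induction k arbitrary: f)
  case 0
  have "continuous (at x) f" if "x \<in> S" for x
    using 0[OF that] by (auto simp: continuous_on_eq_continuous_at)
  then show ?case by (simp add: continuous_at_imp_continuous_on)
next
  case (Suc k)
  have "f differentiable (at x)" if "x \<in> S" for x
    using Suc.prems[OF that] by auto
  moreover have "Ck_on k S (\<lambda>x. frechet_derivative f (at x) v)" for v
    using Suc.prems by (intro Suc.IH) fastforce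
  ultimately show ?case by simp
qed

lemma Ck_on_SucI:
  assumes "open S" "\<And>x. x \<in> S \<Longrightarrow> (f has_derivative f' x) (at x)" "\<And>v. Ck_on k S (\<lambda>x. f' x v)"
  shows "Ck_on (Suc k) S f"
proof -
  have "Ck_on k S (\<lambda>x. frechet_derivative f (at x) v)" for v
    by (subst Ck_on_cong[OF assms(1), of _ "\<lambda>x. f' x v"])
      (auto simp: assms(3) frechet_derivative_at[OF assms(2)])
  then show ?thesis using assms(2) by (auto simp: differentiable_def)
qed

lemma Ck_on_SucD:
  assumes "Ck_on (Suc k) S f"
  shows "\<And>x. x \<in> S \<Longrightarrow> (f has_derivative frechet_derivative f (at x)) (at x)"
    and "Ck_on k S (\<lambda>x. frechet_derivative f (at x) v)"
  using assms by (auto simp: frechet_derivative_works)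

lemma Ck_on_Suc_imp: "Ck_on (Suc k) S f \<Longrightarrow> Ck_on k S f"
proof (induction k arbitrary: f)
  case 0
  then show ?case
    by (auto intro!: continuous_at_imp_continuous_on differentiable_imp_continuous_within)
next
  case (Suc k)
  then show ?case by (metis Ck_on.simps(2))
qed

lemma Ck_on_const: "open S \<Longrightarrow> Ck_on k S (\<lambda>x. c)"
proof (induction k arbitrary: c)
  case (Suc k)
  then show ?case by (intro Ck_on_SucI[where f' = "\<lambda>x v. 0"]) (auto intro: derivative_eq_intros)
qed auto

lemma Ck_on_add: "open S \<Longrightarrow> Ck_on k S f \<Longrightarrow> Ck_on k S g \<Longrightarrow> Ck_on k S (\<lambda>x. f x + g x)"
proof (induction k arbitrary: f g)
  case (Suc k)
  note f = Ck_on_SucD[OF Suc.prems(2)] and g = Ck_on_SucD[OF Suc.prems(3)]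
  show ?case
    by (rule Ck_on_SucI[OF Suc.prems(1) has_derivative_add[OF f(1) g(1)]
        Suc.IH[OF Suc.prems(1) f(2) g(2)]])
qed (auto intro: continuous_intros)

lemma Ck_on_mult:
  fixes f g :: "'a::real_normed_vector \<Rightarrow> real"
  shows "open S \<Longrightarrow> Ck_on k S f \<Longrightarrow> Ck_on k S g \<Longrightarrow> Ck_on k S (\<lambda>x. f x * g x)"
proof (induction k arbitrary: f g)
  case (Suc k)
  note f = Ck_on_SucD[OF Suc.prems(2)] and g = Ck_on_SucD[OF Suc.prems(3)]
  note fg = Ck_on_Suc_imp[OF Suc.prems(2)] Ck_on_Suc_imp[OF Suc.prems(3)]
  show ?case
    by (rule Ck_on_SucI[OF Suc.prems(1) has_derivative_mult[OF f(1) g(1)]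
        Ck_on_add[OF Suc.prems(1) Suc.IH[OF Suc.prems(1) fg(1) g(2)] Suc.IH[OF Suc.prems(1) f(2) fg(2)]]])
qed (auto intro: continuous_intros)

lemma Ck_on_inverse:
  fixes f :: "'a::real_normed_vector \<Rightarrow> real"
  shows "open S \<Longrightarrow> (\<And>x. x \<in> S \<Longrightarrow> f x \<noteq> 0) \<Longrightarrow> Ck_on k S f \<Longrightarrow> Ck_on k S (\<lambda>x. inverse (f x))"
proof (induction k)
  case (Suc k)
  note f = Ck_on_SucD[OF Suc.prems(3)]
  let ?D = "\<lambda>x v. frechet_derivative f (at x) v"
  have inv: "Ck_on k S (\<lambda>x. inverse (f x))"
    using Suc.IH Suc.prems Ck_on_Suc_imp by blast
  \<comment> \<open>The derivative is written as a product with the constant -1 so that the closure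
    rules for products apply directly.\<close>
  have D: "((\<lambda>x. inverse (f x)) has_derivative (\<lambda>v. - 1 * (inverse (f x) * ?D x v * inverse (f x)))) (at x)"
    if "x \<in> S" for x
    using Deriv.has_derivative_inverse[OF Suc.prems(2)[OF that] f(1)[OF that]] by simp
  have C: "Ck_on k S (\<lambda>x. - 1 * (inverse (f x) * ?D x v * inverse (f x)))" for v
    by (intro Ck_on_mult Ck_on_const Suc.prems(1) inv f(2))
  show ?case
    by (rule Ck_on_SucI[where f' = "\<lambda>x v. - 1 * (inverse (f x) * ?D x v * inverse (f x))",
        OF Suc.prems(1) D C])
qed (auto intro!: continuous_intros)

lemma Ck_on_sum:
  assumes "open S" "\<And>i. i \<in> I \<Longrightarrow> Ck_on k S (f i)"
  shows "Ck_on k S (\<lambda>x. \<Sum>i\<in>I. f i x)"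
  using assms(2)
  by (induction I rule: infinite_finite_induct) (auto intro: Ck_on_const Ck_on_add assms(1))

lemma Ck_on_bounded_linear:
  assumes "bounded_linear h" "open S"
  shows "Ck_on k S f \<Longrightarrow> Ck_on k S (\<lambda>x. h (f x))"
proof (induction k arbitrary: f)
  case 0
  then show ?case using bounded_linear.continuous_on[OF assms(1)] by auto
next
  case (Suc k)
  note f = Ck_on_SucD[OF Suc.prems]
  show ?case
    by (rule Ck_on_SucI[OF assms(2) bounded_linear.has_derivative[OF assms(1) f(1)] Suc.IH[OF f(2)]])
qed

lemma Ck_on_id: "open S \<Longrightarrow> Ck_on k S (\<lambda>x. x)"
proof (induction k)
  case (Suc k)
  then show ?case
    by (intro Ck_on_SucI[where f' = "\<lambda>x v. v"] Ck_on_const) (auto intro: derivative_eq_intros)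
qed (auto intro: continuous_intros)

lemma Ck_on_compose:
  fixes f :: "'b::euclidean_space \<Rightarrow> real" and g :: "'a::euclidean_space \<Rightarrow> 'b"
  assumes "open S" "g ` S \<subseteq> T"
  shows "Ck_on k T f \<Longrightarrow> Ck_on k S g \<Longrightarrow> Ck_on k S (\<lambda>x. f (g x))"
proof (induction k arbitrary: f)
  case 0
  then show ?case using continuous_on_compose2[of T f S g] assms(2) by auto
next
  case (Suc k)
  note f = Ck_on_SucD[OF Suc.prems(1)] and g = Ck_on_SucD[OF Suc.prems(2)]
  let ?Df = "\<lambda>y. frechet_derivative f (at y)" and ?Dg = "\<lambda>x. frechet_derivative g (at x)"
  \<comment> \<open>In the chain rule the direction in which \<open>f\<close> is differentiated
    varies with \<open>x\<close>, whereas \<open>Ck_on\<close> controls derivatives in fixed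
    directions only. Expanding the direction in the standard basis leaves derivatives of
    \<open>f\<close> along basis vectors, to which the induction hypothesis applies.\<close>
  have expand: "?Df (g x) (?Dg x v) = (\<Sum>b\<in>Basis. (?Dg x v \<bullet> b) * ?Df (g x) b)" if "x \<in> S" for x v
  proof -
    have lin: "linear (?Df (g x))"
      using f(1)[of "g x"] that assms(2) by (auto intro!: has_derivative_linear)
    have "?Df (g x) (?Dg x v) = ?Df (g x) (\<Sum>b\<in>Basis. (?Dg x v \<bullet> b) *\<^sub>R b)"
      by (simp add: euclidean_representation)
    then show ?thesis by (simp add: linear_sum[OF lin] linear_scale[OF lin])
  qed
  have "((\<lambda>x. f (g x)) has_derivative (\<lambda>v. \<Sum>b\<in>Basis. (?Dg x v \<bullet> b) * ?Df (g x) b)) (at x)" if "x \<in> S" for x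
    using has_derivative_compose[OF g(1)[OF that] f(1)] that assms(2)
    by (auto simp: expand[OF that] image_subset_iff)
  moreover have "Ck_on k S (\<lambda>x. \<Sum>b\<in>Basis. (?Dg x v \<bullet> b) * ?Df (g x) b)" for v
    by (intro Ck_on_sum Ck_on_mult assms(1) Ck_on_bounded_linear[OF bounded_linear_inner_left] g(2)
        Suc.IH f(2) Ck_on_Suc_imp[OF Suc.prems(2)])
  ultimately show ?case by (rule Ck_on_SucI[OF assms(1)])
qed

lemma smooth_on_cong: "open S \<Longrightarrow> (\<And>y. y \<in> S \<Longrightarrow> f y = g y) \<Longrightarrow> smooth_on S f \<longleftrightarrow> smooth_on S g"
  unfolding smooth_on_def by (intro all_cong1 Ck_on_cong)

lemma smooth_on_subset: "smooth_on T f \<Longrightarrow> S \<subseteq> T \<Longrightarrow> smooth_on S f"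
  by (auto simp: smooth_on_def intro: Ck_on_subset)

lemma smooth_on_local: "(\<And>x. x \<in> S \<Longrightarrow> \<exists>T. open T \<and> x \<in> T \<and> smooth_on T f) \<Longrightarrow> smooth_on S f"
  unfolding smooth_on_def by (intro allI Ck_on_local) blast

lemma smooth_on_const: "open S \<Longrightarrow> smooth_on S (\<lambda>x. c)"
  unfolding smooth_on_def by (intro allI Ck_on_const)

lemma smooth_on_id: "open S \<Longrightarrow> smooth_on S (\<lambda>x. x)"
  unfolding smooth_on_def by (intro allI Ck_on_id)

lemma smooth_on_bounded_linear:
  "bounded_linear h \<Longrightarrow> open S \<Longrightarrow> smooth_on S f \<Longrightarrow> smooth_on S (\<lambda>x. h (f x))"
  unfolding smooth_on_def by (intro allI, rule Ck_on_bounded_linear) auto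

lemma smooth_on_add: "open S \<Longrightarrow> smooth_on S f \<Longrightarrow> smooth_on S g \<Longrightarrow> smooth_on S (\<lambda>x. f x + g x)"
  unfolding smooth_on_def by (intro allI Ck_on_add) auto

lemma smooth_on_mult:
  fixes f g :: "'a::real_normed_vector \<Rightarrow> real"
  shows "open S \<Longrightarrow> smooth_on S f \<Longrightarrow> smooth_on S g \<Longrightarrow> smooth_on S (\<lambda>x. f x * g x)"
  unfolding smooth_on_def by (intro allI Ck_on_mult) auto

lemma smooth_on_inverse:
  fixes f :: "'a::real_normed_vector \<Rightarrow> real"
  shows "open S \<Longrightarrow> (\<And>x. x \<in> S \<Longrightarrow> f x \<noteq> 0) \<Longrightarrow> smooth_on S f \<Longrightarrow> smooth_on S (\<lambda>x. inverse (f x))"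
  unfolding smooth_on_def by (intro allI Ck_on_inverse) auto

lemma smooth_on_sum:
  "open S \<Longrightarrow> (\<And>i. i \<in> I \<Longrightarrow> smooth_on S (f i)) \<Longrightarrow> smooth_on S (\<lambda>x. \<Sum>i\<in>I. f i x)"
  unfolding smooth_on_def by (intro allI, rule Ck_on_sum) auto

lemma smooth_on_compose:
  fixes f :: "'b::euclidean_space \<Rightarrow> real" and g :: "'a::euclidean_space \<Rightarrow> 'b"
  shows "open S \<Longrightarrow> g ` S \<subseteq> T \<Longrightarrow> smooth_on T f \<Longrightarrow> smooth_on S g \<Longrightarrow> smooth_on S (\<lambda>x. f (g x))"
  unfolding smooth_on_def by (intro allI, rule Ck_on_compose[of S g T]) auto

section \<open>A flat function and bump functions on Euclidean space\<close>

text \<open>For m = 0 this is the standard flat function. The powers in the denominator make the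
  family closed under differentiation up to linear combinations, so that one induction over the
  order, with \<open>m\<close> arbitrary, proves smoothness.\<close>

definition flat_exp :: "nat \<Rightarrow> real \<Rightarrow> real" where
  "flat_exp m x = (if x > 0 then exp (- 1 / x) / x ^ m else 0)"

text \<open>The term of degree m + 2 in the series of exp(1/x) bounds exp(-1/x) by (m+2)! x^(m+2).
  Two powers survive division by x^m, one more than the difference quotient at 0 consumes.\<close>

lemma flat_exp_bound: "\<bar>flat_exp m x\<bar> \<le> fact (m + 2) * x\<^sup>2"
proof (cases "x > 0")
  case True
  let ?n = "m + 2"
  have "inverse (fact ?n) * (1 / x) ^ ?n \<le> (\<Sum>n\<le>?n. inverse (fact n) * (1 / x) ^ n)"
    using True by (intro member_le_sum) auto
  also have "\<dots> \<le> exp (1 / x)"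
    unfolding exp_def real_scaleR_def
    using True by (intro sum_le_suminf summable_exp) auto
  finally have "inverse (fact ?n * x ^ ?n) \<le> exp (1 / x)"
    unfolding power_one_over inverse_mult_distrib by (simp only: divide_inverse mult_1)
  then have "inverse (exp (1 / x)) \<le> inverse (inverse (fact ?n * x ^ ?n))"
    by (rule le_imp_inverse_le) (simp add: True)
  then have "exp (- 1 / x) \<le> fact ?n * x ^ ?n"
    by (simp only: inverse_inverse_eq exp_minus[symmetric] minus_divide_left)
  then show ?thesis using True
    by (simp add: flat_exp_def field_simps power_add power2_eq_square)
qed (simp add: flat_exp_def)

lemma flat_exp_derivative:
  "(flat_exp m has_real_derivative (flat_exp (m + 2) x - m * flat_exp (m + 1) x)) (at x)"
proof -
  consider "x > 0" | "x < 0" | "x = 0" by linarith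
  then show ?thesis
  proof cases
    case 1
    have "((\<lambda>x. exp (- 1 / x) / x ^ m) has_real_derivative
        (flat_exp (m + 2) x - m * flat_exp (m + 1) x)) (at x)"
    proof (cases m)
      case 0
      show ?thesis unfolding 0 using 1
        by (auto intro!: derivative_eq_intros simp: flat_exp_def field_simps power2_eq_square)
    next
      case (Suc j)
      show ?thesis unfolding Suc using 1
        by (auto intro!: derivative_eq_intros simp: flat_exp_def field_simps power2_eq_square, cases j, auto)
    qed
    then show ?thesis
      by (rule has_field_derivative_transform_within_open[of _ _ _ "{0<..}"]) (use 1 in \<open>auto simp: flat_exp_def\<close>)
  next
    case 2
    have "((\<lambda>x::real. 0) has_real_derivative (flat_exp (m + 2) x - m * flat_exp (m + 1) x)) (at x)"
      using 2 by (simp add: flat_exp_def)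
    then show ?thesis
      by (rule has_field_derivative_transform_within_open[of _ _ _ "{..<0}"]) (use 2 in \<open>auto simp: flat_exp_def\<close>)
  next
    case 3
    \<comment> \<open>Difference quotient at 0, where all functions of the family vanish.\<close>
    have "((\<lambda>y. flat_exp m y / y) \<longlongrightarrow> 0) (at 0)"
    proof (rule Lim_null_comparison)
      show "\<forall>\<^sub>F y in at 0. norm (flat_exp m y / y) \<le> fact (m + 2) * \<bar>y\<bar>"
        using flat_exp_bound[of m]
        by (intro always_eventually allI)
          (auto simp: divide_le_eq abs_mult power2_eq_square mult.assoc)
      show "((\<lambda>y::real. fact (m + 2) * \<bar>y\<bar>) \<longlongrightarrow> 0) (at 0)"
        by (auto intro!: tendsto_eq_intros)
    qed
    then show ?thesis unfolding 3
      by (simp add: has_field_derivative_iff flat_exp_def[of _ 0])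
  qed
qed

lemma smooth_flat_exp: "smooth_on UNIV (flat_exp m)"
proof -
  have "Ck_on k UNIV (flat_exp m)" for k
  proof (induction k arbitrary: m)
    case 0
    have "isCont (flat_exp m) x" for x by (rule DERIV_isCont[OF flat_exp_derivative])
    then show ?case by (simp add: continuous_at_imp_continuous_on)
  next
    case (Suc k)
    have "(flat_exp m has_derivative (\<lambda>v. (flat_exp (m + 2) x + - m * flat_exp (m + 1) x) * v)) (at x)" for x
      using flat_exp_derivative[of m x] by (simp add: has_field_derivative_def)
    then show ?case
      by (rule Ck_on_SucI[OF open_UNIV]) (intro Ck_on_mult Ck_on_add Ck_on_const Suc.IH open_UNIV)
  qed
  then show ?thesis by (simp add: smooth_on_def)
qed

lemma euclidean_bump:
  fixes x0 :: "'a::euclidean_space"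
  assumes "r > 0"
  shows "\<exists>\<beta> :: 'a \<Rightarrow> real. smooth_on UNIV \<beta> \<and> \<beta> x0 = 1 \<and> (\<forall>x. x \<notin> cball x0 r \<longrightarrow> \<beta> x = 0)"
proof (intro exI conjI allI impI)
  \<comment> \<open>The squared radius minus the squared distance to \<open>x0\<close>, spelled out
    in coordinates with sums and products only, so that the closure rules prove it smooth. Dividing
    by the value at the centre normalises the bump to 1.\<close>
  let ?d = "\<lambda>x. r\<^sup>2 + - 1 * (\<Sum>b\<in>Basis. (x \<bullet> b + - (x0 \<bullet> b)) * (x \<bullet> b + - (x0 \<bullet> b)))"
  let ?\<beta> = "\<lambda>x. inverse (flat_exp 0 (r\<^sup>2)) * flat_exp 0 (?d x)"
  have d: "?d x = r\<^sup>2 - (dist x0 x)\<^sup>2" for x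
  proof -
    have "(dist x0 x)\<^sup>2 = (\<Sum>b\<in>Basis. ((x0 - x) \<bullet> b) * ((x0 - x) \<bullet> b))"
      by (subst euclidean_inner[symmetric]) (simp add: dist_norm power2_norm_eq_inner)
    also have "\<dots> = (\<Sum>b\<in>Basis. (x \<bullet> b + - (x0 \<bullet> b)) * (x \<bullet> b + - (x0 \<bullet> b)))"
      by (intro sum.cong) (auto simp: inner_diff_left algebra_simps)
    finally show ?thesis by simp
  qed
  have "smooth_on UNIV ?d"
    by (intro smooth_on_add smooth_on_mult smooth_on_sum smooth_on_const open_UNIV smooth_on_id
        smooth_on_bounded_linear[OF bounded_linear_inner_left])
  then show "smooth_on UNIV ?\<beta>"
    by (intro smooth_on_mult smooth_on_const open_UNIV smooth_on_compose[OF _ _ smooth_flat_exp]) auto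
  show "?\<beta> x0 = 1" using assms by (simp add: flat_exp_def)
  show "?\<beta> x = 0" if "x \<notin> cball x0 r" for x
    using that assms power_strict_mono[of r "dist x0 x" 2] unfolding d by (simp add: flat_exp_def)
qed

section \<open>Smooth functions on manifolds\<close>

text \<open>Smoothness of a germ. Quotients and pivots are nonzero only near a point, so divisions
  have to be carried out at this level.\<close>

definition smooth_at :: "('m::topological_space, 'a::euclidean_space) atlas \<Rightarrow> 'm \<Rightarrow> ('m \<Rightarrow> real) \<Rightarrow> bool" where
  "smooth_at A p f \<longleftrightarrow> (\<exists>W. open W \<and> p \<in> W \<and> smooth_fun_on A W f)"

locale manifold =
  fixes A :: "('m::{t2_space, second_countable_topology}, 'a::euclidean_space) atlas"
  assumes manifold: "smooth_manifold A"
begin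

lemma chart:
  assumes "(U, \<phi>) \<in> A"
  shows "open U" "open (\<phi> ` U)" "continuous_on U \<phi>" "inj_on \<phi> U"
    "continuous_on (\<phi> ` U) (inv_into U \<phi>)"
proof -
  have "open U \<and> open (\<phi> ` U) \<and> homeomorphism U (\<phi> ` U) \<phi> (inv_into U \<phi>)"
    using manifold assms unfolding smooth_manifold_def by blast
  then show "open U" "open (\<phi> ` U)" "continuous_on U \<phi>" "inj_on \<phi> U"
    "continuous_on (\<phi> ` U) (inv_into U \<phi>)"
    by (auto simp: homeomorphism_def intro: inj_on_inverseI)
qed

lemma chart_at: obtains U \<phi> where "(U, \<phi>) \<in> A" "p \<in> U"
proof -
  have "p \<in> (\<Union>(U, \<phi>)\<in>A. U)" using manifold by (simp add: smooth_manifold_def)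
  then show thesis using that by blast
qed

lemma open_chart_image:
  assumes "(U, \<phi>) \<in> A" "open W" shows "open (\<phi> ` (U \<inter> W))"
proof -
  note c = chart[OF assms(1)]
  have "\<phi> ` (U \<inter> W) = \<phi> ` U \<inter> inv_into U \<phi> -` W"
    using c(4) by (auto simp: inv_into_f_f)
  then show ?thesis using continuous_open_preimage[OF c(5,2) assms(2)] by simp
qed

lemma smooth_fun_on_subset:
  "smooth_fun_on A W f \<Longrightarrow> V \<subseteq> W \<Longrightarrow> smooth_fun_on A V f"
  unfolding smooth_fun_on_def by (fastforce elim: smooth_on_subset)

lemma smooth_fun_on_iff:
  assumes "open W"
  shows "smooth_fun_on A W f \<longleftrightarrow> (\<forall>p\<in>W. smooth_at A p f)"
proof
  assume "\<forall>p\<in>W. smooth_at A p f"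
  then have loc: "\<exists>V. open V \<and> p \<in> V \<and> smooth_fun_on A V f" if "p \<in> W" for p
    using that by (auto simp: smooth_at_def)
  have "smooth_on (\<phi> ` (U \<inter> W)) (f \<circ> inv_into U \<phi>)" if U: "(U, \<phi>) \<in> A" for U \<phi>
  proof (rule smooth_on_local)
    fix x assume "x \<in> \<phi> ` (U \<inter> W)"
    then obtain p where p: "p \<in> U" "p \<in> W" "x = \<phi> p" by blast
    obtain V where "open V" "p \<in> V" "smooth_fun_on A V f" using loc p by blast
    then show "\<exists>T. open T \<and> x \<in> T \<and> smooth_on T (f \<circ> inv_into U \<phi>)"
      using p U open_chart_image[OF U]
      by (intro exI[of _ "\<phi> ` (U \<inter> V)"]) (auto simp: smooth_fun_on_def)
  qed
  then show "smooth_fun_on A W f" by (auto simp: smooth_fun_on_def)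
qed (use assms in \<open>auto simp: smooth_at_def\<close>)

lemma smooth_functions_iff: "f \<in> smooth_functions A \<longleftrightarrow> (\<forall>p. smooth_at A p f)"
  by (simp add: smooth_functions_def smooth_fun_on_iff)

lemma smooth_at_cong:
  assumes "smooth_at A p f" "open W" "p \<in> W" "\<And>r. r \<in> W \<Longrightarrow> f r = g r"
  shows "smooth_at A p g"
proof -
  obtain V where V: "open V" "p \<in> V" "smooth_fun_on A V f" using assms by (auto simp: smooth_at_def)
  have "smooth_fun_on A (V \<inter> W) g"
    unfolding smooth_fun_on_def
  proof safe
    fix U \<phi> assume U: "(U, \<phi>) \<in> A"
    have "smooth_on (\<phi> ` (U \<inter> (V \<inter> W))) (f \<circ> inv_into U \<phi>)"
      using smooth_fun_on_subset[OF V(3), of "V \<inter> W"] U by (auto simp: smooth_fun_on_def)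
    then show "smooth_on (\<phi> ` (U \<inter> (V \<inter> W))) (g \<circ> inv_into U \<phi>)"
      using chart(4)[OF U] assms(4)
      by (subst smooth_on_cong[OF open_chart_image[OF U open_Int[OF V(1) assms(2)]], of _ "f \<circ> inv_into U \<phi>"])
        (auto simp: inv_into_f_f)
  qed
  then show ?thesis using V assms unfolding smooth_at_def by (intro exI[of _ "V \<inter> W"]) auto
qed

lemma smooth_at_binary:
  assumes "smooth_at A p f" "smooth_at A p g"
    and "\<And>S F G. open S \<Longrightarrow> smooth_on S F \<Longrightarrow> smooth_on S G \<Longrightarrow> smooth_on S (\<lambda>x::'a. h (F x) (G x))"
  shows "smooth_at A p (\<lambda>r. h (f r) (g r))"
proof -
  obtain V where V: "open V" "p \<in> V" "smooth_fun_on A V f" using assms by (auto simp: smooth_at_def)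
  obtain W where W: "open W" "p \<in> W" "smooth_fun_on A W g" using assms by (auto simp: smooth_at_def)
  have fg: "smooth_fun_on A (V \<inter> W) f" "smooth_fun_on A (V \<inter> W) g"
    using V W by (auto elim: smooth_fun_on_subset)
  have "smooth_fun_on A (V \<inter> W) (\<lambda>r. h (f r) (g r))"
    unfolding smooth_fun_on_def
  proof safe
    fix U \<phi> assume U: "(U, \<phi>) \<in> A"
    show "smooth_on (\<phi> ` (U \<inter> (V \<inter> W))) ((\<lambda>r. h (f r) (g r)) \<circ> inv_into U \<phi>)"
      using assms(3)[OF open_chart_image[OF U open_Int[OF V(1) W(1)]], of "f \<circ> inv_into U \<phi>" "g \<circ> inv_into U \<phi>"]
        fg U unfolding smooth_fun_on_def by (auto simp: o_def)
  qed
  then show ?thesis using V W unfolding smooth_at_def by (intro exI[of _ "V \<inter> W"]) auto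
qed

lemma smooth_at_add: "smooth_at A p f \<Longrightarrow> smooth_at A p g \<Longrightarrow> smooth_at A p (\<lambda>r. f r + g r)"
  by (rule smooth_at_binary[where h = "(+)"]) (auto intro: smooth_on_add)

lemma smooth_at_mult: "smooth_at A p f \<Longrightarrow> smooth_at A p g \<Longrightarrow> smooth_at A p (\<lambda>r. f r * g r)"
  by (rule smooth_at_binary[where h = "(*)"]) (auto intro: smooth_on_mult)

lemma smooth_at_const: "smooth_at A p (\<lambda>r. c)"
  unfolding smooth_at_def smooth_fun_on_def
  by (intro exI[of _ UNIV]) (auto simp: o_def chart(2) intro: smooth_on_const)

lemma smooth_at_minus: "smooth_at A p f \<Longrightarrow> smooth_at A p (\<lambda>r. - f r)"
  using smooth_at_mult[OF smooth_at_const[of p "-1"], of f] by simp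

lemma smooth_at_diff: "smooth_at A p f \<Longrightarrow> smooth_at A p g \<Longrightarrow> smooth_at A p (\<lambda>r. f r - g r)"
  using smooth_at_add[OF _ smooth_at_minus, of p f g] by simp

lemma smooth_at_sum: "(\<And>i. i \<in> I \<Longrightarrow> smooth_at A p (f i)) \<Longrightarrow> smooth_at A p (\<lambda>r. \<Sum>i\<in>I. f i r)"
  by (induction I rule: infinite_finite_induct) (auto intro: smooth_at_const smooth_at_add)

lemma continuous_on_smooth:
  assumes "smooth_fun_on A W f" "open W"
  shows "continuous_on W f"
proof -
  have "isCont f p" if p: "p \<in> W" for p
  proof -
    obtain U \<phi> where U: "(U, \<phi>) \<in> A" "p \<in> U" by (rule chart_at)
    note c = chart[OF U(1)]
    have "continuous_on (\<phi> ` (U \<inter> W)) (f \<circ> inv_into U \<phi>)"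
      using assms(1) U(1) unfolding smooth_fun_on_def smooth_on_def by (metis (no_types, lifting) Ck_on.simps(1) case_prodD)
    then have "continuous_on (U \<inter> W) (\<lambda>r. (f \<circ> inv_into U \<phi>) (\<phi> r))"
      by (rule continuous_on_compose2[OF _ continuous_on_subset[OF c(3)]]) auto
    then have "continuous_on (U \<inter> W) f"
      by (rule continuous_on_eq) (use c(4) in \<open>auto simp: inv_into_f_f\<close>)
    then show ?thesis using p U c(1) assms(2)
      by (simp add: continuous_on_eq_continuous_at open_Int)
  qed
  then show ?thesis by (simp add: continuous_at_imp_continuous_on)
qed

lemma smooth_at_nonzero_nbhd:
  assumes "smooth_at A p f" "f p \<noteq> 0"
  shows "\<exists>W. open W \<and> p \<in> W \<and> smooth_fun_on A W f \<and> (\<forall>r\<in>W. f r \<noteq> 0)"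
proof -
  obtain V where V: "open V" "p \<in> V" "smooth_fun_on A V f" using assms by (auto simp: smooth_at_def)
  have "open (V \<inter> f -` (- {0}))"
    by (rule continuous_open_preimage[OF continuous_on_smooth[OF V(3,1)] V(1)]) auto
  then show ?thesis
    using V assms by (intro exI[of _ "V \<inter> f -` (- {0})"]) (auto elim: smooth_fun_on_subset)
qed

lemma smooth_at_inverse:
  assumes "smooth_at A p f" "f p \<noteq> 0"
  shows "smooth_at A p (\<lambda>r. inverse (f r))"
proof -
  obtain W where W: "open W" "p \<in> W" "smooth_fun_on A W f" "\<And>r. r \<in> W \<Longrightarrow> f r \<noteq> 0"
    using smooth_at_nonzero_nbhd[OF assms] by auto
  have "smooth_fun_on A W (\<lambda>r. inverse (f r))"
    unfolding smooth_fun_on_def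
  proof safe
    fix U \<phi> assume U: "(U, \<phi>) \<in> A"
    have "smooth_on (\<phi> ` (U \<inter> W)) (f \<circ> inv_into U \<phi>)"
      using W(3) U unfolding smooth_fun_on_def by auto
    then have "smooth_on (\<phi> ` (U \<inter> W)) (\<lambda>x. inverse ((f \<circ> inv_into U \<phi>) x))"
      by (rule smooth_on_inverse[OF open_chart_image[OF U W(1)], rotated])
        (use W(4) chart(4)[OF U] in \<open>auto simp: inv_into_f_f\<close>)
    then show "smooth_on (\<phi> ` (U \<inter> W)) ((\<lambda>r. inverse (f r)) \<circ> inv_into U \<phi>)"
      by (simp add: o_def)
  qed
  then show ?thesis using W by (auto simp: smooth_at_def)
qed

lemma smooth_at_divide:
  "smooth_at A p f \<Longrightarrow> smooth_at A p g \<Longrightarrow> g p \<noteq> 0 \<Longrightarrow> smooth_at A p (\<lambda>r. f r / g r)"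
  unfolding divide_inverse by (intro smooth_at_mult smooth_at_inverse)

lemma smooth_functions_const: "(\<lambda>r. c) \<in> smooth_functions A"
  by (simp add: smooth_functions_iff smooth_at_const)

lemma smooth_functions_add:
  "f \<in> smooth_functions A \<Longrightarrow> g \<in> smooth_functions A \<Longrightarrow> (\<lambda>r. f r + g r) \<in> smooth_functions A"
  by (simp add: smooth_functions_iff smooth_at_add)

lemma smooth_functions_mult:
  "f \<in> smooth_functions A \<Longrightarrow> g \<in> smooth_functions A \<Longrightarrow> (\<lambda>r. f r * g r) \<in> smooth_functions A"
  by (simp add: smooth_functions_iff smooth_at_mult)

lemma smooth_functions_minus: "f \<in> smooth_functions A \<Longrightarrow> (\<lambda>r. - f r) \<in> smooth_functions A"
  by (simp add: smooth_functions_iff smooth_at_minus)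

lemma smooth_functions_diff:
  "f \<in> smooth_functions A \<Longrightarrow> g \<in> smooth_functions A \<Longrightarrow> (\<lambda>r. f r - g r) \<in> smooth_functions A"
  by (simp add: smooth_functions_iff smooth_at_diff)

lemma smooth_functions_scaleR: "f \<in> smooth_functions A \<Longrightarrow> r *\<^sub>R f \<in> smooth_functions A"
  using smooth_functions_mult[OF smooth_functions_const] by (simp add: scaleR_fun_def)

lemma smooth_functions_plus:
  "f \<in> smooth_functions A \<Longrightarrow> g \<in> smooth_functions A \<Longrightarrow> f + g \<in> smooth_functions A"
  using smooth_functions_add[of f g] by (simp add: plus_fun_def)

section \<open>Extension by zero and bump functions on the manifold\<close>

text \<open>Inside the chart smoothness comes from the transition maps. The preimage of the compact
  set \<open>K\<close> is compact, hence closed because the manifold is Hausdorff, so a point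
  outside the chart has a neighbourhood on which the extension vanishes.\<close>

lemma chart_function:
  assumes U: "(U, \<phi>) \<in> A" and F: "smooth_on UNIV F"
    and K: "compact K" "K \<subseteq> \<phi> ` U" "\<And>x. x \<notin> K \<Longrightarrow> F x = 0"
  shows "(\<lambda>p. if p \<in> U then F (\<phi> p) else 0) \<in> smooth_functions A" (is "?f \<in> _")
    and "closed (inv_into U \<phi> ` K)" "inv_into U \<phi> ` K \<subseteq> U"
    and "p \<notin> inv_into U \<phi> ` K \<Longrightarrow> (if p \<in> U then F (\<phi> p) else 0) = 0"
proof -
  let ?L = "inv_into U \<phi> ` K"
  note c = chart[OF U]
  show L: "closed ?L"
    using K(1,2) continuous_on_subset[OF c(5) K(2)]
    by (intro compact_imp_closed compact_continuous_image)
  show LU: "?L \<subseteq> U" using K(2) by (auto intro: inv_into_into)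
  have zero: "?f p = 0" if "p \<notin> ?L" for p
  proof (cases "p \<in> U")
    case True
    then have "p = inv_into U \<phi> (\<phi> p)" using c(4) by (simp add: inv_into_f_f)
    then have "\<phi> p \<notin> K" using that by blast
    then show ?thesis using K(3) True by simp
  qed simp
  then show "p \<notin> ?L \<Longrightarrow> (if p \<in> U then F (\<phi> p) else 0) = 0" .
  have "smooth_at A p ?f" if "p \<in> U" for p
  proof -
    have "smooth_on (\<psi> ` (V \<inter> U)) (?f \<circ> inv_into V \<psi>)" if V: "(V, \<psi>) \<in> A" for V \<psi>
    proof -
      have o: "open (\<psi> ` (V \<inter> U))" by (rule open_chart_image[OF V c(1)])
      have T: "smooth_on (\<psi> ` (V \<inter> U)) (\<phi> \<circ> inv_into V \<psi>)"
        using manifold U V unfolding smooth_manifold_def by blast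
      have "smooth_on (\<psi> ` (V \<inter> U)) (\<lambda>x. F ((\<phi> \<circ> inv_into V \<psi>) x))"
        by (rule smooth_on_compose[OF o _ F T]) simp
      then show ?thesis
        using chart(4)[OF V]
        by (subst smooth_on_cong[OF o, of _ "\<lambda>x. F ((\<phi> \<circ> inv_into V \<psi>) x)"]) (auto simp: inv_into_f_f)
    qed
    then show ?thesis
      using that c(1) unfolding smooth_at_def smooth_fun_on_def by (intro exI[of _ U]) auto
  qed
  moreover have "smooth_at A p ?f" if "p \<notin> U" for p
    by (rule smooth_at_cong[OF smooth_at_const[of p 0], of "- ?L"]) (use that L LU zero in auto)
  ultimately show "?f \<in> smooth_functions A" by (auto simp: smooth_functions_iff)
qed

lemma chart_cball:
  assumes "(U, \<phi>) \<in> A" "p \<in> U" "open W" "p \<in> W"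
  obtains r where "r > 0" "cball (\<phi> p) r \<subseteq> \<phi> ` (U \<inter> W)"
proof -
  have "\<phi> p \<in> \<phi> ` (U \<inter> W)" using assms by blast
  then show thesis
    using open_chart_image[OF assms(1,3)] that unfolding open_contains_cball by blast
qed

text \<open>The closed set \<open>K\<close> is part of the statement because extending products by
  zero requires \<open>b\<close> to vanish near each point outside \<open>W\<close>, not merely at
  it; \<open>bump_mult\<close> relies on this.\<close>

lemma bump:
  assumes "open W" "p \<in> W"
  shows "\<exists>b K. b \<in> smooth_functions A \<and> b p = 1 \<and> closed K \<and> K \<subseteq> W \<and> (\<forall>r. r \<notin> K \<longrightarrow> b r = 0)"
proof -
  obtain U \<phi> where U: "(U, \<phi>) \<in> A" "p \<in> U" by (rule chart_at)
  obtain r where r: "r > 0" "cball (\<phi> p) r \<subseteq> \<phi> ` (U \<inter> W)" by (rule chart_cball[OF U assms])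
  obtain \<beta> :: "'a \<Rightarrow> real" where \<beta>: "smooth_on UNIV \<beta>" "\<beta> (\<phi> p) = 1" "\<And>x. x \<notin> cball (\<phi> p) r \<Longrightarrow> \<beta> x = 0"
    using euclidean_bump[OF r(1), of "\<phi> p"] by metis
  have sub: "cball (\<phi> p) r \<subseteq> \<phi> ` U" using r(2) by blast
  note f = chart_function[OF U(1) \<beta>(1) compact_cball sub \<beta>(3)]
  have "inv_into U \<phi> ` cball (\<phi> p) r \<subseteq> W"
    using r(2) chart(4)[OF U(1)] by (force simp: inv_into_f_f)
  then show ?thesis using f(1,2,4) U(2) \<beta>(2)
    by (intro exI[of _ "\<lambda>p. if p \<in> U then \<beta> (\<phi> p) else 0"] exI[of _ "inv_into U \<phi> ` cball (\<phi> p) r"]) auto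
qed

lemma bump_mult:
  assumes "b \<in> smooth_functions A" "closed K" "K \<subseteq> U" "\<And>r. r \<notin> K \<Longrightarrow> b r = 0"
    and "open U" "open V" "smooth_fun_on A (U \<inter> V) c"
  shows "smooth_fun_on A V (\<lambda>r. if r \<in> U then b r * c r else 0)"
proof -
  have "smooth_at A p (\<lambda>r. if r \<in> U then b r * c r else 0)" if p: "p \<in> V" for p
  proof (cases "p \<in> U")
    case True
    have "smooth_at A p (\<lambda>r. b r * c r)"
      using assms p True
      by (intro smooth_at_mult) (auto simp: smooth_functions_iff smooth_fun_on_iff open_Int)
    then show ?thesis by (rule smooth_at_cong[of _ _ U]) (use assms True in auto)
  next
    case False
    show ?thesis
      by (rule smooth_at_cong[OF smooth_at_const[of p 0], of "- K"]) (use assms False in auto)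
  qed
  then show ?thesis by (simp add: smooth_fun_on_iff assms)
qed

section \<open>Tangent spaces\<close>

lemma tangent_space_smooth:
  assumes "x \<in> tangent_space A p"
  shows "\<And>f g. f \<in> smooth_functions A \<Longrightarrow> g \<in> smooth_functions A \<Longrightarrow> x (\<lambda>r. f r + g r) = x f + x g"
    and "\<And>f g. f \<in> smooth_functions A \<Longrightarrow> g \<in> smooth_functions A
      \<Longrightarrow> x (\<lambda>r. f r * g r) = x f * g p + f p * x g"
    and "\<And>f. f \<notin> smooth_functions A \<Longrightarrow> x f = 0"
proof -
  show "x (\<lambda>r. f r + g r) = x f + x g" if "f \<in> smooth_functions A" "g \<in> smooth_functions A" for f g
    using assms that unfolding tangent_space_def linear_on_def by (simp add: plus_fun_def)
qed (use assms in \<open>auto simp: tangent_space_def\<close>)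

lemma subspace_tangent_space: "subspace (tangent_space A p)"
  unfolding tangent_space_def linear_on_def
  by (rule subspaceI) (auto simp: scaleR_fun_def algebra_simps)

text \<open>The derivations are the partial derivatives in a chart at \<open>p\<close>; the
  functions are the centred coordinates of this chart, multiplied by a bump function to make them
  global.\<close>

lemma coordinate_derivations:
  "\<exists>(D :: 'a \<Rightarrow> 'm tangent) (x :: 'a \<Rightarrow> 'm \<Rightarrow> real).
     (\<forall>i\<in>Basis. D i \<in> tangent_space A p) \<and>
     (\<forall>i\<in>Basis. \<forall>j\<in>Basis. D i (x j) = (if i = j then 1 else 0))"
proof -
  let ?C = "smooth_functions A"
  obtain U \<phi> where U: "(U, \<phi>) \<in> A" "p \<in> U" by (rule chart_at)
  note c = chart[OF U(1)]
  let ?y = "\<phi> p" and ?l = "\<lambda>f. f \<circ> inv_into U \<phi>"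
  obtain r where r: "r > 0" "cball ?y r \<subseteq> \<phi> ` (U \<inter> UNIV)"
    by (rule chart_cball[OF U open_UNIV UNIV_I])
  obtain \<beta> :: "'a \<Rightarrow> real" where \<beta>: "smooth_on UNIV \<beta>" "\<beta> ?y = 1" "\<And>x. x \<notin> cball ?y r \<Longrightarrow> \<beta> x = 0"
    using euclidean_bump[OF r(1), of "\<phi> p"] by metis
  define D :: "'a \<Rightarrow> 'm tangent"
    where "D i f = (if f \<in> ?C then frechet_derivative (?l f) (at ?y) i else 0)" for i f
  \<comment> \<open>Centring makes the coordinate vanish at the base point, which removes the
    derivative of the bump factor; that factor is 1 there, so the differential of \<open>X j\<close>
    is the j-th coordinate.\<close>
  define X where "X j z = \<beta> z * (z \<bullet> j + - (?y \<bullet> j))" for j z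
  define x where "x j = (\<lambda>p. if p \<in> U then X j (\<phi> p) else 0)" for j
  have diff: "(?l f has_derivative frechet_derivative (?l f) (at ?y)) (at ?y)" if "f \<in> ?C" for f
  proof -
    have "smooth_on (\<phi> ` (U \<inter> UNIV)) (?l f)"
      using that U(1) unfolding smooth_functions_def smooth_fun_on_def by blast
    then have "Ck_on (Suc 0) (\<phi> ` U) (?l f)" unfolding smooth_on_def by simp
    then show ?thesis by (rule Ck_on_SucD(1)) (use U(2) in blast)
  qed
  have lp: "?l f ?y = f p" for f using c(4) U(2) by (simp add: inv_into_f_f)
  have D: "D i \<in> tangent_space A p" for i
    unfolding tangent_space_def mem_Collect_eq
  proof (intro conjI linear_onI ballI allI impI)
    fix f h assume fh: "f \<in> ?C" "h \<in> ?C"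
    have "frechet_derivative (?l (f + h)) (at ?y) = (\<lambda>v. frechet_derivative (?l f) (at ?y) v + frechet_derivative (?l h) (at ?y) v)"
      using has_derivative_add[OF diff[OF fh(1)] diff[OF fh(2)]]
      by (intro frechet_derivative_at[symmetric]) (simp add: o_def)
    then show "D i (f + h) = D i f + D i h"
      using fh by (simp add: D_def smooth_functions_plus)
    have "frechet_derivative (?l (\<lambda>q. f q * h q)) (at ?y)
        = (\<lambda>v. ?l f ?y * frechet_derivative (?l h) (at ?y) v + frechet_derivative (?l f) (at ?y) v * ?l h ?y)"
      using has_derivative_mult[OF diff[OF fh(1)] diff[OF fh(2)]]
      by (intro frechet_derivative_at[symmetric]) (simp add: o_def)
    then show "D i (\<lambda>q. f q * h q) = D i f * h p + f p * D i h"
      unfolding lp using fh by (simp add: D_def smooth_functions_mult)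
  next
    fix f r assume f: "f \<in> ?C"
    have "frechet_derivative (?l (r *\<^sub>R f)) (at ?y) = (\<lambda>v. r *\<^sub>R frechet_derivative (?l f) (at ?y) v)"
      using has_derivative_scaleR_right[OF diff[OF f], of r]
      by (intro frechet_derivative_at[symmetric]) (simp add: o_def scaleR_fun_def)
    then show "D i (r *\<^sub>R f) = r *\<^sub>R D i f"
      using f by (simp add: D_def smooth_functions_scaleR)
  qed (simp add: D_def)
  have X: "smooth_on UNIV (X j)" for j
    unfolding X_def
    by (intro smooth_on_mult smooth_on_add smooth_on_const \<beta>(1) open_UNIV smooth_on_id
        smooth_on_bounded_linear[OF bounded_linear_inner_left])
  have x: "x j \<in> ?C" for j
    unfolding x_def using r(2) \<beta>(3)
    by (intro chart_function(1)[OF U(1) X compact_cball, of ?y r]) (auto simp: X_def)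
  have "D i (x j) = (if i = j then 1 else 0)" if "i \<in> Basis" "j \<in> Basis" for i j
  proof -
    have "(\<beta> has_derivative frechet_derivative \<beta> (at ?y)) (at ?y)"
      using \<beta>(1) unfolding smooth_on_def
      by (metis Ck_on.simps(2) UNIV_I frechet_derivative_works)
    then have "(X j has_derivative (\<lambda>v. v \<bullet> j)) (at ?y)"
      unfolding X_def by (auto intro!: derivative_eq_intros simp: \<beta>(2))
    then have "(?l (x j) has_derivative (\<lambda>v. v \<bullet> j)) (at ?y)"
      by (rule has_derivative_transform_within_open[OF _ c(2)])
        (use U c(4) in \<open>auto simp: x_def inv_into_f_f\<close>)
    then have "frechet_derivative (?l (x j)) (at ?y) = (\<lambda>v. v \<bullet> j)"
      by (rule frechet_derivative_at[symmetric])
    then show ?thesis using x that by (simp add: D_def inner_Basis)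
  qed
  then show ?thesis using D by blast
qed

text \<open>Evaluation on the dual coordinate functions shows that the partial derivatives are
  independent. Through this bound the assumption on \<open>DIM('a)\<close> in the theorem excludes n
  = 1.\<close>

lemma dim_tangent_space:
  assumes "findim (tangent_space A p)"
  shows "DIM('a) \<le> card (some_basis (tangent_space A p))"
proof -
  interpret findim "tangent_space A p" by fact
  obtain D :: "'a \<Rightarrow> 'm tangent" and x :: "'a \<Rightarrow> 'm \<Rightarrow> real"
    where D: "\<And>i. i \<in> Basis \<Longrightarrow> D i \<in> tangent_space A p"
    and x: "\<And>i j. i \<in> Basis \<Longrightarrow> j \<in> Basis \<Longrightarrow> D i (x j) = (if i = j then 1 else 0)"
    using coordinate_derivations[of p] by blast
  have inj: "inj_on D Basis"
    using x by (intro inj_onI) (metis zero_neq_one)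
  have app: "(\<Sum>i\<in>I. u i *\<^sub>R D i) f = (\<Sum>i\<in>I. u i * D i f)" for u I f
    by (induction I rule: infinite_finite_induct) (auto simp: scaleR_fun_def)
  have "independent (D ` Basis)"
  proof
    assume "dependent (D ` Basis)"
    then obtain u where u: "\<exists>v\<in>D ` Basis. u v \<noteq> 0" "(\<Sum>v\<in>D ` Basis. u v *\<^sub>R v) = 0"
      by (auto simp: dependent_finite)
    have "u (D j) = 0" if "j \<in> Basis" for j
    proof -
      have "0 = (\<Sum>i\<in>Basis. u (D i) *\<^sub>R D i) (x j)" using u(2) by (simp add: sum.reindex[OF inj])
      also have "\<dots> = (\<Sum>i\<in>Basis. if i = j then u (D i) else 0)"
        unfolding app by (intro sum.cong) (auto simp: x that)
      finally show ?thesis using that by simp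
    qed
    then show False using u(1) by blast
  qed
  moreover have "D ` Basis \<subseteq> span (some_basis (tangent_space A p))"
    using D span_basis[OF some_basis(1)] by auto
  ultimately have "card (D ` Basis) \<le> card (some_basis (tangent_space A p))"
    using independent_span_bound[OF some_basis(2)] by blast
  then show ?thesis by (simp add: card_image[OF inj])
qed

end

section \<open>Sections of vector bundles\<close>

text \<open>Gaussian elimination over the ring of germs of smooth functions at \<open>p\<close>.\<close>

lemma (in manifold) smooth_at_solution:
  assumes "\<And>a j. a \<in> L \<Longrightarrow> j < N \<Longrightarrow> smooth_at A p (a j)"
    and "\<And>a. a \<in> L \<Longrightarrow> smooth_at A p (\<lambda>r. \<Sum>j<N. a j r * c j r)"
    and "\<And>x :: nat \<Rightarrow> real. (\<And>a. a \<in> L \<Longrightarrow> (\<Sum>j<N. a j p * x j) = 0) \<Longrightarrow> \<forall>j<N. x j = 0"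
  shows "\<forall>j<N. smooth_at A p (c j)"
  using assms
proof (induction N arbitrary: L)
  case (Suc N)
  have "\<exists>a\<in>L. a N p \<noteq> 0"
  proof (rule ccontr)
    assume "\<not> (\<exists>a\<in>L. a N p \<noteq> 0)"
    \<comment> \<open>Injectivity at \<open>p\<close> is applied to the last unit vector: if all
      entries of the last column vanished at \<open>p\<close>, that vector would solve the
      homogeneous system. So a row with a nonzero pivot exists.\<close>
    then have "\<forall>j<Suc N. (if j = N then 1 else 0 :: real) = 0"
      by (intro Suc.prems(3)) (simp add: sum.neutral)
    then show False by auto
  qed
  then obtain d where d: "d \<in> L" "d N p \<noteq> 0" by blast
  have sd: "smooth_at A p (d j)" if "j < Suc N" for j using Suc.prems(1)[OF d(1)] that .
  \<comment> \<open>Subtracts the multiple of the pivot row \<open>d\<close> that removes the last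
    unknown; the quotient is a smooth germ because the pivot is nonzero at \<open>p\<close>.\<close>
  define elim where "elim a = (\<lambda>j r. a j r - a N r / d N r * d j r)" for a :: "nat \<Rightarrow> 'm \<Rightarrow> real"
  obtain W where W: "open W" "p \<in> W" "\<And>r. r \<in> W \<Longrightarrow> d N r \<noteq> 0"
    using smooth_at_nonzero_nbhd[OF sd d(2)] by auto
  have IH: "\<forall>j<N. smooth_at A p (c j)"
  proof (rule Suc.IH[of "elim ` L"])
    fix b j assume b: "b \<in> elim ` L" and j: "j < N"
    obtain a where a: "a \<in> L" "b = elim a" using b by blast
    have "smooth_at A p (a j)" "smooth_at A p (a N)" "smooth_at A p (d j)" "smooth_at A p (d N)"
      using Suc.prems(1)[OF a(1)] sd j by auto
    then show "smooth_at A p (b j)"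
      unfolding a(2) elim_def by (intro smooth_at_diff smooth_at_mult smooth_at_divide d(2))
  next
    fix b assume "b \<in> elim ` L"
    then obtain a where a: "a \<in> L" "b = elim a" by blast
    let ?S = "\<lambda>a r. \<Sum>j<Suc N. a j r * c j r"
    have "smooth_at A p (\<lambda>r. ?S a r - a N r / d N r * ?S d r)"
      using a d Suc.prems(1,2) by (intro smooth_at_diff smooth_at_mult smooth_at_divide) auto
    then show "smooth_at A p (\<lambda>r. \<Sum>j<N. b j r * c j r)"
    proof (rule smooth_at_cong[OF _ W(1,2)])
      fix r assume "r \<in> W"
      then have "d N r \<noteq> 0" by (rule W(3))
      then show "?S a r - a N r / d N r * ?S d r = (\<Sum>j<N. b j r * c j r)"
        by (simp add: a elim_def algebra_simps sum_subtractf sum_distrib_left)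
    qed
  next
    fix x :: "nat \<Rightarrow> real"
    assume x: "\<And>b. b \<in> elim ` L \<Longrightarrow> (\<Sum>j<N. b j p * x j) = 0"
    \<comment> \<open>A solution of the reduced homogeneous system is completed by solving the pivot
      row for the last unknown, so injectivity passes to the reduced system.\<close>
    define y where "y j = (if j = N then - (\<Sum>j<N. d j p * x j) / d N p else x j)" for j
    have "\<forall>j<Suc N. y j = 0"
    proof (rule Suc.prems(3))
      fix a assume "a \<in> L"
      then have "(\<Sum>j<N. elim a j p * x j) = 0" using x by blast
      then have "(\<Sum>j<N. a j p * x j) = a N p / d N p * (\<Sum>j<N. d j p * x j)"
        by (simp add: elim_def algebra_simps sum_subtractf sum_distrib_left)
      then show "(\<Sum>j<Suc N. a j p * y j) = 0" by (simp add: y_def)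
    qed
    then have "y j = 0" if "j < N" for j using that by simp
    then show "\<forall>j<N. x j = 0" by (simp add: y_def)
  qed
  have "smooth_at A p (\<lambda>r. ((\<Sum>j<Suc N. d j r * c j r) - (\<Sum>j<N. d j r * c j r)) / d N r)"
    using IH d by (intro smooth_at_divide smooth_at_diff smooth_at_sum smooth_at_mult sd Suc.prems(2)) auto
  then have "smooth_at A p (c N)"
    by (rule smooth_at_cong[OF _ W(1,2)]) (use W(3) in auto)
  then show ?case using IH by (auto simp: less_Suc_eq)
qed simp

locale smooth_bundle =
  fixes E :: "('m::{t2_space, second_countable_topology}, 'a::euclidean_space, 'e::real_vector, 'z) vbundle_scheme"
  assumes vector_bundle: "vector_bundle E"
begin

sublocale manifold "base E"
  by unfold_locales (use vector_bundle in \<open>simp add: vector_bundle_def\<close>)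

abbreviation "C \<equiv> smooth_functions (base E)"
abbreviation "\<Gamma> \<equiv> sections E"

definition frame_coef :: "(nat \<Rightarrow> 'm \<Rightarrow> 'e) \<Rightarrow> 'm \<Rightarrow> 'e \<Rightarrow> nat \<Rightarrow> real" where
  "frame_coef e p x i = representation ((\<lambda>i. e i p) ` {..<rk E}) x (e i p)"

lemma subspace_fibre: "subspace (fibre E p)"
  using vector_bundle by (simp add: vector_bundle_def)

lemma frame_at: obtains U e where "(U, e) \<in> frames E" "p \<in> U"
proof -
  have "p \<in> (\<Union>(U, e)\<in>frames E. U)" using vector_bundle by (simp add: vector_bundle_def)
  then show thesis using that by blast
qed

lemma frame:
  assumes "(U, e) \<in> frames E"
  shows "open U"
    and "p \<in> U \<Longrightarrow> inj_on (\<lambda>i. e i p) {..<rk E}"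
    and "p \<in> U \<Longrightarrow> is_basis (fibre E p) ((\<lambda>i. e i p) ` {..<rk E})"
    and "(V, e') \<in> frames E \<Longrightarrow> i < rk E \<Longrightarrow> smooth_on_frame E U (V, e') (e i)"
proof -
  have *: "open U \<and> (\<forall>p\<in>U. inj_on (\<lambda>i. e i p) {..<rk E} \<and> is_basis (fibre E p) ((\<lambda>i. e i p) ` {..<rk E}))"
    using vector_bundle assms unfolding vector_bundle_def by blast
  then show "open U" "p \<in> U \<Longrightarrow> inj_on (\<lambda>i. e i p) {..<rk E}"
    "p \<in> U \<Longrightarrow> is_basis (fibre E p) ((\<lambda>i. e i p) ` {..<rk E})" by auto
  show "(V, e') \<in> frames E \<Longrightarrow> i < rk E \<Longrightarrow> smooth_on_frame E U (V, e') (e i)"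
    using vector_bundle assms unfolding vector_bundle_def by blast
qed

lemma findim_fibre: "findim (fibre E p)"
proof -
  obtain U e where "(U, e) \<in> frames E" "p \<in> U" by (rule frame_at)
  then show ?thesis using frame(3) subspace_fibre by unfold_locales blast+
qed

lemma frame_mem: "(U, e) \<in> frames E \<Longrightarrow> p \<in> U \<Longrightarrow> i < rk E \<Longrightarrow> e i p \<in> fibre E p"
  using frame(3) by (force simp: is_basis_def)

lemma linear_on_coef:
  "(U, e) \<in> frames E \<Longrightarrow> p \<in> U \<Longrightarrow> linear_on (fibre E p) (\<lambda>x. frame_coef e p x i)"
  unfolding frame_coef_def by (intro findim.linear_on_representation[OF findim_fibre] frame(3))

lemma coef_sum:
  assumes "(U, e) \<in> frames E" "p \<in> U" "x \<in> fibre E p"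
  shows "(\<Sum>i<rk E. frame_coef e p x i *\<^sub>R e i p) = x"
  using findim.basis_sum[OF findim_fibre frame(3)[OF assms(1,2)] assms(3)]
  by (simp add: frame_coef_def sum.reindex[OF frame(2)[OF assms(1,2)]])

lemma coef_eqI:
  assumes "(U, e) \<in> frames E" "p \<in> U" "x = (\<Sum>i<rk E. c i *\<^sub>R e i p)" "j < rk E"
  shows "frame_coef e p x j = c j"
proof -
  have kron: "frame_coef e p (e i p) j = (if i = j then 1 else 0)" if "i < rk E" for i
    using frame(2,3)[OF assms(1,2)] that assms(4)
    by (auto simp: frame_coef_def is_basis_def representation_basis inj_on_def)
  have "frame_coef e p x j = (\<Sum>i<rk E. c i *\<^sub>R frame_coef e p (e i p) j)"
    unfolding assms(3)
    by (rule linear_on_lincomb[OF linear_on_coef[OF assms(1,2)] subspace_fibre])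
      (auto intro: frame_mem[OF assms(1,2)])
  also have "\<dots> = (\<Sum>i<rk E. if i = j then c i else 0)" by (intro sum.cong) (auto simp: kron)
  finally show ?thesis using assms(4) by simp
qed

text \<open>Uniqueness of coefficients in a frame replaces the existential in
  \<open>smooth_on_frame\<close> by the functions \<open>frame_coef\<close>, and smoothness becomes
  a condition at each point.\<close>

lemma sections_iff:
  "s \<in> \<Gamma> \<longleftrightarrow> (\<forall>p. s p \<in> fibre E p) \<and>
    (\<forall>U e p i. (U, e) \<in> frames E \<longrightarrow> p \<in> U \<longrightarrow> i < rk E \<longrightarrow> smooth_at (base E) p (\<lambda>r. frame_coef e r (s r) i))"
    (is "_ \<longleftrightarrow> ?fib \<and> ?sm")
proof
  assume s: "s \<in> \<Gamma>"
  have ?sm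
  proof (intro allI impI)
    fix U e p i assume a: "(U, e) \<in> frames E" "p \<in> U" "i < rk E"
    have "smooth_on_frame E UNIV (U, e) s" using s a(1) by (auto simp: sections_def)
    then obtain c where c: "\<forall>i<rk E. smooth_fun_on (base E) U (c i)" "\<forall>p\<in>U. s p = (\<Sum>i<rk E. c i p *\<^sub>R e i p)"
      unfolding smooth_on_frame_def by auto
    then have "smooth_at (base E) p (c i)" using a frame(1)[OF a(1)] by (auto simp: smooth_fun_on_iff)
    then show "smooth_at (base E) p (\<lambda>r. frame_coef e r (s r) i)"
      by (rule smooth_at_cong[OF _ frame(1)[OF a(1)] a(2)]) (use coef_eqI[OF a(1)] a(3) c(2) in auto)
  qed
  then show "?fib \<and> ?sm" using s by (auto simp: sections_def)
next
  assume *: "?fib \<and> ?sm"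
  have "smooth_on_frame E UNIV (U, e) s" if "(U, e) \<in> frames E" for U e
    unfolding smooth_on_frame_def
    using * that frame(1)[OF that] coef_sum[OF that, symmetric]
    by (auto simp: smooth_fun_on_iff intro!: exI[of _ "\<lambda>i r. frame_coef e r (s r) i"])
  then show "s \<in> \<Gamma>" using * by (auto simp: sections_def)
qed

lemma section_fibre: "s \<in> \<Gamma> \<Longrightarrow> s p \<in> fibre E p"
  by (simp add: sections_def)

lemma section_coef_smooth:
  "s \<in> \<Gamma> \<Longrightarrow> (U, e) \<in> frames E \<Longrightarrow> p \<in> U \<Longrightarrow> i < rk E \<Longrightarrow> smooth_at (base E) p (\<lambda>r. frame_coef e r (s r) i)"
  by (simp add: sections_iff)

lemma section_add:
  assumes "s \<in> \<Gamma>" "t \<in> \<Gamma>" shows "s + t \<in> \<Gamma>"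
  unfolding sections_iff
proof (intro conjI allI impI)
  show "(s + t) p \<in> fibre E p" for p
    using assms subspace_fibre by (simp add: subspace_add section_fibre)
next
  fix U e p i assume a: "(U, e) \<in> frames E" "p \<in> U" "i < rk E"
  have "smooth_at (base E) p (\<lambda>r. frame_coef e r (s r) i + frame_coef e r (t r) i)"
    using assms a by (intro smooth_at_add section_coef_smooth)
  then show "smooth_at (base E) p (\<lambda>r. frame_coef e r ((s + t) r) i)"
    by (rule smooth_at_cong[OF _ frame(1)[OF a(1)] a(2)])
      (use assms in \<open>simp add: section_fibre linear_on_add[OF linear_on_coef[OF a(1)]]\<close>)
qed

lemma section_fscale:
  assumes "f \<in> C" "s \<in> \<Gamma>" shows "fscale f s \<in> \<Gamma>"
  unfolding sections_iff
proof (intro conjI allI impI)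
  show "fscale f s p \<in> fibre E p" for p
    using assms subspace_fibre by (simp add: subspace_scale section_fibre fscale_def)
next
  fix U e p i assume a: "(U, e) \<in> frames E" "p \<in> U" "i < rk E"
  have "smooth_at (base E) p (\<lambda>r. f r * frame_coef e r (s r) i)"
    using assms a by (intro smooth_at_mult section_coef_smooth) (auto simp: smooth_functions_iff)
  then show "smooth_at (base E) p (\<lambda>r. frame_coef e r (fscale f s r) i)"
    by (rule smooth_at_cong[OF _ frame(1)[OF a(1)] a(2)])
      (use assms in \<open>simp add: section_fibre fscale_def linear_on_scale[OF linear_on_coef[OF a(1)]]\<close>)
qed

lemma section_scaleR: "s \<in> \<Gamma> \<Longrightarrow> r *\<^sub>R s \<in> \<Gamma>"
  using section_fscale[OF smooth_functions_const, of s r] by (simp add: fscale_def scaleR_fun_def)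

lemma section_minus: "s \<in> \<Gamma> \<Longrightarrow> - s \<in> \<Gamma>"
  using section_scaleR[of s "-1"] by simp

lemma section_diff: "s \<in> \<Gamma> \<Longrightarrow> t \<in> \<Gamma> \<Longrightarrow> s - t \<in> \<Gamma>"
  using section_add[OF _ section_minus, of s t] by simp

lemma section_zero: "0 \<in> \<Gamma>"
  unfolding sections_iff
proof (intro conjI allI impI)
  fix U e p i assume a: "(U, e) \<in> frames E" "p \<in> U" "i < rk E"
  show "smooth_at (base E) p (\<lambda>r. frame_coef e r (0 r) i)"
    by (simp add: frame_coef_def real_vector.representation_zero smooth_at_const)
qed (simp add: subspace_fibre subspace_0)

lemma subspace_sections: "subspace \<Gamma>"
  by (intro subspaceI section_zero section_add section_scaleR)

lemma section_sum: "(\<And>i. i \<in> I \<Longrightarrow> s i \<in> \<Gamma>) \<Longrightarrow> (\<Sum>i\<in>I. s i) \<in> \<Gamma>"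
  by (rule subspace_sum[OF subspace_sections])

section \<open>Global sections from local frames\<close>

definition cutoff :: "('m \<Rightarrow> real) \<Rightarrow> 'm set \<Rightarrow> ('m \<Rightarrow> 'w::real_vector) \<Rightarrow> 'm \<Rightarrow> 'w" where
  "cutoff b U s = (\<lambda>r. if r \<in> U then b r *\<^sub>R s r else 0)"

text \<open>One bump function supported in the domain of the frame globalises both the frame fields
  and any smooth coefficient on that domain without changing their values at
  \<open>p\<close>.\<close>

lemma frame_cutoff:
  assumes "(U, e) \<in> frames E" "p \<in> U"
  shows "\<exists>b. b \<in> C \<and> b p = 1 \<and> (\<forall>r. r \<notin> U \<longrightarrow> b r = 0) \<and> (\<forall>i<rk E. cutoff b U (e i) \<in> \<Gamma>) \<and>
    (\<forall>c. smooth_fun_on (base E) U c \<longrightarrow> cutoff b U c \<in> C)"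
proof -
  obtain b K where b: "b \<in> C" "b p = 1" "closed K" "K \<subseteq> U" "\<forall>r. r \<notin> K \<longrightarrow> b r = 0"
    using bump[OF frame(1)[OF assms(1)] assms(2)] by metis
  have sm: "smooth_fun_on (base E) V (cutoff b U c)" if "open V" "smooth_fun_on (base E) (U \<inter> V) c" for c V
    unfolding cutoff_def real_scaleR_def
    by (rule bump_mult[OF b(1,3,4) _ frame(1)[OF assms(1)] that]) (use b(5) in blast)
  have "cutoff b U (e i) \<in> \<Gamma>" if i: "i < rk E" for i
  proof -
    have "smooth_on_frame E UNIV (V, e') (cutoff b U (e i))" if V: "(V, e') \<in> frames E" for V e'
    proof -
      have "smooth_on_frame E U (V, e') (e i)" using frame(4)[OF assms(1) V i] .
      then obtain c where c: "\<forall>j<rk E. smooth_fun_on (base E) (V \<inter> U) (c j)"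
          "\<forall>r\<in>V \<inter> U. e i r = (\<Sum>j<rk E. c j r *\<^sub>R e' j r)"
        unfolding smooth_on_frame_def by auto
      have "\<forall>j<rk E. smooth_fun_on (base E) V (cutoff b U (c j))"
        using c(1) sm[OF frame(1)[OF V]] by (simp add: Int_commute)
      moreover have "cutoff b U (e i) r = (\<Sum>j<rk E. cutoff b U (c j) r *\<^sub>R e' j r)" if "r \<in> V" for r
        using c(2) that by (simp add: cutoff_def scaleR_sum_right)
      ultimately show ?thesis unfolding smooth_on_frame_def by auto
    qed
    moreover have "cutoff b U (e i) r \<in> fibre E r" for r
      using frame_mem[OF assms(1) _ i] subspace_fibre by (simp add: cutoff_def subspace_scale subspace_0)
    ultimately show ?thesis by (auto simp: sections_def)
  qed
  moreover have "cutoff b U c \<in> C" if "smooth_fun_on (base E) U c" for c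
    using sm[of UNIV c] that by (simp add: smooth_functions_def)
  ultimately show ?thesis using b by blast
qed

lemma section_through:
  assumes "a \<in> fibre E p"
  shows "\<exists>s\<in>\<Gamma>. s p = a"
proof -
  obtain U e where U: "(U, e) \<in> frames E" "p \<in> U" by (rule frame_at)
  obtain b where b: "b p = 1" "\<forall>i<rk E. cutoff b U (e i) \<in> \<Gamma>"
    using frame_cutoff[OF U] by blast
  have app: "(\<Sum>i\<in>I. frame_coef e p a i *\<^sub>R cutoff b U (e i)) p = (\<Sum>i\<in>I. frame_coef e p a i *\<^sub>R e i p)" for I
    by (induction I rule: infinite_finite_induct) (auto simp: scaleR_fun_def cutoff_def U(2) b(1))
  show ?thesis
    using b(2) app coef_sum[OF U assms]
    by (intro bexI[of _ "\<Sum>i<rk E. frame_coef e p a i *\<^sub>R cutoff b U (e i)"] section_sum section_scaleR) auto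
qed

section \<open>Operators linear over the smooth functions and their values at a point\<close>

definition tensorial :: "(('m \<Rightarrow> 'e) \<Rightarrow> 'm \<Rightarrow> 'w::real_vector) \<Rightarrow> bool" where
  "tensorial op \<longleftrightarrow> (\<forall>u\<in>\<Gamma>. \<forall>v\<in>\<Gamma>. op (u + v) = op u + op v) \<and> (\<forall>f\<in>C. \<forall>u\<in>\<Gamma>. op (fscale f u) = fscale f (op u))"

lemma tensorialI:
  assumes "\<And>u v p. u \<in> \<Gamma> \<Longrightarrow> v \<in> \<Gamma> \<Longrightarrow> op (u + v) p = op u p + op v p"
    and "\<And>f u p. f \<in> C \<Longrightarrow> u \<in> \<Gamma> \<Longrightarrow> op (fscale f u) p = f p *\<^sub>R op u p"
  shows "tensorial op"
  using assms by (auto simp: tensorial_def fscale_def fun_eq_iff)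

text \<open>Near \<open>p\<close> the section is a combination of frame fields with coefficients
  that vanish at \<open>p\<close>; linearity over functions pulls these coefficients out. Cutting
  off makes the argument global.\<close>

lemma tensorial_zero:
  assumes "tensorial op" "u \<in> \<Gamma>" "u p = 0"
  shows "op u p = 0"
proof -
  obtain U e where U: "(U, e) \<in> frames E" "p \<in> U" by (rule frame_at)
  obtain b where b: "b \<in> C" "b p = 1" "\<forall>r. r \<notin> U \<longrightarrow> b r = 0" "\<forall>i<rk E. cutoff b U (e i) \<in> \<Gamma>"
    "\<forall>c. smooth_fun_on (base E) U c \<longrightarrow> cutoff b U c \<in> C"
    using frame_cutoff[OF U] by blast
  define c where "c i = cutoff b U (\<lambda>r. frame_coef e r (u r) i)" for i
  have c: "c i \<in> C" if "i < rk E" for i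
    using b(5) section_coef_smooth[OF assms(2) U(1) _ that] frame(1)[OF U(1)]
    by (simp add: c_def smooth_fun_on_iff)
  have cp: "c i p = 0" for i
    by (simp add: c_def cutoff_def U assms(3) frame_coef_def real_vector.representation_zero)
  have sum_app: "(\<Sum>i\<in>I. f i) r = (\<Sum>i\<in>I. f i r)" for f :: "nat \<Rightarrow> 'm \<Rightarrow> 'x::real_vector" and I r
    by (induction I rule: infinite_finite_induct) auto
  \<comment> \<open>The bump factor enters twice: one factor makes the coefficient a global
    function, the other makes the frame field a global section.\<close>
  have "fscale (\<lambda>r. b r * b r) u = (\<Sum>i<rk E. fscale (c i) (cutoff b U (e i)))"
  proof
    fix r show "fscale (\<lambda>r. b r * b r) u r = (\<Sum>i<rk E. fscale (c i) (cutoff b U (e i))) r"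
    proof (cases "r \<in> U")
      case True
      have "(\<Sum>i<rk E. fscale (c i) (cutoff b U (e i))) r = (b r * b r) *\<^sub>R (\<Sum>i<rk E. frame_coef e r (u r) i *\<^sub>R e i r)"
        by (simp add: sum_app fscale_def c_def cutoff_def True scaleR_sum_right algebra_simps)
      then show ?thesis using coef_sum[OF U(1) True] assms(2) by (simp add: section_fibre fscale_def)
    qed (use b(3) in \<open>simp add: sum_app fscale_def c_def cutoff_def\<close>)
  qed
  then have "op (fscale (\<lambda>r. b r * b r) u) p = op (\<Sum>i<rk E. fscale (c i) (cutoff b U (e i))) p" by simp
  moreover have "op (fscale (\<lambda>r. b r * b r) u) p = op u p"
    using assms b(1,2) smooth_functions_mult[OF b(1) b(1)] by (simp add: tensorial_def fscale_def)
  moreover have "op (\<Sum>i\<in>I. fscale (c i) (cutoff b U (e i))) p = 0" if "I \<subseteq> {..<rk E}" for I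
    using that
  proof (induction I rule: infinite_finite_induct)
    case empty
    have "op (fscale (\<lambda>r. 0) 0) = fscale (\<lambda>r. 0) (op 0)"
      using assms(1) smooth_functions_const section_zero unfolding tensorial_def by blast
    then show ?case by (simp add: fscale_def zero_fun_def)
  next
    case (insert i I)
    have *: "fscale (c j) (cutoff b U (e j)) \<in> \<Gamma>" if "j < rk E" for j
      using that b(4) c by (intro section_fscale) auto
    have eq: "op (fscale (c i) (cutoff b U (e i)) + (\<Sum>i\<in>I. fscale (c i) (cutoff b U (e i))))
        = op (fscale (c i) (cutoff b U (e i))) + op (\<Sum>i\<in>I. fscale (c i) (cutoff b U (e i)))"
      using assms(1) insert.prems * section_sum[of I "\<lambda>i. fscale (c i) (cutoff b U (e i))"]
      unfolding tensorial_def by (simp add: subset_iff)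
    have 0: "op (fscale (c i) (cutoff b U (e i))) p = 0"
      using assms(1) insert.prems b(4) c cp by (simp add: tensorial_def fscale_def)
    show ?case
      unfolding sum.insert[OF insert.hyps] eq using insert.IH insert.prems 0 by simp
  qed (simp add: finite_subset[OF _ finite_lessThan])
  ultimately show ?thesis by (metis subset_refl)
qed

lemma tensorial_cong:
  assumes "tensorial op" "u \<in> \<Gamma>" "v \<in> \<Gamma>" "u p = v p"
  shows "op u p = op v p"
proof -
  have m: "fscale (\<lambda>r. - 1) v = - v" by (auto simp: fscale_def)
  have "op (u + fscale (\<lambda>r. - 1) v) = op u + fscale (\<lambda>r. - 1) (op v)"
    using assms(1-3) section_minus[OF assms(3)] smooth_functions_const[of "-1"]
    unfolding tensorial_def m by (metis m)
  moreover have "op (u + fscale (\<lambda>r. - 1) v) p = 0"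
    unfolding m
    by (rule tensorial_zero[OF assms(1) section_add[OF assms(2) section_minus[OF assms(3)]]])
      (simp add: assms(4))
  ultimately show ?thesis by (simp add: fscale_def)
qed

text \<open>By \<open>tensorial_cong\<close> the section chosen in \<open>value_at\<close> may be
  exchanged for any other one with the same value at \<open>p\<close>.\<close>

lemma value_at_section:
  assumes "tensorial op" "u \<in> \<Gamma>"
  shows "value_at \<Gamma> op p (u p) = op u p"
proof -
  have "\<exists>s. s \<in> \<Gamma> \<and> s p = u p" using assms by blast
  then have "(SOME s. s \<in> \<Gamma> \<and> s p = u p) \<in> \<Gamma> \<and> (SOME s. s \<in> \<Gamma> \<and> s p = u p) p = u p"
    by (rule someI_ex)
  then show ?thesis unfolding value_at_def by (intro tensorial_cong[OF assms(1) _ assms(2)]) auto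
qed

lemma linear_on_value_at:
  assumes "tensorial op"
  shows "linear_on (fibre E p) (value_at \<Gamma> op p)"
proof (rule linear_onI)
  fix a b assume "a \<in> fibre E p" "b \<in> fibre E p"
  then obtain s t where st: "s \<in> \<Gamma>" "s p = a" "t \<in> \<Gamma>" "t p = b" using section_through by metis
  then show "value_at \<Gamma> op p (a + b) = value_at \<Gamma> op p a + value_at \<Gamma> op p b"
    using value_at_section[OF assms, of s p] value_at_section[OF assms, of t p]
      value_at_section[OF assms section_add[OF st(1,3)], of p] assms
    by (simp add: tensorial_def)
next
  fix a r assume "a \<in> fibre E p"
  then obtain s where s: "s \<in> \<Gamma>" "s p = a" using section_through by metis
  show "value_at \<Gamma> op p (r *\<^sub>R a) = r *\<^sub>R value_at \<Gamma> op p a"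
    using value_at_section[OF assms, of s p] s smooth_functions_const[of r]
      value_at_section[OF assms section_fscale[OF smooth_functions_const s(1)], of p r] assms
    by (simp add: tensorial_def fscale_def)
qed

lemma value_at_mem:
  assumes "tensorial op" "\<And>u. u \<in> \<Gamma> \<Longrightarrow> op u p \<in> F" "a \<in> fibre E p"
  shows "value_at \<Gamma> op p a \<in> F"
  using section_through[OF assms(3)] value_at_section[OF assms(1)] assms(2) by metis

section \<open>Criteria for smoothness of sections and traces\<close>

text \<open>A frame field is not a global section, but near \<open>p\<close> it is a global section
  divided by the nonzero bump function.\<close>

lemma smooth_at_frame_covector:
  assumes "(U, e) \<in> frames E" "p \<in> U" "i < rk E"
    and "\<And>r. linear_on (fibre E r) (l r)" "\<And>s. s \<in> \<Gamma> \<Longrightarrow> (\<lambda>r. l r (s r)) \<in> C"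
  shows "smooth_at (base E) p (\<lambda>r. l r (e i r))"
proof -
  obtain b where b: "b \<in> C" "b p = 1" "\<forall>r. r \<notin> U \<longrightarrow> b r = 0" "\<forall>i<rk E. cutoff b U (e i) \<in> \<Gamma>"
    using frame_cutoff[OF assms(1,2)] by blast
  have sb: "smooth_at (base E) p b" using b(1) by (simp add: smooth_functions_iff)
  obtain W where W: "open W" "p \<in> W" "\<forall>r\<in>W. b r \<noteq> 0"
    using smooth_at_nonzero_nbhd[OF sb] b(2) by auto
  have "smooth_at (base E) p (\<lambda>r. l r (cutoff b U (e i) r) / b r)"
    using assms(3,5) b by (intro smooth_at_divide sb) (auto simp: smooth_functions_iff)
  then show ?thesis
  proof (rule smooth_at_cong[OF _ W(1,2)])
    fix r assume r: "r \<in> W"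
    then have "r \<in> U" using W(3) b(3) by blast
    then show "l r (cutoff b U (e i) r) / b r = l r (e i r)"
      using W(3) r frame_mem[OF assms(1) _ assms(3)] by (simp add: cutoff_def linear_on_scale[OF assms(4)])
  qed
qed

text \<open>In a frame the coefficients of \<open>z\<close> solve a linear system with smooth matrix
  \<open>l r (e j r)\<close> and smooth right-hand sides \<open>l r (z r)\<close>. Separation of
  points makes the system injective at \<open>p\<close>, so \<open>smooth_at_solution\<close>
  applies.\<close>

lemma sections_by_covectors:
  assumes z: "\<And>p. z p \<in> fibre E p"
    and L: "\<And>l r. l \<in> L \<Longrightarrow> linear_on (fibre E r) (l r)"
      "\<And>l s. l \<in> L \<Longrightarrow> s \<in> \<Gamma> \<Longrightarrow> (\<lambda>r. l r (s r)) \<in> C"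
      "\<And>l. l \<in> L \<Longrightarrow> (\<lambda>r. l r (z r)) \<in> C"
    and sep: "\<And>p a. a \<in> fibre E p \<Longrightarrow> (\<And>l. l \<in> L \<Longrightarrow> l p a = 0) \<Longrightarrow> a = 0"
  shows "z \<in> \<Gamma>"
  unfolding sections_iff
proof (intro conjI allI impI z)
  fix U e p i assume a: "(U, e) \<in> frames E" "p \<in> U" "i < rk E"
  have expand: "l r (\<Sum>j<rk E. x j *\<^sub>R e j r) = (\<Sum>j<rk E. l r (e j r) * x j)"
    if "l \<in> L" "r \<in> U" for l r x
    by (subst linear_on_lincomb[OF L(1)[OF that(1)] subspace_fibre])
      (auto intro: frame_mem[OF a(1) that(2)] simp: mult.commute)
  have "\<forall>j<rk E. smooth_at (base E) p (\<lambda>r. frame_coef e r (z r) j)"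
  proof (rule smooth_at_solution[where L = "(\<lambda>l j r. l r (e j r)) ` L"])
    fix d j assume "d \<in> (\<lambda>l j r. l r (e j r)) ` L" "j < rk E"
    then show "smooth_at (base E) p (d j)"
      using smooth_at_frame_covector[OF a(1,2)] L(1,2) by blast
  next
    fix d assume "d \<in> (\<lambda>l j r. l r (e j r)) ` L"
    then obtain l where l: "l \<in> L" "d = (\<lambda>j r. l r (e j r))" by blast
    have "smooth_at (base E) p (\<lambda>r. l r (z r))" using L(3)[OF l(1)] by (simp add: smooth_functions_iff)
    then show "smooth_at (base E) p (\<lambda>r. \<Sum>j<rk E. d j r * frame_coef e r (z r) j)"
      by (rule smooth_at_cong[OF _ frame(1)[OF a(1)] a(2)])
        (simp add: l(2) expand[OF l(1), symmetric] coef_sum[OF a(1)] z)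
  next
    fix x :: "nat \<Rightarrow> real"
    assume x: "\<And>d. d \<in> (\<lambda>l j r. l r (e j r)) ` L \<Longrightarrow> (\<Sum>j<rk E. d j p * x j) = 0"
    have "(\<Sum>j<rk E. x j *\<^sub>R e j p) = 0"
    proof (rule sep)
      show "(\<Sum>j<rk E. x j *\<^sub>R e j p) \<in> fibre E p"
        using frame_mem[OF a(1,2)] by (intro subspace_sum subspace_scale subspace_fibre) auto
    next
      fix l assume l: "l \<in> L"
      then have "(\<Sum>j<rk E. l p (e j p) * x j) = 0" using x[of "\<lambda>j r. l r (e j r)"] by blast
      then show "l p (\<Sum>j<rk E. x j *\<^sub>R e j p) = 0" by (simp only: expand[OF l a(2)])
    qed
    then show "\<forall>j<rk E. x j = 0"
      using coef_eqI[OF a(1,2), of 0 x] coef_eqI[OF a(1,2), of 0 "\<lambda>_. 0"] by simp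
  qed
  then show "smooth_at (base E) p (\<lambda>r. frame_coef e r (z r) i)" using a(3) by blast
qed

text \<open>The basis in \<open>trace_on\<close> is chosen independently at each point.
  \<open>trace_on_family\<close> replaces it by the local frame, in which the trace is a sum of
  smooth coefficients.\<close>

lemma trace_smooth:
  assumes "tensorial op" "\<And>u. u \<in> \<Gamma> \<Longrightarrow> op u \<in> \<Gamma>"
  shows "(\<lambda>p. trace_on (fibre E p) (value_at \<Gamma> op p)) \<in> C"
  unfolding smooth_functions_iff
proof
  fix p
  obtain U e where U: "(U, e) \<in> frames E" "p \<in> U" by (rule frame_at)
  obtain b where b: "b \<in> C" "b p = 1" "\<forall>r. r \<notin> U \<longrightarrow> b r = 0" "\<forall>i<rk E. cutoff b U (e i) \<in> \<Gamma>"
    using frame_cutoff[OF U] by blast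
  have sb: "smooth_at (base E) p b" using b(1) by (simp add: smooth_functions_iff)
  obtain W where W: "open W" "p \<in> W" "\<forall>r\<in>W. b r \<noteq> 0"
    using smooth_at_nonzero_nbhd[OF sb] b(2) by auto
  have "smooth_at (base E) p (\<lambda>r. \<Sum>i<rk E. frame_coef e r (op (cutoff b U (e i)) r) i / b r)"
    using b(2,4) assms(2) by (intro smooth_at_sum smooth_at_divide sb section_coef_smooth[OF _ U]) auto
  then show "smooth_at (base E) p (\<lambda>p. trace_on (fibre E p) (value_at \<Gamma> op p))"
  proof (rule smooth_at_cong[OF _ W(1,2)])
    fix r assume r: "r \<in> W"
    then have rU: "r \<in> U" using W(3) b(3) by blast
    note lin = linear_on_value_at[OF assms(1), of r]
    have mem: "value_at \<Gamma> op r x \<in> fibre E r" if "x \<in> fibre E r" for x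
      using assms that by (intro value_at_mem) (auto simp: section_fibre)
    have "trace_on (fibre E r) (value_at \<Gamma> op r) = (\<Sum>i<rk E. frame_coef e r (value_at \<Gamma> op r (e i r)) i)"
      using coef_sum[OF U(1) rU] frame_mem[OF U(1) rU] linear_on_coef[OF U(1) rU]
      by (intro findim.trace_on_family[OF findim_fibre] lin mem) auto
    also have "\<dots> = (\<Sum>i<rk E. frame_coef e r (op (cutoff b U (e i)) r) i / b r)"
    proof (intro sum.cong refl)
      fix i assume i: "i \<in> {..<rk E}"
      have "op (cutoff b U (e i)) r = value_at \<Gamma> op r (b r *\<^sub>R e i r)"
        using value_at_section[OF assms(1), of "cutoff b U (e i)" r] b(4) i rU by (simp add: cutoff_def)
      also have "\<dots> = b r *\<^sub>R value_at \<Gamma> op r (e i r)"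
        using frame_mem[OF U(1) rU] i by (simp add: linear_on_scale[OF lin])
      finally show "frame_coef e r (value_at \<Gamma> op r (e i r)) i = frame_coef e r (op (cutoff b U (e i)) r) i / b r"
        using mem frame_mem[OF U(1) rU] i W(3) r by (simp add: linear_on_scale[OF linear_on_coef[OF U(1) rU]])
    qed
    finally show "(\<Sum>i<rk E. frame_coef e r (op (cutoff b U (e i)) r) i / b r)
      = trace_on (fibre E r) (value_at \<Gamma> op r)" by simp
  qed
qed

end

section \<open>Exact Courant algebroids\<close>

lemma findim_image:
  assumes "findim V" "linear_on V f" "f ` V = W" "subspace W"
  shows "findim W"
proof
  interpret V: findim V by fact
  obtain B where B: "B \<subseteq> W" "independent B" "W \<subseteq> span B" by (rule maximal_independent_subset)
  have "W \<subseteq> span (f ` some_basis V)"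
  proof
    fix w assume "w \<in> W"
    then obtain v where v: "v \<in> V" "w = f v" using assms(3) by blast
    have "f v = f (\<Sum>b\<in>some_basis V. representation (some_basis V) v b *\<^sub>R b)"
      by (simp add: V.basis_sum[OF V.some_basis(1) v(1)])
    also have "\<dots> = (\<Sum>b\<in>some_basis V. representation (some_basis V) v b *\<^sub>R f b)"
      by (rule linear_on_lincomb[OF assms(2) V.subspace V.some_basis_mem])
    finally show "w \<in> span (f ` some_basis V)"
      unfolding v(2) by (simp add: span_sum span_scale span_base)
  qed
  then have "finite B"
    using independent_span_bound[OF finite_imageI[OF V.some_basis(2)] B(2)] B(1) by auto
  then show "\<exists>B. finite B \<and> is_basis W B" using B by (auto simp: is_basis_def)
qed fact

locale exact_courant =
  fixes E :: "('m::{t2_space, second_countable_topology}, 'a::euclidean_space, 'e::real_vector) courant"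
  assumes exact: "exact_courant_algebroid E"
begin

lemma courant: "courant_algebroid E"
  using exact by (simp add: exact_courant_algebroid_def)

sublocale smooth_bundle E
  by unfold_locales (use courant in \<open>simp add: courant_algebroid_def\<close>)

abbreviation "F \<equiv> fibre E"
abbreviation "q \<equiv> pairing E"
abbreviation "\<pi> \<equiv> anchor E"
abbreviation "T \<equiv> tangent_space (base E)"
abbreviation "\<XX> \<equiv> vector_fields (base E)"
abbreviation "br \<equiv> dorfman E"

lemma fibre_metric_pairing: "fibre_metric E q"
  using courant by (simp add: courant_algebroid_def)

sublocale q: inner_findim "F p" "q p" for p
  using findim_fibre fibre_metric_pairing subspace_fibre unfolding fibre_metric_def
  by (intro inner_findim.intro findim_fibre inner_findim_axioms.intro) auto

lemma pair_smooth: "u \<in> \<Gamma> \<Longrightarrow> v \<in> \<Gamma> \<Longrightarrow> (\<lambda>p. q p (u p) (v p)) \<in> C"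
  using fibre_metric_pairing by (auto simp: fibre_metric_def)

lemma anchor_linear: "linear_on (F p) (\<pi> p)"
  using courant by (simp add: courant_algebroid_def)

lemma anchor_image: "\<pi> p ` F p = T p"
  using exact by (simp add: exact_courant_algebroid_def)

lemma anchor_mem: "a \<in> F p \<Longrightarrow> \<pi> p a \<in> T p"
  using anchor_image by blast

lemma anchor_section: "u \<in> \<Gamma> \<Longrightarrow> anchor_section E u \<in> \<XX>"
  using courant by (simp add: courant_algebroid_def)

lemmas anchor_add = linear_on_add[OF anchor_linear]
lemmas anchor_scale = linear_on_scale[OF anchor_linear]
lemmas anchor_diff = linear_on_diff[OF anchor_linear subspace_fibre]
lemmas anchor_zero = linear_on_zero[OF anchor_linear subspace_fibre]

text \<open>Exactness maps the finite-dimensional fibre onto the space of derivations at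
  \<open>p\<close>.\<close>

lemma findim_tangent: "findim (T p)"
  by (rule findim_image[OF findim_fibre anchor_linear anchor_image subspace_tangent_space])

sublocale T: findim "T p" for p by (rule findim_tangent)

lemma vector_fieldD: "X \<in> \<XX> \<Longrightarrow> X p \<in> T p" "X \<in> \<XX> \<Longrightarrow> f \<in> C \<Longrightarrow> (\<lambda>p. X p f) \<in> C"
  by (auto simp: vector_fields_def)

lemma vector_field_add: "X \<in> \<XX> \<Longrightarrow> Y \<in> \<XX> \<Longrightarrow> X + Y \<in> \<XX>"
  unfolding vector_fields_def by (auto intro: subspace_add subspace_tangent_space smooth_functions_add)

lemma vector_field_fscale: "f \<in> C \<Longrightarrow> X \<in> \<XX> \<Longrightarrow> fscale f X \<in> \<XX>"
  using subspace_scale[OF subspace_tangent_space] smooth_functions_mult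
  unfolding vector_fields_def fscale_def by (simp add: scaleR_fun_def)

lemma anchor_section_add: "u \<in> \<Gamma> \<Longrightarrow> v \<in> \<Gamma> \<Longrightarrow> anchor_section E (u + v) = anchor_section E u + anchor_section E v"
  by (auto simp: anchor_section_def fun_eq_iff anchor_add section_fibre)

lemma anchor_section_fscale: "u \<in> \<Gamma> \<Longrightarrow> anchor_section E (fscale f u) = fscale f (anchor_section E u)"
  by (auto simp: anchor_section_def fun_eq_iff anchor_scale section_fibre fscale_def)

lemma tangent_linear:
  assumes "x \<in> T p"
  shows "f \<in> C \<Longrightarrow> g \<in> C \<Longrightarrow> x (\<lambda>r. f r + g r) = x f + x g"
    and "f \<in> C \<Longrightarrow> g \<in> C \<Longrightarrow> x (\<lambda>r. f r - g r) = x f - x g"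
    and "f \<in> C \<Longrightarrow> x (\<lambda>r. c * f r) = c * x f"
    and "x (\<lambda>r. 0) = 0"
proof -
  have scale: "x (\<lambda>r. c * f r) = c * x f" if "f \<in> C" for c f
    using assms that unfolding tangent_space_def linear_on_def by (simp add: scaleR_fun_def)
  note add = tangent_space_smooth(1)[OF assms]
  show "f \<in> C \<Longrightarrow> g \<in> C \<Longrightarrow> x (\<lambda>r. f r + g r) = x f + x g" by (rule add)
  show "f \<in> C \<Longrightarrow> x (\<lambda>r. c * f r) = c * x f" by (rule scale)
  show "f \<in> C \<Longrightarrow> g \<in> C \<Longrightarrow> x (\<lambda>r. f r - g r) = x f - x g"
    using add[of f "\<lambda>r. - g r"] scale[of g "-1"] smooth_functions_minus[of g] by simp
  show "x (\<lambda>r. 0) = 0" using scale[OF smooth_functions_const, of 0 0] by simp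
qed

lemma act_eq: "act E u f p = \<pi> p (u p) f"
  by (simp add: act_def derivative_along_def anchor_section_def)

lemma br_section: "u \<in> \<Gamma> \<Longrightarrow> v \<in> \<Gamma> \<Longrightarrow> br u v \<in> \<Gamma>"
  using courant by (simp add: courant_algebroid_def)

lemma br_bilinear: "bilinear_on \<Gamma> br"
  using courant by (simp add: courant_algebroid_def)

lemma br_add: "u \<in> \<Gamma> \<Longrightarrow> v \<in> \<Gamma> \<Longrightarrow> w \<in> \<Gamma> \<Longrightarrow> br u (v + w) = br u v + br u w"
  "u \<in> \<Gamma> \<Longrightarrow> v \<in> \<Gamma> \<Longrightarrow> w \<in> \<Gamma> \<Longrightarrow> br (v + w) u = br v u + br w u"
  using bilinear_onD[OF br_bilinear] by (auto simp: linear_on_def)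

lemma br_fscale:
  assumes "u \<in> \<Gamma>" "v \<in> \<Gamma>" "f \<in> C"
  shows "br u (fscale f v) p = \<pi> p (u p) f *\<^sub>R v p + f p *\<^sub>R br u v p"
proof -
  have "br u (fscale f v) = fscale (act E u f) v + fscale f (br u v)"
    using courant assms unfolding courant_algebroid_def by blast
  then show ?thesis by (simp add: fscale_def act_eq)
qed

lemma anchor_br:
  assumes "u \<in> \<Gamma>" "v \<in> \<Gamma>"
  shows "anchor_section E (br u v) = lie_bracket (base E) (anchor_section E u) (anchor_section E v)"
  using courant assms unfolding courant_algebroid_def by blast

lemma br_metric:
  assumes "u \<in> \<Gamma>" "v \<in> \<Gamma>" "w \<in> \<Gamma>"
  shows "\<pi> p (u p) (\<lambda>r. q r (v r) (w r)) = q p (br u v p) (w p) + q p (v p) (br u w p)"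
proof -
  have "act E u (pair_sections E v w) = pair_sections E (br u v) w + pair_sections E v (br u w)"
    using courant assms unfolding courant_algebroid_def by blast
  from fun_cong[OF this, of p] show ?thesis by (simp add: act_eq pair_sections_def[abs_def])
qed

lemma br_sym:
  assumes "u \<in> \<Gamma>" "v \<in> \<Gamma>" "w \<in> \<Gamma>"
  shows "q p (br u v p) (w p) + q p (br v u p) (w p) = \<pi> p (w p) (\<lambda>r. q r (u r) (v r))"
proof -
  have "pair_sections E (br u v + br v u) w = act E w (pair_sections E u v)"
    using courant assms unfolding courant_algebroid_def by blast
  from fun_cong[OF this, of p] show ?thesis
    using assms by (simp add: act_eq pair_sections_def[abs_def] q.add_left br_section section_fibre)
qed

text \<open>The symmetric part of the Dorfman bracket is determined by the derivatives of the
  pairing of \<open>u\<close> and \<open>v\<close>, here a constant. This applies to sections of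
  opposite eigenbundles.\<close>

lemma br_skew:
  assumes "u \<in> \<Gamma>" "v \<in> \<Gamma>" "\<And>r. q r (u r) (v r) = 0"
  shows "br u v p = - br v u p"
proof -
  have "br u v p + br v u p = 0"
  proof (rule q.eqI)
    show "br u v p + br v u p \<in> F p" "0 \<in> F p"
      using assms subspace_fibre by (simp_all add: subspace_add subspace_0 section_fibre br_section)
    fix c assume c: "c \<in> F p"
    then obtain w where w: "w \<in> \<Gamma>" "w p = c" using section_through by blast
    have "q p (br u v p + br v u p) (w p) = \<pi> p (w p) (\<lambda>r. 0)"
      using br_sym[OF assms(1,2) w(1), of p] assms w c
      by (simp add: q.add_left br_section section_fibre)
    also have "\<dots> = 0" by (rule tangent_linear(4)[OF anchor_mem]) (simp add: w c)
    finally show "q p (br u v p + br v u p) c = q p 0 c" using w c by (simp add: q.zero_left)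
  qed
  then show ?thesis by (simp add: eq_neg_iff_add_eq_0)
qed

text \<open>In general the Leibniz rule in the first argument has a further term, the pairing of
  \<open>u\<close> and \<open>v\<close> times the differential of \<open>f\<close>. For orthogonal
  sections it is absent, and skewness reduces the rule to the second argument.\<close>

lemma br_fscale_left:
  assumes "u \<in> \<Gamma>" "v \<in> \<Gamma>" "f \<in> C" "\<And>r. q r (u r) (v r) = 0"
  shows "br (fscale f u) v p = f p *\<^sub>R br u v p - \<pi> p (v p) f *\<^sub>R u p"
proof -
  have z: "q r (v r) (u r) = 0" "q r (fscale f u r) (v r) = 0" for r
    using assms by (auto simp: q.sym[of "v r"] section_fibre fscale_def q.scale_left)
  show ?thesis
    using br_skew[OF section_fscale[OF assms(3,1)] assms(2) z(2), of p]
      br_fscale[OF assms(2,1,3), of p] br_skew[OF assms(2,1) z(1), of p] by simp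
qed

lemma section_by_pairing:
  assumes "\<And>p. z p \<in> F p" "\<And>w. w \<in> \<Gamma> \<Longrightarrow> (\<lambda>p. q p (z p) (w p)) \<in> C"
  shows "z \<in> \<Gamma>"
proof (rule sections_by_covectors[where L = "(\<lambda>w p a. q p a (w p)) ` \<Gamma>"])
  fix p a assume a: "a \<in> F p" "\<And>l. l \<in> (\<lambda>w p a. q p a (w p)) ` \<Gamma> \<Longrightarrow> l p a = 0"
  show "a = 0"
  proof (rule q.eqI)
    fix c assume c: "c \<in> F p"
    then obtain w where w: "w \<in> \<Gamma>" "w p = c" using section_through by blast
    have "q p a (w p) = 0" using a(2) w(1) by auto
    then show "q p a c = q p 0 c" using w c by (simp add: q.zero_left)
  qed (use a subspace_fibre subspace_0 in auto)
qed (use assms pair_smooth in \<open>auto intro: q.q_left section_fibre\<close>)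

lemma pairing_eqI:
  assumes "a \<in> F p" "b \<in> F p" "\<And>w. w \<in> \<Gamma> \<Longrightarrow> q p a (w p) = q p b (w p)"
  shows "a = b"
  using q.eqI[OF assms(1,2)] assms(3) section_through by metis

section \<open>The kernel of the anchor is Lagrangian\<close>

lemma coanchor:
  assumes "\<xi> \<in> cotangent_space (base E) p"
  shows "coanchor E p \<xi> \<in> F p" "b \<in> F p \<Longrightarrow> q p (coanchor E p \<xi>) b = (1/2) * \<xi> (\<pi> p b)"
proof -
  have "linear_on (F p) (\<lambda>b. (1/2) * \<xi> (\<pi> p b))"
    using assms anchor_mem
    by (intro linear_onI) (auto simp: cotangent_space_def anchor_add anchor_scale linear_on_add
        linear_on_scale algebra_simps add_divide_distrib)
  then have "coanchor E p \<xi> \<in> F p \<and> (\<forall>b\<in>F p. q p (coanchor E p \<xi>) b = (1/2) * \<xi> (\<pi> p b))"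
    unfolding coanchor_def by (rule theI'[OF q.riesz_unique])
  then show "coanchor E p \<xi> \<in> F p" "b \<in> F p \<Longrightarrow> q p (coanchor E p \<xi>) b = (1/2) * \<xi> (\<pi> p b)" by auto
qed

lemma kernel_anchor: "coanchor E p ` cotangent_space (base E) p = {a \<in> F p. \<pi> p a = 0}"
  using exact by (simp add: exact_courant_algebroid_def)

text \<open>An element of the kernel is a covector by exactness, and it pairs with \<open>b\<close>
  through the anchor of \<open>b\<close>.\<close>

lemma kernel_isotropic:
  assumes "a \<in> F p" "\<pi> p a = 0" "b \<in> F p" "\<pi> p b = 0"
  shows "q p a b = 0"
proof -
  obtain \<xi> where \<xi>: "\<xi> \<in> cotangent_space (base E) p" "a = coanchor E p \<xi>"
    using kernel_anchor[of p] assms by blast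
  then have "\<xi> 0 = 0" by (auto simp: cotangent_space_def linear_on_zero subspace_tangent_space)
  then show ?thesis using coanchor(2)[OF \<xi>(1) assms(3)] \<xi> assms(4) by simp
qed

text \<open>The kernel contains every covector. Pairing \<open>y\<close> with a coordinate covector
  gives half the corresponding coordinate of the anchor of \<open>y\<close>, so all of these
  coordinates vanish.\<close>

lemma kernel_perp:
  assumes y: "y \<in> F p" and perp: "\<And>k. k \<in> F p \<Longrightarrow> \<pi> p k = 0 \<Longrightarrow> q p y k = 0"
  shows "\<pi> p y = 0"
proof -
  let ?B = "some_basis (T p)"
  have "representation ?B (\<pi> p y) b = 0" if "b \<in> ?B" for b
  proof -
    let ?\<xi> = "restrict (\<lambda>x. representation ?B x b) (T p)"
    have lin: "linear_on (T p) (\<lambda>x. representation ?B x b)"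
      by (rule T.linear_on_representation[OF T.some_basis(1)])
    have \<xi>: "?\<xi> \<in> cotangent_space (base E) p"
      using lin subspace_tangent_space[of p]
      by (auto simp: cotangent_space_def linear_on_def subspace_add subspace_scale)
    have k: "coanchor E p ?\<xi> \<in> {a \<in> F p. \<pi> p a = 0}" using kernel_anchor[of p] \<xi> by blast
    then have "q p y (coanchor E p ?\<xi>) = 0" using perp by blast
    then have "q p (coanchor E p ?\<xi>) y = 0" using q.sym[OF y] k by simp
    then show ?thesis using coanchor(2)[OF \<xi> y] anchor_mem[OF y] by simp
  qed
  then show ?thesis using T.basis_sum[OF T.some_basis(1) anchor_mem[OF y]] by simp
qed

end

section \<open>Generalised metrics\<close>

locale gen_metric = exact_courant E
  for E :: "('m::{t2_space, second_countable_topology}, 'a::euclidean_space, 'e::real_vector) courant" +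
  fixes G :: "'m \<Rightarrow> 'e \<Rightarrow> 'e \<Rightarrow> real"
  assumes gen_metric: "generalised_metric E G"
begin

abbreviation "J \<equiv> metric_end E G"
abbreviation "sgns \<equiv> {1, - 1 :: real}"
abbreviation "eig \<equiv> eigenbundle E G"
abbreviation "lft \<equiv> lift E G"
abbreviation "g \<equiv> base_metric E G"

lemma fibre_metric_G: "fibre_metric E G"
  using gen_metric by (simp add: generalised_metric_def)

lemma G_bilinear: "bilinear_on (F p) (G p)" and G_sym: "a \<in> F p \<Longrightarrow> b \<in> F p \<Longrightarrow> G p a b = G p b a"
  and G_smooth: "u \<in> \<Gamma> \<Longrightarrow> v \<in> \<Gamma> \<Longrightarrow> (\<lambda>p. G p (u p) (v p)) \<in> C"
  using fibre_metric_G by (auto simp: fibre_metric_def)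

lemma J: assumes "a \<in> F p"
  shows J_mem: "J p a \<in> F p" and J_pair: "c \<in> F p \<Longrightarrow> q p (J p a) c = G p a c"
proof -
  have "J p a \<in> F p \<and> (\<forall>c\<in>F p. q p (J p a) c = G p a c)"
    unfolding metric_end_def using bilinear_onD(1)[OF G_bilinear assms]
    by (rule theI'[OF q.riesz_unique])
  then show "J p a \<in> F p" "c \<in> F p \<Longrightarrow> q p (J p a) c = G p a c" by auto
qed

lemma J_J: "a \<in> F p \<Longrightarrow> J p (J p a) = a"
  using gen_metric by (simp add: generalised_metric_def)

lemma J_linear: "linear_on (F p) (J p)"
proof (rule linear_onI)
  fix a b assume "a \<in> F p" "b \<in> F p"
  then show "J p (a + b) = J p a + J p b"
    using subspace_fibre linear_on_add[OF bilinear_onD(2)[OF G_bilinear]]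
    by (intro q.eqI[of _ p]) (auto simp: J_mem subspace_add J_pair q.add_left)
next
  fix a r assume "a \<in> F p"
  then show "J p (r *\<^sub>R a) = r *\<^sub>R J p a"
    using subspace_fibre linear_on_scale[OF bilinear_onD(2)[OF G_bilinear]]
    by (intro q.eqI[of _ p]) (auto simp: J_mem subspace_scale J_pair q.scale_left)
qed

lemmas J_add = linear_on_add[OF J_linear]
lemmas J_scale = linear_on_scale[OF J_linear]

lemma J_sym: "a \<in> F p \<Longrightarrow> b \<in> F p \<Longrightarrow> q p (J p a) b = q p a (J p b)"
  using q.sym[of a p "J p b"] by (simp add: J_mem J_pair G_sym)

section \<open>Projections to the eigenbundles\<close>

definition pr :: "real \<Rightarrow> 'm \<Rightarrow> 'e \<Rightarrow> 'e" where
  "pr s p a = (1/2) *\<^sub>R (a + s *\<^sub>R J p a)"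

lemma proj_eq: "proj E G s u p = pr s p (u p)"
  by (simp add: proj_def pr_def)

lemma pr_mem: "a \<in> F p \<Longrightarrow> pr s p a \<in> F p"
  using subspace_fibre by (simp add: pr_def J_mem subspace_add subspace_scale)

lemma pr_linear: "linear_on (F p) (pr s p)"
  by (intro linear_onI) (auto simp: pr_def J_add J_scale algebra_simps)

lemmas pr_add = linear_on_add[OF pr_linear]
lemmas pr_scale = linear_on_scale[OF pr_linear]
lemmas pr_minus = linear_on_minus[OF pr_linear]
lemmas pr_diff = linear_on_diff[OF pr_linear subspace_fibre]
lemmas pr_zero = linear_on_zero[OF pr_linear subspace_fibre]

lemma eig_iff: "a \<in> eig s p \<longleftrightarrow> a \<in> F p \<and> J p a = s *\<^sub>R a"
  by (auto simp: eigenbundle_def)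

lemma eig_fibre: "a \<in> eig s p \<Longrightarrow> a \<in> F p"
  by (simp add: eig_iff)

lemma pr_eig: "s \<in> sgns \<Longrightarrow> a \<in> F p \<Longrightarrow> pr s p a \<in> eig s p"
  using subspace_fibre
  by (auto simp: eig_iff pr_mem) (auto simp: pr_def J_add J_scale J_J J_mem subspace_add subspace_scale algebra_simps
      subspace_neg linear_on_minus[OF J_linear] linear_on_diff[OF J_linear subspace_fibre])

lemma pr_sum: "pr s p a + pr (- s) p a = a"
proof -
  have "pr s p a + pr (- s) p a = (1/2) *\<^sub>R ((a + s *\<^sub>R J p a) + (a + (- s) *\<^sub>R J p a))"
    by (simp only: pr_def scaleR_add_right)
  also have "\<dots> = (1/2) *\<^sub>R (a + a)" by simp
  finally show ?thesis by simp
qed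

lemma pr_eq: "s \<in> sgns \<Longrightarrow> a \<in> eig s p \<Longrightarrow> pr s p a = a"
  and pr_other: "s \<in> sgns \<Longrightarrow> a \<in> eig s p \<Longrightarrow> pr (- s) p a = 0"
proof -
  assume s: "s \<in> sgns" and a: "a \<in> eig s p"
  then show "pr (- s) p a = 0" by (auto simp: pr_def eig_iff)
  then show "pr s p a = a" using pr_sum[of s p a] by simp
qed

lemma pr_pr:
  assumes "s \<in> sgns" "a \<in> F p"
  shows "pr s p (pr s p a) = pr s p a" "pr (- s) p (pr s p a) = 0" "pr s p (pr (- s) p a) = 0"
proof -
  show "pr s p (pr s p a) = pr s p a" "pr (- s) p (pr s p a) = 0"
    using assms by (simp_all add: pr_eq pr_other pr_eig)
  show "pr s p (pr (- s) p a) = 0"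
    using pr_other[OF _ pr_eig, of "- s" a p] assms by auto
qed

lemma pr_self_adjoint: "a \<in> F p \<Longrightarrow> b \<in> F p \<Longrightarrow> q p (pr s p a) b = q p a (pr s p b)"
  using subspace_fibre
  by (simp add: pr_def q.scale_left q.scale_right q.add_left q.add_right J_mem J_sym subspace_add subspace_scale)

lemma eig_orthogonal:
  assumes "s \<in> sgns" "a \<in> eig s p" "b \<in> eig (- s) p"
  shows "q p a b = 0"
proof -
  have "q p a b = q p (pr s p a) b" using assms by (simp add: pr_eq)
  also have "\<dots> = q p a (pr s p b)" using assms by (simp add: pr_self_adjoint eig_fibre)
  also have "pr s p b = 0" using pr_other[of "- s" b p] assms by auto
  finally show ?thesis using assms by (simp add: q.zero_right eig_fibre)
qed

lemma pr_pair: "s \<in> sgns \<Longrightarrow> a \<in> F p \<Longrightarrow> b \<in> F p \<Longrightarrow> q p (pr s p a) (pr s p b) = q p (pr s p a) b"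
  by (simp add: pr_self_adjoint[symmetric] pr_mem pr_pr)

lemma eig_by_perp:
  assumes "s \<in> sgns" "y \<in> F p" "\<And>b. b \<in> eig s p \<Longrightarrow> q p y b = 0"
  shows "y \<in> eig (- s) p"
proof -
  have "pr s p y = 0"
  proof (rule q.eqI)
    fix c assume c: "c \<in> F p"
    have "q p (pr s p y) c = q p y (pr s p c)" by (rule pr_self_adjoint[OF assms(2) c])
    also have "\<dots> = 0" using assms c by (simp add: pr_eig)
    finally show "q p (pr s p y) c = q p 0 c" using c by (simp add: q.zero_left)
  qed (use assms subspace_fibre in \<open>auto simp: pr_mem subspace_0\<close>)
  then have "y = pr (- s) p y" using pr_sum[of s p y] by simp
  then show ?thesis using pr_eig[of "- s" y p] assms by auto
qed

lemma subspace_eig: "subspace (eig s p)"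
  unfolding subspace_def
  using subspace_fibre[of p]
  by (auto simp: eig_iff J_add J_scale subspace_add subspace_scale subspace_0
      linear_on_zero[OF J_linear subspace_fibre] algebra_simps)

lemma G_eq:
  assumes "a \<in> F p" "b \<in> F p"
  shows "G p a b = (\<Sum>s\<in>sgns. s * q p (pr s p a) (pr s p b))"
proof -
  have "J p a = pr 1 p a - pr (- 1) p a"
    using J_mem[OF assms(1)] by (simp add: pr_def algebra_simps flip: scaleR_left_distrib)
  then have "G p a b = q p (pr 1 p a) b - q p (pr (- 1) p a) b"
    using J_pair[OF assms] assms by (simp add: q.diff_left pr_mem)
  then show ?thesis using assms by (simp add: pr_pair)
qed

section \<open>The anchor restricted to an eigenbundle is an isomorphism\<close>

text \<open>On an eigenvector \<open>G\<close> is plus or minus the pairing, and the kernel is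
  isotropic, so such a vector in the kernel is \<open>G\<close>-orthogonal to the whole kernel. Here
  the nondegeneracy of \<open>G\<close> on the cotangent bundle enters.\<close>

lemma eig_kernel:
  assumes "s \<in> sgns" "a \<in> eig s p" "\<pi> p a = 0"
  shows "a = 0"
proof -
  have "nondegenerate_on {a \<in> F p. \<pi> p a = 0} (G p)"
    using gen_metric unfolding generalised_metric_def kernel_anchor by blast
  moreover have "G p a b = 0" if "b \<in> F p" "\<pi> p b = 0" for b
  proof -
    have "G p a b = q p (s *\<^sub>R a) b" using assms J_pair[of a p b] that by (auto simp: eig_iff)
    also have "\<dots> = 0" using kernel_isotropic[of a p b] assms that by (simp add: q.scale_left eig_fibre)
    finally show ?thesis .
  qed
  ultimately show ?thesis using assms unfolding nondegenerate_on_def by (auto simp: eig_fibre)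
qed

text \<open>The kernel and the eigenbundle together span the fibre: a vector orthogonal to both lies
  in the opposite eigenbundle and, since the kernel is its own complement, in the kernel; hence it
  is zero. The anchor ignores the kernel summand.\<close>

lemma anchor_eig_surj:
  assumes s: "s \<in> sgns" and x: "x \<in> T p"
  shows "\<exists>a\<in>eig s p. \<pi> p a = x"
proof -
  let ?K = "{k \<in> F p. \<pi> p k = 0}"
  let ?W = "{k + a |k a. k \<in> ?K \<and> a \<in> eig s p}"
  have K: "subspace ?K"
    using subspace_fibre[of p] by (auto simp: subspace_def anchor_add anchor_scale anchor_zero)
  have 0: "0 \<in> ?K" "0 \<in> eig s p" by (rule subspace_0[OF K], rule subspace_0[OF subspace_eig])
  have "?W = F p"
  proof (rule q.subspace_eq_whole)
    show "subspace ?W" by (rule subspace_sums[OF K subspace_eig])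
    show "?W \<subseteq> F p" using subspace_fibre by (auto simp: subspace_add eig_fibre)
    fix y assume y: "y \<in> F p" "\<And>w. w \<in> ?W \<Longrightarrow> q p y w = 0"
    have "q p y b = 0" if "b \<in> eig s p" for b
    proof -
      have "0 + b \<in> ?W" using that 0(1) by blast
      from y(2)[OF this] show ?thesis by simp
    qed
    then have e: "y \<in> eig (- s) p" by (rule eig_by_perp[OF s y(1)])
    have "q p y k = 0" if "k \<in> ?K" for k
    proof -
      have "k + 0 \<in> ?W" using that 0(2) by blast
      from y(2)[OF this] show ?thesis by simp
    qed
    then have "\<pi> p y = 0" using y(1) by (intro kernel_perp) auto
    then show "y = 0" using eig_kernel[OF _ e] s by auto
  qed
  moreover have "x \<in> \<pi> p ` F p" using x by (simp only: anchor_image)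
  then obtain b where "b \<in> F p" "\<pi> p b = x" by auto
  ultimately have "b \<in> ?W" by simp
  then obtain k a where "k \<in> ?K" "a \<in> eig s p" "b = k + a" by blast
  then show ?thesis using \<open>\<pi> p b = x\<close> by (intro bexI[of _ a]) (auto simp: anchor_add eig_fibre)
qed

lemma eig_anchor_inj:
  assumes "s \<in> sgns" "a \<in> eig s p" "b \<in> eig s p" "\<pi> p a = \<pi> p b"
  shows "a = b"
  using eig_kernel[OF assms(1), of "a - b" p] subspace_diff[OF subspace_eig assms(2,3)] assms
  by (simp add: anchor_diff eig_fibre)

lemma lift:
  assumes "s \<in> sgns" "x \<in> T p"
  shows lift_eig: "lft s p x \<in> eig s p" and anchor_lift: "\<pi> p (lft s p x) = x"
proof -
  have "\<exists>!a. a \<in> eig s p \<and> \<pi> p a = x"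
    using anchor_eig_surj[OF assms] eig_anchor_inj[OF assms(1)] by blast
  from theI'[OF this] show "lft s p x \<in> eig s p" "\<pi> p (lft s p x) = x" by (auto simp: lift_def)
qed

lemma lift_mem: "s \<in> sgns \<Longrightarrow> x \<in> T p \<Longrightarrow> lft s p x \<in> F p"
  by (rule eig_fibre[OF lift_eig])

lemma lift_anchor: "s \<in> sgns \<Longrightarrow> a \<in> eig s p \<Longrightarrow> lft s p (\<pi> p a) = a"
  by (rule eig_anchor_inj[of s]) (auto simp: lift_eig anchor_lift anchor_mem eig_fibre)

lemma pr_lift: "s \<in> sgns \<Longrightarrow> x \<in> T p \<Longrightarrow> pr s p (lft s p x) = lft s p x"
  "s \<in> sgns \<Longrightarrow> x \<in> T p \<Longrightarrow> pr (- s) p (lft s p x) = 0"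
  by (simp_all add: pr_eq pr_other lift_eig)

lemma lift_linear:
  assumes s: "s \<in> sgns" shows "linear_on (T p) (lft s p)"
proof (rule linear_onI)
  note sub = subspace_tangent_space[of p] subspace_eig[of s p]
  fix a b assume ab: "a \<in> T p" "b \<in> T p"
  show "lft s p (a + b) = lft s p a + lft s p b"
    by (rule eig_anchor_inj[OF s, of _ p]) (use ab sub s in \<open>simp_all add: lift_eig anchor_lift subspace_add anchor_add lift_mem\<close>)
next
  note sub = subspace_tangent_space[of p] subspace_eig[of s p]
  fix a r assume a: "a \<in> T p"
  show "lft s p (r *\<^sub>R a) = r *\<^sub>R lft s p a"
    by (rule eig_anchor_inj[OF s, of _ p]) (use a sub s in \<open>simp_all add: lift_eig anchor_lift subspace_scale anchor_scale lift_mem\<close>)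
qed

lemmas lift_add = linear_on_add[OF lift_linear]
lemmas lift_scale = linear_on_scale[OF lift_linear]

text \<open>
  The lifts to \<open>E\<^sub>+\<close> and \<open>E\<^sub>-\<close> of a tangent vector differ by an element of the isotropic kernel
  of the anchor.
\<close>

lemma base_metric_lift:
  assumes s: "s \<in> sgns" and xy: "x \<in> T p" "y \<in> T p"
  shows "q p (lft s p x) (lft s p y) = s * g p x y"
proof -
  have plus: "q p (lft 1 p x) (lft 1 p y) = g p x y"
    using J_pair[OF lift_mem[of 1 x p] lift_mem[of 1 y p]] lift_eig[of 1 x p] xy
    by (simp add: base_metric_def eig_iff)
  have minus: "q p (lft (-1) p x) (lft (-1) p y) = - g p x y"
  proof -
    let ?k = "\<lambda>x. lft 1 p x - lft (-1) p x"
    have "q p (?k x) (?k y) = 0"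
      using xy subspace_fibre
      by (intro kernel_isotropic) (auto simp: anchor_diff anchor_lift lift_mem subspace_diff)
    moreover have "q p (lft 1 p x) (lft (-1) p y) = 0" "q p (lft (-1) p x) (lft 1 p y) = 0"
      using eig_orthogonal[of 1] eig_orthogonal[of "-1"] xy by (auto simp: lift_eig)
    ultimately show ?thesis
      using plus xy subspace_fibre by (simp add: q.diff_left q.diff_right lift_mem subspace_diff)
  qed
  show ?thesis using s plus minus by auto
qed

lemma eig_pair: "s \<in> sgns \<Longrightarrow> a \<in> eig s p \<Longrightarrow> b \<in> eig s p \<Longrightarrow> q p a b = s * g p (\<pi> p a) (\<pi> p b)"
  using base_metric_lift[of s "\<pi> p a" p "\<pi> p b"] by (simp add: lift_anchor anchor_mem eig_fibre)

lemma proj_section: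
  assumes "u \<in> \<Gamma>" shows "proj E G s u \<in> \<Gamma>"
proof -
  have "(\<lambda>p. J p (u p)) \<in> \<Gamma>"
    using assms by (intro section_by_pairing) (auto simp: J_mem J_pair section_fibre G_smooth)
  then have "(1/2) *\<^sub>R (u + s *\<^sub>R (\<lambda>p. J p (u p))) \<in> \<Gamma>"
    by (intro section_scaleR section_add assms)
  moreover have "proj E G s u = (1/2) *\<^sub>R (u + s *\<^sub>R (\<lambda>p. J p (u p)))"
    by (auto simp: proj_def scaleR_fun_def)
  ultimately show ?thesis by simp
qed

text \<open>Two kinds of covectors are used: differentials of functions composed with the anchor,
  whose values on the lift are derivatives along \<open>X\<close>, and pairings with the opposite
  projection, which vanish on the lift. They separate points because an eigenbundle meets the kernel
  of the anchor trivially.\<close>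

lemma lift_section:
  assumes s: "s \<in> sgns" and X: "X \<in> \<XX>"
  shows "(\<lambda>p. lft s p (X p)) \<in> \<Gamma>"
proof (rule sections_by_covectors[where L =
      "(\<lambda>f p a. \<pi> p a f) ` C \<union> (\<lambda>w p a. q p (pr (- s) p a) (w p)) ` \<Gamma>"])
  show "lft s p (X p) \<in> F p" for p using s X by (simp add: lift_mem vector_fieldD)
next
  fix l r assume "l \<in> (\<lambda>f p a. \<pi> p a f) ` C \<union> (\<lambda>w p a. q p (pr (- s) p a) (w p)) ` \<Gamma>"
  then consider f where "f \<in> C" "l = (\<lambda>p a. \<pi> p a f)"
    | w where "w \<in> \<Gamma>" "l = (\<lambda>p a. q p (pr (- s) p a) (w p))" by blast
  then show "linear_on (F r) (l r)"
    by cases (auto intro!: linear_onI simp: anchor_add anchor_scale scaleR_fun_def pr_add pr_scale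
        q.add_left q.scale_left section_fibre pr_mem)
next
  fix l u assume "l \<in> (\<lambda>f p a. \<pi> p a f) ` C \<union> (\<lambda>w p a. q p (pr (- s) p a) (w p)) ` \<Gamma>" and u: "u \<in> \<Gamma>"
  then consider f where "f \<in> C" "l = (\<lambda>p a. \<pi> p a f)"
    | w where "w \<in> \<Gamma>" "l = (\<lambda>p a. q p (pr (- s) p a) (w p))" by blast
  then show "(\<lambda>r. l r (u r)) \<in> C"
  proof cases
    case 1
    then show ?thesis using vector_fieldD(2)[OF anchor_section[OF u]] by (simp add: anchor_section_def)
  next
    case 2
    then show ?thesis using pair_smooth[OF proj_section[OF u, of "- s"]] by (simp add: proj_eq)
  qed
next
  fix l assume "l \<in> (\<lambda>f p a. \<pi> p a f) ` C \<union> (\<lambda>w p a. q p (pr (- s) p a) (w p)) ` \<Gamma>"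
  then consider f where "f \<in> C" "l = (\<lambda>p a. \<pi> p a f)"
    | w where "w \<in> \<Gamma>" "l = (\<lambda>p a. q p (pr (- s) p a) (w p))" by blast
  then show "(\<lambda>r. l r (lft s r (X r))) \<in> C"
  proof cases
    case 1
    then show ?thesis using vector_fieldD[OF X] s by (simp add: anchor_lift)
  next
    case 2
    then show ?thesis using vector_fieldD[OF X] s
      by (simp add: pr_lift q.zero_left section_fibre smooth_functions_const)
  qed
next
  fix p a
  assume a: "a \<in> F p"
    and l: "\<And>l. l \<in> (\<lambda>f p a. \<pi> p a f) ` C \<union> (\<lambda>w p a. q p (pr (- s) p a) (w p)) ` \<Gamma> \<Longrightarrow> l p a = 0"
  have "\<pi> p a f = 0" for f
    using l[of "\<lambda>p a. \<pi> p a f"] tangent_space_smooth(3)[OF anchor_mem[OF a]] by (cases "f \<in> C") auto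
  then have "\<pi> p a = 0" by auto
  moreover have "pr (- s) p a = 0"
  proof (rule pairing_eqI)
    fix w assume "w \<in> \<Gamma>"
    then show "q p (pr (- s) p a) (w p) = q p 0 (w p)"
      using l[of "\<lambda>p a. q p (pr (- s) p a) (w p)"] by (auto simp: q.zero_left section_fibre)
  qed (use a subspace_fibre in \<open>auto simp: pr_mem subspace_0\<close>)
  then have "a \<in> eig s p" using pr_sum[of s p a] pr_eig[OF s a] by simp
  ultimately show "a = 0" using eig_kernel[OF s] by blast
qed

lemma base_metric_smooth:
  assumes "X \<in> \<XX>" "Y \<in> \<XX>"
  shows "(\<lambda>p. g p (X p) (Y p)) \<in> C"
  using pair_smooth[OF lift_section[OF _ assms(1), of 1] lift_section[OF _ assms(2), of 1]] assms
  by (simp add: base_metric_lift vector_fieldD)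

end

section \<open>The Levi-Civita connection of the base metric\<close>

lemma fscale_apply: "fscale f s p = f p *\<^sub>R s p"
  by (simp add: fscale_def)

context exact_courant
begin

lemma tangent_const: assumes "x \<in> T p" shows "x (\<lambda>r. c) = 0"
proof -
  have 1: "(\<lambda>r. 1 :: real) \<in> C" by (rule smooth_functions_const)
  have "x (\<lambda>r. 1) = 0" using tangent_space_smooth(2)[OF assms 1 1] by simp
  then show ?thesis using tangent_linear(3)[OF assms 1, of c] by simp
qed

lemma fscale_const: "fscale (\<lambda>r. c) u = c *\<^sub>R u"
  by (auto simp: fscale_def scaleR_fun_def)

end

context gen_metric
begin

abbreviation "lf s X \<equiv> (\<lambda>p. lft s p (X p))"

lemma anchor_section_lift: "s \<in> sgns \<Longrightarrow> X \<in> \<XX> \<Longrightarrow> anchor_section E (lf s X) = X"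
  by (auto simp: anchor_section_def anchor_lift vector_fieldD fun_eq_iff)

lemma lift_section_add: "s \<in> sgns \<Longrightarrow> X \<in> \<XX> \<Longrightarrow> Y \<in> \<XX> \<Longrightarrow> lf s (X + Y) = lf s X + lf s Y"
  by (auto simp: fun_eq_iff lift_add vector_fieldD)

lemma lift_section_fscale: "s \<in> sgns \<Longrightarrow> X \<in> \<XX> \<Longrightarrow> lf s (fscale f X) = fscale f (lf s X)"
  by (auto simp: fun_eq_iff fscale_def lift_scale vector_fieldD)

lemma proj_add: "u \<in> \<Gamma> \<Longrightarrow> v \<in> \<Gamma> \<Longrightarrow> proj E G s (u + v) = proj E G s u + proj E G s v"
  by (auto simp: proj_eq fun_eq_iff pr_add section_fibre)

lemma proj_fscale: "u \<in> \<Gamma> \<Longrightarrow> proj E G s (fscale f u) = fscale f (proj E G s u)"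
  by (auto simp: proj_eq fun_eq_iff fscale_def pr_scale section_fibre)

lemma proj_eig: "s \<in> sgns \<Longrightarrow> u \<in> \<Gamma> \<Longrightarrow> proj E G s u p \<in> eig s p"
  by (simp add: proj_eq pr_eig section_fibre)

lemma g_linear:
  shows "x \<in> T p \<Longrightarrow> y \<in> T p \<Longrightarrow> z \<in> T p \<Longrightarrow> g p (x + y) z = g p x z + g p y z"
    and "x \<in> T p \<Longrightarrow> y \<in> T p \<Longrightarrow> z \<in> T p \<Longrightarrow> g p z (x + y) = g p z x + g p z y"
    and "x \<in> T p \<Longrightarrow> z \<in> T p \<Longrightarrow> g p (c *\<^sub>R x) z = c * g p x z"
    and "x \<in> T p \<Longrightarrow> z \<in> T p \<Longrightarrow> g p z (c *\<^sub>R x) = c * g p z x"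
proof -
  have g: "g p x y = q p (lft 1 p x) (lft 1 p y)" if "x \<in> T p" "y \<in> T p" for x y
    using base_metric_lift[of 1 x p y] that by simp
  note sub = subspace_tangent_space[of p]
  show "x \<in> T p \<Longrightarrow> y \<in> T p \<Longrightarrow> z \<in> T p \<Longrightarrow> g p (x + y) z = g p x z + g p y z"
    "x \<in> T p \<Longrightarrow> y \<in> T p \<Longrightarrow> z \<in> T p \<Longrightarrow> g p z (x + y) = g p z x + g p z y"
    "x \<in> T p \<Longrightarrow> z \<in> T p \<Longrightarrow> g p (c *\<^sub>R x) z = c * g p x z"
    "x \<in> T p \<Longrightarrow> z \<in> T p \<Longrightarrow> g p z (c *\<^sub>R x) = c * g p z x"
    using sub by (simp_all add: g subspace_add subspace_scale lift_add lift_scale lift_mem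
        q.add_left q.add_right q.scale_left q.scale_right)
qed

text \<open>
  Each of the two connections \<open>X, Y \<mapsto> \<pi> ([X\<^sub>\<mp>, Y\<^sub>\<plusminus>]\<^sub>\<plusminus>)\<close> is metric, and their torsions \<open>\<plusminus>H\<close>
  cancel in the mean.
\<close>

definition half_connection :: "real \<Rightarrow> ('m \<Rightarrow> 'm tangent) \<Rightarrow> ('m \<Rightarrow> 'm tangent) \<Rightarrow> 'm \<Rightarrow> 'm tangent" where
  "half_connection s X Y p = \<pi> p (pr s p (br (lf (- s) X) (lf s Y) p))"

text \<open>Linearity in \<open>X\<close> over functions holds because the derivative term in the
  bracket is a multiple of the lift of \<open>X\<close> to the opposite eigenbundle, which
  \<open>pr s\<close> kills; in \<open>Y\<close> the corresponding term survives and gives the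
  Leibniz rule. Metricity is invariance of the pairing under the bracket, as the pairing of lifts is
  s times \<open>g\<close>.\<close>

lemma half_connection:
  assumes s: "s \<in> sgns" and X: "X \<in> \<XX>" and Y: "Y \<in> \<XX>"
  shows half_connection_field: "half_connection s X Y \<in> \<XX>"
    and "f \<in> C \<Longrightarrow> half_connection s (fscale f X) Y p = f p *\<^sub>R half_connection s X Y p"
    and "f \<in> C \<Longrightarrow> half_connection s X (fscale f Y) p = X p f *\<^sub>R Y p + f p *\<^sub>R half_connection s X Y p"
    and "Z \<in> \<XX> \<Longrightarrow> half_connection s (X + Z) Y p = half_connection s X Y p + half_connection s Z Y p"
    and "Z \<in> \<XX> \<Longrightarrow> half_connection s X (Y + Z) p = half_connection s X Y p + half_connection s X Z p"
    and "Z \<in> \<XX> \<Longrightarrow> X p (\<lambda>r. g r (Y r) (Z r))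
      = g p (half_connection s X Y p) (Z p) + g p (Y p) (half_connection s X Z p)"
proof -
  have s': "- s \<in> sgns" using s by auto
  have lX: "lf (- s) X \<in> \<Gamma>" and lY: "lf s Y \<in> \<Gamma>" using lift_section s s' X Y by auto
  note fibre = section_fibre[OF lX] section_fibre[OF lY] section_fibre[OF br_section[OF lX lY]]
  have orth: "q r (lf (- s) X r) (lf s Y r) = 0" for r
    using eig_orthogonal[OF s', of "lf (- s) X r" r "lf s Y r"] s s' X Y by (simp add: lift_eig vector_fieldD)
  have TX: "\<pi> p (lf (- s) X p) = X p" and TY: "\<pi> p (lf s Y p) = Y p" for p
    using s s' X Y by (simp_all add: anchor_lift vector_fieldD)
  have "half_connection s X Y = anchor_section E (proj E G s (br (lf (- s) X) (lf s Y)))"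
    by (auto simp: half_connection_def anchor_section_def proj_eq fun_eq_iff)
  then show "half_connection s X Y \<in> \<XX>"
    using lX lY by (simp add: anchor_section proj_section br_section)
  show "half_connection s (fscale f X) Y p = f p *\<^sub>R half_connection s X Y p" if f: "f \<in> C"
  proof -
    have 0: "pr s p (lf (- s) X p) = 0"
      using pr_other[OF s', of "lf (- s) X p" p] s' X by (simp add: lift_eig vector_fieldD)
    show ?thesis
      unfolding half_connection_def lift_section_fscale[OF s' X] br_fscale_left[OF lX lY f orth]
      using fibre subspace_fibre 0
      by (simp add: pr_diff pr_scale subspace_scale anchor_scale anchor_diff pr_mem)
  qed
  show "half_connection s X (fscale f Y) p = X p f *\<^sub>R Y p + f p *\<^sub>R half_connection s X Y p" if f: "f \<in> C"
  proof -
    have 0: "pr s p (lf s Y p) = lf s Y p" using pr_lift(1)[OF s] Y by (simp add: vector_fieldD)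
    show ?thesis
      unfolding half_connection_def lift_section_fscale[OF s Y] br_fscale[OF lX lY f] TX
      using fibre subspace_fibre 0 TY
      by (simp add: pr_add pr_scale subspace_scale anchor_scale anchor_add pr_mem)
  qed
  show "half_connection s (X + Z) Y p = half_connection s X Y p + half_connection s Z Y p" if Z: "Z \<in> \<XX>"
  proof -
    have lZ: "lf (- s) Z \<in> \<Gamma>" by (rule lift_section[OF s' Z])
    show ?thesis
      unfolding half_connection_def lift_section_add[OF s' X Z] br_add(2)[OF lY lX lZ]
      using section_fibre[OF br_section] lX lY lZ by (simp add: pr_add anchor_add pr_mem)
  qed
  fix Z assume Z: "Z \<in> \<XX>"
  have lZ: "lf s Z \<in> \<Gamma>" by (rule lift_section[OF s Z])
  show "half_connection s X (Y + Z) p = half_connection s X Y p + half_connection s X Z p"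
    unfolding half_connection_def lift_section_add[OF s Y Z] br_add(1)[OF lX lY lZ]
    using section_fibre[OF br_section] lX lY lZ by (simp add: pr_add anchor_add pr_mem)
  have ss: "s * s = 1" using s by auto
  have pair: "s * q p (br (lf (- s) X) (lf s V) p) (lf s W p) = g p (half_connection s X V p) (W p)"
    if V: "V \<in> \<XX>" and W: "W \<in> \<XX>" for V W
  proof -
    have lVW: "lf s V \<in> \<Gamma>" "lf s W \<in> \<Gamma>" using lift_section s V W by auto
    note b = section_fibre[OF br_section[OF lX lVW(1)], of p]
    have e: "lf s W p \<in> eig s p" using s W by (simp add: lift_eig vector_fieldD)
    have "q p (br (lf (- s) X) (lf s V) p) (lf s W p) = q p (pr s p (br (lf (- s) X) (lf s V) p)) (lf s W p)"
      using pr_self_adjoint[OF b eig_fibre[OF e], of s] pr_eq[OF s e] by simp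
    also have "\<dots> = s * g p (half_connection s X V p) (W p)"
      unfolding eig_pair[OF s pr_eig[OF s b] e] half_connection_def
      using s W by (simp add: anchor_lift vector_fieldD)
    finally show ?thesis using ss by (simp flip: mult.assoc)
  qed
  have gsym: "g p x y = g p y x" if "x \<in> T p" "y \<in> T p" for x y
    using base_metric_lift[of 1 x p y] base_metric_lift[of 1 y p x] that
      q.sym[OF lift_mem[of 1 x p] lift_mem[of 1 y p]] by simp
  have "(\<lambda>r. g r (Y r) (Z r)) = (\<lambda>r. s * q r (lf s Y r) (lf s Z r))"
    using base_metric_lift[OF s] Y Z ss by (simp add: vector_fieldD flip: mult.assoc)
  then have "X p (\<lambda>r. g r (Y r) (Z r)) = s * X p (\<lambda>r. q r (lf s Y r) (lf s Z r))"
    using tangent_linear(3)[OF vector_fieldD(1)[OF X] pair_smooth[OF lY lZ]] by simp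
  also have "\<dots> = s * q p (br (lf (- s) X) (lf s Y) p) (lf s Z p)
      + s * q p (br (lf (- s) X) (lf s Z) p) (lf s Y p)"
    using br_metric[OF lX lY lZ, of p] q.sym[OF fibre(2) section_fibre[OF br_section[OF lX lZ]], of p]
    by (simp add: TX algebra_simps)
  also have "\<dots> = g p (half_connection s X Y p) (Z p) + g p (Y p) (half_connection s X Z p)"
  proof -
    have "half_connection s X Z p \<in> T p"
      unfolding half_connection_def
      by (intro anchor_mem pr_mem section_fibre br_section lX lZ)
    then show ?thesis
      using pair[OF Y Z] pair[OF Z Y] gsym[of "half_connection s X Z p" "Y p"] Y by (simp add: vector_fieldD)
  qed
  finally show "X p (\<lambda>r. g r (Y r) (Z r))
      = g p (half_connection s X Y p) (Z p) + g p (Y p) (half_connection s X Z p)" .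
qed

text \<open>The half connection for s in \<open>X, Y\<close> and the one for -s in
  \<open>Y, X\<close> are, up to sign, complementary projections of one and the same bracket, whose
  anchor is the Lie bracket. So torsion is compared across the two signs.\<close>

lemma half_connection_torsion:
  assumes X: "X \<in> \<XX>" and Y: "Y \<in> \<XX>"
  shows "(\<Sum>s\<in>sgns. half_connection s X Y p) - (\<Sum>s\<in>sgns. half_connection s Y X p)
    = 2 *\<^sub>R lie_bracket (base E) X Y p"
proof -
  have lie: "\<pi> p (br (lf (- s) X) (lf s Y) p) = lie_bracket (base E) X Y p" if s: "s \<in> sgns" for s
  proof -
    have s': "- s \<in> sgns" using s by auto
    show ?thesis
      using fun_cong[OF anchor_br[OF lift_section[OF s' X] lift_section[OF s Y]], of p]
      unfolding anchor_section_lift[OF s' X] anchor_section_lift[OF s Y] by (simp add: anchor_section_def)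
  qed
  have split: "half_connection s X Y p - half_connection (- s) Y X p = lie_bracket (base E) X Y p"
    if s: "s \<in> sgns" for s
  proof -
    have s': "- s \<in> sgns" using s by auto
    have l: "lf (- s) X \<in> \<Gamma>" "lf s Y \<in> \<Gamma>" using lift_section s s' X Y by auto
    have "q r (lf s Y r) (lf (- s) X r) = 0" for r
      using eig_orthogonal[OF s, of "lf s Y r" r "lf (- s) X r"] s s' X Y by (simp add: lift_eig vector_fieldD)
    then have "br (lf s Y) (lf (- s) X) p = - br (lf (- s) X) (lf s Y) p"
      by (rule br_skew[OF l(2,1)])
    then have "half_connection (- s) Y X p = - \<pi> p (pr (- s) p (br (lf (- s) X) (lf s Y) p))"
      using section_fibre[OF br_section[OF l], of p]
      by (simp add: half_connection_def pr_minus pr_mem linear_on_minus[OF anchor_linear])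
    then have "half_connection s X Y p - half_connection (- s) Y X p
        = \<pi> p (pr s p (br (lf (- s) X) (lf s Y) p) + pr (- s) p (br (lf (- s) X) (lf s Y) p))"
      using section_fibre[OF br_section[OF l], of p] by (simp add: half_connection_def anchor_add pr_mem)
    then show ?thesis unfolding pr_sum using lie[OF s] by simp
  qed
  show ?thesis using split[of 1] split[of "-1"] by (simp add: algebra_simps scaleR_2)
qed

text \<open>Secures the properties of the connection chosen in \<open>levi_civita\<close> for the
  base metric.\<close>

lemma levi_civita_exists: "\<exists>nab. affine_levi_civita (base E) g nab"
proof
  let ?n = "\<lambda>X Y. (1/2) *\<^sub>R (half_connection 1 X Y + half_connection (- 1) X Y)"
  have eq: "?n X Y p = (1/2) *\<^sub>R (\<Sum>s\<in>sgns. half_connection s X Y p)" for X Y p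
    by (simp add: scaleR_fun_def)
  note hc = half_connection
  have field: "?n X Y \<in> \<XX>" if "X \<in> \<XX>" "Y \<in> \<XX>" for X Y
    using vector_field_fscale[OF smooth_functions_const vector_field_add[OF hc(1)[of 1] hc(1)[of "- 1"]]] that
    unfolding fscale_const[symmetric] by simp
  have left: "?n (fscale f X) Y = fscale f (?n X Y)" if "f \<in> C" "X \<in> \<XX>" "Y \<in> \<XX>" for f X Y
  proof (rule ext)
    fix p
    have "fscale f (?n X Y) p = f p *\<^sub>R ?n X Y p" by (rule fscale_apply)
    then show "?n (fscale f X) Y p = fscale f (?n X Y) p"
      unfolding eq using that by (simp add: hc(2) scaleR_add_right scaleR_left_commute[of "f p"])
  qed
  have right: "?n X (fscale f Y) = fscale (derivative_along X f) Y + fscale f (?n X Y)"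
    if "f \<in> C" "X \<in> \<XX>" "Y \<in> \<XX>" for f X Y
  proof (rule ext)
    fix p
    have "?n X (fscale f Y) p
        = (1/2) *\<^sub>R (X p f *\<^sub>R Y p + X p f *\<^sub>R Y p) + f p *\<^sub>R ((1/2) *\<^sub>R (\<Sum>s\<in>sgns. half_connection s X Y p))"
      unfolding eq using that by (simp add: hc(3) scaleR_add_right add_ac scaleR_left_commute[of "f p"])
    also have "\<dots> = (fscale (derivative_along X f) Y + fscale f (?n X Y)) p"
      unfolding scaleR_half_double plus_fun_apply fscale_apply eq derivative_along_def ..
    finally show "?n X (fscale f Y) p = (fscale (derivative_along X f) Y + fscale f (?n X Y)) p" .
  qed
  have addl: "?n (X + Z) Y = ?n X Y + ?n Z Y" if "X \<in> \<XX>" "Y \<in> \<XX>" "Z \<in> \<XX>" for X Y Z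
    using that by (simp add: fun_eq_iff hc(4) scaleR_fun_def algebra_simps)
  have addr: "?n X (Y + Z) = ?n X Y + ?n X Z" if "X \<in> \<XX>" "Y \<in> \<XX>" "Z \<in> \<XX>" for X Y Z
    using that by (simp add: fun_eq_iff hc(5) scaleR_fun_def algebra_simps)
  show "affine_levi_civita (base E) g ?n"
    unfolding affine_levi_civita_def Let_def
  proof (intro conjI ballI allI field left right)
    show "bilinear_on \<XX> ?n"
      unfolding bilinear_on_def
    proof (intro conjI ballI linear_onI addl addr)
      fix X Y r assume XY: "X \<in> \<XX>" "Y \<in> \<XX>"
      show "?n (r *\<^sub>R X) Y = r *\<^sub>R ?n X Y"
        using left[OF smooth_functions_const XY, of r] unfolding fscale_const .
      have "derivative_along X (\<lambda>q. r) = (\<lambda>q. 0)"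
        using tangent_const[OF vector_fieldD(1)[OF XY(1)]] by (auto simp: derivative_along_def)
      then show "?n X (r *\<^sub>R Y) = r *\<^sub>R ?n X Y"
        using right[OF smooth_functions_const XY, of r] unfolding fscale_const by (simp add: fscale_const)
    qed
  next
    fix X Y Z p assume XYZ: "X \<in> \<XX>" "Y \<in> \<XX>" "Z \<in> \<XX>"
    have T: "half_connection s V W p \<in> T p" if "s \<in> sgns" "V \<in> \<XX>" "W \<in> \<XX>" for s V W
      using hc(1)[OF that] by (simp add: vector_fieldD)
    have "g p (?n X Y p) (Z p) + g p (Y p) (?n X Z p)
      = (1/2) * (\<Sum>s\<in>sgns. g p (half_connection s X Y p) (Z p) + g p (Y p) (half_connection s X Z p))"
      unfolding eq using XYZ T subspace_tangent_space
      by (simp add: g_linear vector_fieldD subspace_add subspace_scale field_simps)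
    also have "\<dots> = (1/2) * (\<Sum>s\<in>sgns. X p (\<lambda>r. g r (Y r) (Z r)))"
      using hc(6)[OF _ XYZ(1,2,3), of _ p] by simp
    finally show "derivative_along X (\<lambda>q. g q (Y q) (Z q)) p = g p (?n X Y p) (Z p) + g p (Y p) (?n X Z p)"
      by (simp add: derivative_along_def)
  next
    fix X Y assume XY: "X \<in> \<XX>" "Y \<in> \<XX>"
    have "(?n X Y - ?n Y X) p = lie_bracket (base E) X Y p" for p
    proof -
      have "(?n X Y - ?n Y X) p = (1/2) *\<^sub>R ((\<Sum>s\<in>sgns. half_connection s X Y p) - (\<Sum>s\<in>sgns. half_connection s Y X p))"
        unfolding scaleR_diff_right eq[symmetric] by (rule minus_apply)
      also have "\<dots> = lie_bracket (base E) X Y p"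
        unfolding half_connection_torsion[OF XY] by simp
      finally show ?thesis .
    qed
    then show "?n X Y - ?n Y X = lie_bracket (base E) X Y" by auto
  qed
qed

abbreviation "nab \<equiv> levi_civita (base E) g"

lemma levi_civita: "affine_levi_civita (base E) g nab"
  unfolding levi_civita_def by (rule someI_ex[OF levi_civita_exists])

lemma nab:
  assumes "X \<in> \<XX>" "Y \<in> \<XX>"
  shows nab_field: "nab X Y \<in> \<XX>"
    and nab_add_left: "Z \<in> \<XX> \<Longrightarrow> nab (X + Z) Y p = nab X Y p + nab Z Y p"
    and nab_add_right: "Z \<in> \<XX> \<Longrightarrow> nab X (Y + Z) p = nab X Y p + nab X Z p"
    and nab_fscale_left: "f \<in> C \<Longrightarrow> nab (fscale f X) Y p = f p *\<^sub>R nab X Y p"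
    and nab_fscale_right: "f \<in> C \<Longrightarrow> nab X (fscale f Y) p = X p f *\<^sub>R Y p + f p *\<^sub>R nab X Y p"
    and nab_metric: "Z \<in> \<XX> \<Longrightarrow> X p (\<lambda>r. g r (Y r) (Z r)) = g p (nab X Y p) (Z p) + g p (Y p) (nab X Z p)"
proof -
  note lc = levi_civita[unfolded affine_levi_civita_def Let_def]
  show "nab X Y \<in> \<XX>" using lc assms by blast
  have b: "bilinear_on \<XX> nab" using lc by blast
  show "nab (X + Z) Y p = nab X Y p + nab Z Y p" if "Z \<in> \<XX>"
    using linear_on_add[OF bilinear_onD(2)[OF b assms(2)] assms(1) that] by simp
  show "nab X (Y + Z) p = nab X Y p + nab X Z p" if "Z \<in> \<XX>"
    using linear_on_add[OF bilinear_onD(1)[OF b assms(1)] assms(2) that] by simp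
  show "nab (fscale f X) Y p = f p *\<^sub>R nab X Y p" if "f \<in> C"
  proof -
    have "nab (fscale f X) Y = fscale f (nab X Y)" using lc assms that by blast
    then show ?thesis by (simp add: fscale_def)
  qed
  show "nab X (fscale f Y) p = X p f *\<^sub>R Y p + f p *\<^sub>R nab X Y p" if "f \<in> C"
  proof -
    have "nab X (fscale f Y) = fscale (derivative_along X f) Y + fscale f (nab X Y)"
      using lc assms that by blast
    then show ?thesis by (simp add: fscale_def derivative_along_def)
  qed
  show "X p (\<lambda>r. g r (Y r) (Z r)) = g p (nab X Y p) (Z p) + g p (Y p) (nab X Z p)" if "Z \<in> \<XX>"
  proof -
    have "derivative_along X (\<lambda>q. g q (Y q) (Z q)) p = g p (nab X Y p) (Z p) + g p (Y p) (nab X Z p)"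
      using lc assms that by blast
    then show ?thesis by (simp add: derivative_along_def)
  qed
qed

section \<open>The metric divergence\<close>

abbreviation "nab_at X \<equiv> value_at \<XX> (\<lambda>Y. nab Y X)"

text \<open>Precomposing with the anchor makes the connection an operator on sections of E, where
  the results on tensorial operators apply; lifting to an eigenbundle then carries them back to
  vector fields.\<close>

lemma tensorial_nab: "X \<in> \<XX> \<Longrightarrow> tensorial (\<lambda>u. nab (anchor_section E u) X)"
  by (rule tensorialI)
    (auto simp: anchor_section_add anchor_section_fscale anchor_section nab_add_left nab_fscale_left)

lemma nab_at:
  assumes X: "X \<in> \<XX>"
  shows "Y \<in> \<XX> \<Longrightarrow> nab_at X p (Y p) = nab Y X p"
    and nab_at_linear: "linear_on (T p) (nab_at X p)"
    and nab_at_mem: "x \<in> T p \<Longrightarrow> nab_at X p x \<in> T p"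
proof -
  have cong: "nab Y X p = nab Z X p" if YZ: "Y \<in> \<XX>" "Z \<in> \<XX>" "Y p = Z p" for Y Z
  proof -
    have "lf 1 Y p = lf 1 Z p" using YZ(3) by simp
    then have "nab (anchor_section E (lf 1 Y)) X p = nab (anchor_section E (lf 1 Z)) X p"
      using YZ(1,2) by (intro tensorial_cong[OF tensorial_nab[OF X]] lift_section) auto
    then show ?thesis using YZ by (simp add: anchor_section_lift)
  qed
  have val: "nab_at X p (Y p) = nab Y X p" if Y: "Y \<in> \<XX>" for Y
  proof -
    have "\<exists>Z. Z \<in> \<XX> \<and> Z p = Y p" using Y by blast
    from someI_ex[OF this] show ?thesis unfolding value_at_def using Y by (intro cong) auto
  qed
  then show "Y \<in> \<XX> \<Longrightarrow> nab_at X p (Y p) = nab Y X p" .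
  let ?v = "value_at \<Gamma> (\<lambda>u. nab (anchor_section E u) X) p"
  have eq: "nab_at X p x = ?v (lft 1 p x)" if x: "x \<in> T p" for x
  proof -
    have "lft 1 p x \<in> F p" using x by (simp add: lift_mem)
    then obtain u where u: "u \<in> \<Gamma>" "u p = lft 1 p x" using section_through by blast
    then have "anchor_section E u p = x" using x by (simp add: anchor_section_def anchor_lift)
    then show ?thesis
      using val[OF anchor_section[OF u(1)]] value_at_section[OF tensorial_nab[OF X] u(1), of p] u by simp
  qed
  have "linear_on (F p) ?v" by (rule linear_on_value_at[OF tensorial_nab[OF X]])
  then show "linear_on (T p) (nab_at X p)"
    using subspace_tangent_space[of p]
    by (intro linear_onI) (auto simp: eq subspace_add subspace_scale lift_add lift_scale lift_mem
        linear_on_add linear_on_scale)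
  show "nab_at X p x \<in> T p" if "x \<in> T p"
    unfolding eq[OF that]
    by (rule value_at_mem[OF tensorial_nab[OF X]])
      (use that X in \<open>auto simp: vector_fieldD nab_field anchor_section lift_mem\<close>)
qed

lemma vector_field_through:
  assumes "x \<in> T p" shows "\<exists>X\<in>\<XX>. X p = x"
proof -
  have "lft 1 p x \<in> F p" using assms by (simp add: lift_mem)
  then obtain u where "u \<in> \<Gamma>" "u p = lft 1 p x" using section_through by blast
  then show ?thesis
    using assms anchor_section[of u]
    by (intro bexI[of _ "anchor_section E u"]) (simp add: anchor_section_def anchor_lift, blast)
qed

lemma metric_div_eq: "metric_div (base E) g X p = trace_on (T p) (nab_at X p)"
  by (simp add: metric_div_def)

text \<open>The covariant differential of \<open>X\<close>, transported to an eigenbundle and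
  extended by zero to the other one. It serves twice: for the smoothness of the metric divergence,
  and as a constituent of the auxiliary connection.\<close>

definition lifted_nab :: "real \<Rightarrow> ('m \<Rightarrow> 'm tangent) \<Rightarrow> ('m \<Rightarrow> 'e) \<Rightarrow> 'm \<Rightarrow> 'e" where
  "lifted_nab s X u p = lft s p (nab (anchor_section E (proj E G s u)) X p)"

text \<open>For the trace, the lift is moved cyclically to the right end of the composition, where
  projection and anchor undo it.\<close>

lemma lifted_nab:
  assumes s: "s \<in> sgns" and X: "X \<in> \<XX>"
  shows tensorial_lifted_nab: "tensorial (lifted_nab s X)"
    and lifted_nab_section: "u \<in> \<Gamma> \<Longrightarrow> lifted_nab s X u \<in> \<Gamma>"
    and trace_lifted_nab: "trace_on (F p) (value_at \<Gamma> (lifted_nab s X) p) = metric_div (base E) g X p"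
proof -
  have A: "anchor_section E (proj E G s u) \<in> \<XX>" if "u \<in> \<Gamma>" for u
    using that by (simp add: anchor_section proj_section)
  show tens: "tensorial (lifted_nab s X)"
    by (rule tensorialI)
      (use s X A in \<open>auto simp: lifted_nab_def proj_add proj_fscale proj_section anchor_section_add
        anchor_section_fscale nab_add_left nab_fscale_left lift_add lift_scale vector_fieldD nab_field\<close>)
  show "lifted_nab s X u \<in> \<Gamma>" if "u \<in> \<Gamma>"
    using lift_section[OF s nab_field[OF A[OF that] X]] by (simp add: lifted_nab_def[abs_def])
  have eq: "value_at \<Gamma> (lifted_nab s X) p a = lft s p (nab_at X p (\<pi> p (pr s p a)))" if a: "a \<in> F p" for a
  proof -
    obtain u where u: "u \<in> \<Gamma>" "u p = a" using section_through[OF a] by blast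
    then show ?thesis
      using value_at_section[OF tens u(1), of p] nab_at(1)[OF X A[OF u(1)], of p]
      by (simp add: lifted_nab_def anchor_section_def proj_eq)
  qed
  note lin = nab_at_linear[OF X, of p]
  have "trace_on (F p) (value_at \<Gamma> (lifted_nab s X) p)
      = trace_on (F p) (\<lambda>a. lft s p (nab_at X p (\<pi> p (pr s p a))))"
    by (rule q.trace_on_cong[OF eq])
  also have "\<dots> = trace_on (T p) (\<lambda>x. nab_at X p (\<pi> p (pr s p (lft s p x))))"
  proof (rule trace_on_comp_commute[OF findim_fibre findim_tangent])
    show "linear_on (F p) (\<lambda>a. nab_at X p (\<pi> p (pr s p a)))"
      by (intro linear_onI) (auto simp: pr_add pr_scale anchor_add anchor_scale pr_mem anchor_mem
          linear_on_add[OF lin] linear_on_scale[OF lin])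
    show "linear_on (T p) (lft s p)" by (rule lift_linear[OF s])
  qed (use s X in \<open>auto simp: lift_mem nab_at_mem anchor_mem pr_mem\<close>)
  also have "\<dots> = trace_on (T p) (nab_at X p)"
    by (rule T.trace_on_cong) (use s in \<open>simp add: pr_lift anchor_lift\<close>)
  finally show "trace_on (F p) (value_at \<Gamma> (lifted_nab s X) p) = metric_div (base E) g X p"
    by (simp add: metric_div_eq)
qed

lemma metric_div_smooth: assumes "X \<in> \<XX>" shows "metric_div (base E) g X \<in> C"
proof -
  have "metric_div (base E) g X = (\<lambda>p. trace_on (F p) (value_at \<Gamma> (lifted_nab 1 X) p))"
    using assms by (simp add: trace_lifted_nab fun_eq_iff)
  then show ?thesis
    using trace_smooth[OF tensorial_lifted_nab lifted_nab_section, of 1 X] assms by simp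
qed

lemma metric_div_add:
  assumes X: "X \<in> \<XX>" and Y: "Y \<in> \<XX>"
  shows "metric_div (base E) g (X + Y) p = metric_div (base E) g X p + metric_div (base E) g Y p"
proof -
  have "nab_at (X + Y) p x = nab_at X p x + nab_at Y p x" if x: "x \<in> T p" for x
  proof -
    obtain Z where Z: "Z \<in> \<XX>" "Z p = x" using vector_field_through[OF x] by blast
    show ?thesis
      using nab_at(1)[OF vector_field_add[OF X Y] Z(1), of p] nab_at(1)[OF X Z(1), of p]
        nab_at(1)[OF Y Z(1), of p] nab_add_right[OF Z(1) X Y, of p] Z(2) by simp
  qed
  then have "metric_div (base E) g (X + Y) p = trace_on (T p) (\<lambda>x. nab_at X p x + nab_at Y p x)"
    unfolding metric_div_eq by (rule T.trace_on_cong)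
  then show ?thesis
    unfolding metric_div_eq using T.trace_on_add[of p "nab_at X p" "nab_at Y p"] X Y by (simp add: nab_at_mem)
qed

lemma metric_div_fscale:
  assumes X: "X \<in> \<XX>" and f: "f \<in> C"
  shows "metric_div (base E) g (fscale f X) p = X p f + f p * metric_div (base E) g X p"
proof -
  have "nab_at (fscale f X) p x = x f *\<^sub>R X p + f p *\<^sub>R nab_at X p x" if x: "x \<in> T p" for x
  proof -
    obtain Z where Z: "Z \<in> \<XX>" "Z p = x" using vector_field_through[OF x] by blast
    show ?thesis
      using nab_at(1)[OF vector_field_fscale[OF f X] Z(1), of p] nab_at(1)[OF X Z(1), of p]
        nab_fscale_right[OF Z(1) X f, of p] Z(2) by simp
  qed
  then have "metric_div (base E) g (fscale f X) p = trace_on (T p) (\<lambda>x. x f *\<^sub>R X p + f p *\<^sub>R nab_at X p x)"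
    unfolding metric_div_eq by (rule T.trace_on_cong)
  also have "\<dots> = trace_on (T p) (\<lambda>x. x f *\<^sub>R X p) + trace_on (T p) (\<lambda>x. f p *\<^sub>R nab_at X p x)"
    using subspace_tangent_space[of p] X
    by (intro T.trace_on_add) (auto simp: subspace_scale vector_fieldD nab_at_mem)
  also have "trace_on (T p) (\<lambda>x. x f *\<^sub>R X p) = X p f"
    using X by (intro T.trace_on_rank_one) (auto intro!: linear_onI simp: vector_fieldD scaleR_fun_def)
  also have "trace_on (T p) (\<lambda>x. f p *\<^sub>R nab_at X p x) = f p * trace_on (T p) (nab_at X p)"
    using X by (intro T.trace_on_scale) (auto simp: nab_at_mem)
  finally show ?thesis by (simp add: metric_div_eq)
qed

lemma divergence_operatorI:
  assumes "\<And>v. v \<in> \<Gamma> \<Longrightarrow> dv v \<in> C"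
    and "\<And>u v p. u \<in> \<Gamma> \<Longrightarrow> v \<in> \<Gamma> \<Longrightarrow> dv (u + v) p = dv u p + dv v p"
    and "\<And>f v p. f \<in> C \<Longrightarrow> v \<in> \<Gamma> \<Longrightarrow> dv (fscale f v) p = \<pi> p (v p) f + f p * dv v p"
  shows "divergence_operator E dv"
proof -
  have "dv (r *\<^sub>R v) = r *\<^sub>R dv v" if "v \<in> \<Gamma>" for r v
    using assms(3)[OF smooth_functions_const that, of r] that tangent_const[OF anchor_mem[OF section_fibre]]
    unfolding fscale_const by (auto simp: scaleR_fun_def fun_eq_iff)
  then show ?thesis
    using assms by (auto simp: divergence_operator_def linear_on_def fun_eq_iff fscale_def act_eq)
qed

lemma divergence_operator_metric: "divergence_operator E (metric_divergence E G)"
  by (rule divergence_operatorI)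
    (auto simp: metric_divergence_def anchor_section metric_div_smooth anchor_section_add metric_div_add
      anchor_section_fscale metric_div_fscale, simp add: anchor_section_def)

end

section \<open>Torsion and tensors\<close>

context exact_courant
begin

text \<open>The fibrewise representatives form a smooth section because their pairings with all
  sections are smooth.\<close>

lemma riesz_section:
  fixes e :: "('m \<Rightarrow> 'e) \<Rightarrow> 'm \<Rightarrow> real"
  assumes "tensorial e" "\<And>w. w \<in> \<Gamma> \<Longrightarrow> e w \<in> C"
  shows "\<exists>z\<in>\<Gamma>. \<forall>w\<in>\<Gamma>. \<forall>p. q p (z p) (w p) = e w p"
proof -
  have "\<exists>y\<in>F p. \<forall>x\<in>F p. q p y x = value_at \<Gamma> e p x" for p
    by (rule q.riesz[OF linear_on_value_at[OF assms(1)]])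
  then obtain z where z: "\<And>p. z p \<in> F p" "\<And>p x. x \<in> F p \<Longrightarrow> q p (z p) x = value_at \<Gamma> e p x"
    by metis
  have e: "q p (z p) (w p) = e w p" if "w \<in> \<Gamma>" for w p
    using z(2)[OF section_fibre[OF that]] value_at_section[OF assms(1) that] by simp
  then have "z \<in> \<Gamma>" using z(1) assms(2) by (intro section_by_pairing) simp_all
  then show ?thesis using e by blast
qed

lemma connection:
  assumes "generalised_connection E D" "u \<in> \<Gamma>" "v \<in> \<Gamma>"
  shows connection_section: "D u v \<in> \<Gamma>"
    and connection_add: "w \<in> \<Gamma> \<Longrightarrow> D (u + w) v p = D u v p + D w v p"
      "w \<in> \<Gamma> \<Longrightarrow> D u (v + w) p = D u v p + D u w p"
    and connection_fscale: "f \<in> C \<Longrightarrow> D (fscale f u) v p = f p *\<^sub>R D u v p"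
      "f \<in> C \<Longrightarrow> D u (fscale f v) p = \<pi> p (u p) f *\<^sub>R v p + f p *\<^sub>R D u v p"
    and connection_pairing: "w \<in> \<Gamma> \<Longrightarrow>
      \<pi> p (u p) (\<lambda>r. q r (v r) (w r)) = q p (D u v p) (w p) + q p (v p) (D u w p)"
proof -
  note D = assms(1)[unfolded generalised_connection_def]
  show "D u v \<in> \<Gamma>" using D assms by blast
  have b: "bilinear_on \<Gamma> D" using D by blast
  show "D (u + w) v p = D u v p + D w v p" if "w \<in> \<Gamma>"
    using linear_on_add[OF bilinear_onD(2)[OF b assms(3)] assms(2) that] by simp
  show "D u (v + w) p = D u v p + D u w p" if "w \<in> \<Gamma>"
    using linear_on_add[OF bilinear_onD(1)[OF b assms(2)] assms(3) that] by simp
  show "D (fscale f u) v p = f p *\<^sub>R D u v p" if "f \<in> C"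
  proof -
    have "D (fscale f u) v = fscale f (D u v)" using D assms that by blast
    then show ?thesis by (simp add: fscale_def)
  qed
  show "D u (fscale f v) p = \<pi> p (u p) f *\<^sub>R v p + f p *\<^sub>R D u v p" if "f \<in> C"
  proof -
    have "D u (fscale f v) = fscale (act E u f) v + fscale f (D u v)" using D assms that by blast
    then show ?thesis by (simp add: fscale_def act_eq)
  qed
  show "\<pi> p (u p) (\<lambda>r. q r (v r) (w r)) = q p (D u v p) (w p) + q p (v p) (D u w p)" if "w \<in> \<Gamma>"
  proof -
    have "act E u (pair_sections E v w) = pair_sections E (D u v) w + pair_sections E v (D u w)"
      using D assms that by blast
    from fun_cong[OF this, of p] show ?thesis by (simp add: act_eq pair_sections_def[abs_def])
  qed
qed

lemma generalised_connectionI: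
  assumes "\<And>u v. u \<in> \<Gamma> \<Longrightarrow> v \<in> \<Gamma> \<Longrightarrow> D u v \<in> \<Gamma>"
    and "\<And>u v w p. u \<in> \<Gamma> \<Longrightarrow> v \<in> \<Gamma> \<Longrightarrow> w \<in> \<Gamma> \<Longrightarrow> D (u + w) v p = D u v p + D w v p"
    and "\<And>u v w p. u \<in> \<Gamma> \<Longrightarrow> v \<in> \<Gamma> \<Longrightarrow> w \<in> \<Gamma> \<Longrightarrow> D u (v + w) p = D u v p + D u w p"
    and left: "\<And>u v f p. u \<in> \<Gamma> \<Longrightarrow> v \<in> \<Gamma> \<Longrightarrow> f \<in> C \<Longrightarrow> D (fscale f u) v p = f p *\<^sub>R D u v p"
    and right: "\<And>u v f p. u \<in> \<Gamma> \<Longrightarrow> v \<in> \<Gamma> \<Longrightarrow> f \<in> C \<Longrightarrow>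
      D u (fscale f v) p = \<pi> p (u p) f *\<^sub>R v p + f p *\<^sub>R D u v p"
    and "\<And>u v w p. u \<in> \<Gamma> \<Longrightarrow> v \<in> \<Gamma> \<Longrightarrow> w \<in> \<Gamma> \<Longrightarrow>
      \<pi> p (u p) (\<lambda>r. q r (v r) (w r)) = q p (D u v p) (w p) + q p (v p) (D u w p)"
  shows "generalised_connection E D"
  unfolding generalised_connection_def
proof (intro conjI ballI)
  show "bilinear_on \<Gamma> D"
    unfolding bilinear_on_def
  proof (intro conjI ballI linear_onI ext)
    fix u v r p assume uv: "u \<in> \<Gamma>" "v \<in> \<Gamma>"
    show "D u (r *\<^sub>R v) p = (r *\<^sub>R D u v) p"
      using right[OF uv smooth_functions_const, of r p] tangent_const[OF anchor_mem[OF section_fibre[OF uv(1)]]]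
      unfolding fscale_const by (simp add: scaleR_fun_def)
    show "D (r *\<^sub>R u) v p = (r *\<^sub>R D u v) p"
      using left[OF uv smooth_functions_const, of r p] unfolding fscale_const by (simp add: scaleR_fun_def)
  qed (use assms(2,3) in auto)
qed (use assms in \<open>auto simp: fun_eq_iff fscale_apply act_eq pair_sections_def[abs_def]\<close>)

lemma torsion_eq:
  "gen_torsion E D u v w p = q p (D u v p - D v u p - br u v p) (w p) + q p (D w u p) (v p)"
  by (simp add: gen_torsion_def pair_sections_def)

text \<open>Skewness in the first two arguments: the symmetric part of the bracket cancels against
  the extra term of the torsion. In the last two it follows from compatibility of both
  \<open>D\<close> and the bracket with the pairing. Linearity over functions is checked in the last
  argument and carried to the others by skewness.\<close>

lemma torsion:
  assumes D: "generalised_connection E D" and uvw: "u \<in> \<Gamma>" "v \<in> \<Gamma>" "w \<in> \<Gamma>"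
  shows torsion_skew12: "gen_torsion E D v u w p = - gen_torsion E D u v w p"
    and torsion_skew23: "gen_torsion E D u w v p = - gen_torsion E D u v w p"
    and torsion_smooth: "gen_torsion E D u v w \<in> C"
    and torsion_add: "z \<in> \<Gamma> \<Longrightarrow> gen_torsion E D u v (w + z) p = gen_torsion E D u v w p + gen_torsion E D u v z p"
    and torsion_fscale: "f \<in> C \<Longrightarrow> gen_torsion E D u v (fscale f w) p = f p * gen_torsion E D u v w p"
proof -
  note sec = connection_section[OF D] br_section
  have expand: "gen_torsion E D x y z p
      = q p (D x y p) (z p) - q p (D y x p) (z p) - q p (br x y p) (z p) + q p (D z x p) (y p)"
    if "x \<in> \<Gamma>" "y \<in> \<Gamma>" "z \<in> \<Gamma>" for x y z p
    unfolding torsion_eq using that subspace_fibre by (simp add: q.diff_left subspace_diff section_fibre sec)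
  have sym: "q p (x p) (y p) = q p (y p) (x p)" if "x \<in> \<Gamma>" "y \<in> \<Gamma>" for x y p
    using that by (simp add: q.sym section_fibre)
  show "gen_torsion E D v u w p = - gen_torsion E D u v w p"
    using br_sym[OF uvw, of p] connection_pairing[OF D uvw(3,1,2), of p] sym[of "D w v" u p] uvw
    by (simp add: expand sec)
  show "gen_torsion E D u w v p = - gen_torsion E D u v w p"
    using br_metric[OF uvw, of p] connection_pairing[OF D uvw, of p] connection_pairing[OF D uvw(2,1,3), of p]
      sym[of "D u w" v p] sym[of "D v w" u p] sym[of "br u w" v p] uvw
      connection_pairing[OF D uvw(3,1,2), of p] sym[of "D w v" u p] sym[of "D w u" v p]
    by (simp add: expand sec)
  show "gen_torsion E D u v w \<in> C"
  proof -
    have "D u v - D v u - br u v \<in> \<Gamma>" using uvw by (intro section_diff sec)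
    from smooth_functions_add[OF pair_smooth[OF this uvw(3)] pair_smooth[OF sec(1)[OF uvw(3,1)] uvw(2)]]
    show ?thesis by (simp add: torsion_eq[abs_def])
  qed
  show "gen_torsion E D u v (w + z) p = gen_torsion E D u v w p + gen_torsion E D u v z p" if "z \<in> \<Gamma>"
    using that uvw subspace_fibre
    by (simp add: torsion_eq connection_add[OF D] q.add_left q.add_right section_fibre sec subspace_diff)
  show "gen_torsion E D u v (fscale f w) p = f p * gen_torsion E D u v w p" if "f \<in> C"
    using that uvw subspace_fibre
    by (simp add: torsion_eq connection_fscale[OF D] fscale_apply q.scale_left q.scale_right section_fibre sec
        subspace_diff distrib_left)
qed

lemma tensorial_connection: "generalised_connection E D \<Longrightarrow> v \<in> \<Gamma> \<Longrightarrow> tensorial (\<lambda>u. D u v)"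
  by (rule tensorialI) (auto simp: connection_add connection_fscale)

lemma value_at_add:
  assumes "tensorial op" "tensorial op'" "tensorial op''" "a \<in> F p"
    and "\<And>u. u \<in> \<Gamma> \<Longrightarrow> op u p = op' u p + op'' u p"
  shows "value_at \<Gamma> op p a = value_at \<Gamma> op' p a + value_at \<Gamma> op'' p a"
proof -
  obtain u where "u \<in> \<Gamma>" "u p = a" using section_through[OF assms(4)] by blast
  then show ?thesis using value_at_section assms by metis
qed

lemma trace_value_at_add:
  assumes "tensorial op" "tensorial op'" "tensorial op''"
    and "\<And>u. u \<in> \<Gamma> \<Longrightarrow> op u p = op' u p + op'' u p"
    and "\<And>u. u \<in> \<Gamma> \<Longrightarrow> op' u p \<in> F p" "\<And>u. u \<in> \<Gamma> \<Longrightarrow> op'' u p \<in> F p"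
  shows "trace_on (F p) (value_at \<Gamma> op p)
    = trace_on (F p) (value_at \<Gamma> op' p) + trace_on (F p) (value_at \<Gamma> op'' p)"
proof -
  have "trace_on (F p) (value_at \<Gamma> op p)
      = trace_on (F p) (\<lambda>a. value_at \<Gamma> op' p a + value_at \<Gamma> op'' p a)"
    by (rule q.trace_on_cong[OF value_at_add[OF assms(1-3)]]) (use assms(4) in auto)
  then show ?thesis
    using q.trace_on_add[of p "value_at \<Gamma> op' p" "value_at \<Gamma> op'' p"]
      value_at_mem[OF assms(2), of p "F p"] value_at_mem[OF assms(3), of p "F p"] assms(5,6) by simp
qed

end

context gen_metric
begin

lemma metric_connectionD:
  "metric_connection E G D \<Longrightarrow> u \<in> \<Gamma> \<Longrightarrow> v \<in> \<Gamma> \<Longrightarrow> w \<in> \<Gamma> \<Longrightarrow>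
    \<pi> p (u p) (\<lambda>r. G r (v r) (w r)) = G p (D u v p) (w p) + G p (v p) (D u w p)"
  unfolding metric_connection_def act_eq by blast

lemma G_linear:
  "a \<in> F p \<Longrightarrow> b \<in> F p \<Longrightarrow> c \<in> F p \<Longrightarrow> G p (a + b) c = G p a c + G p b c"
  "a \<in> F p \<Longrightarrow> b \<in> F p \<Longrightarrow> c \<in> F p \<Longrightarrow> G p c (a + b) = G p c a + G p c b"
  using linear_on_add[OF bilinear_onD(1)[OF G_bilinear]] linear_on_add[OF bilinear_onD(2)[OF G_bilinear]] by auto

text \<open>Serves for both perturbations: from the auxiliary connection to D^0, and from D^0 to the
  canonical connection. Skewness of \<open>S\<close> turns the change of the torsion into the cyclic
  sum of \<open>S\<close>.\<close>

lemma add_tensor: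
  assumes D: "generalised_connection E D" "metric_connection E G D"
    and S: "\<And>u v. u \<in> \<Gamma> \<Longrightarrow> v \<in> \<Gamma> \<Longrightarrow> S u v \<in> \<Gamma>"
      "\<And>u v w p. u \<in> \<Gamma> \<Longrightarrow> v \<in> \<Gamma> \<Longrightarrow> w \<in> \<Gamma> \<Longrightarrow> S (u + w) v p = S u v p + S w v p"
      "\<And>u v w p. u \<in> \<Gamma> \<Longrightarrow> v \<in> \<Gamma> \<Longrightarrow> w \<in> \<Gamma> \<Longrightarrow> S u (v + w) p = S u v p + S u w p"
      "\<And>u v f p. u \<in> \<Gamma> \<Longrightarrow> v \<in> \<Gamma> \<Longrightarrow> f \<in> C \<Longrightarrow> S (fscale f u) v p = f p *\<^sub>R S u v p"
      "\<And>u v f p. u \<in> \<Gamma> \<Longrightarrow> v \<in> \<Gamma> \<Longrightarrow> f \<in> C \<Longrightarrow> S u (fscale f v) p = f p *\<^sub>R S u v p"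
    and skew: "\<And>u v w p. u \<in> \<Gamma> \<Longrightarrow> v \<in> \<Gamma> \<Longrightarrow> w \<in> \<Gamma> \<Longrightarrow> q p (S u v p) (w p) = - q p (S u w p) (v p)"
      "\<And>u v w p. u \<in> \<Gamma> \<Longrightarrow> v \<in> \<Gamma> \<Longrightarrow> w \<in> \<Gamma> \<Longrightarrow> G p (S u v p) (w p) = - G p (S u w p) (v p)"
    and D': "\<And>u v. u \<in> \<Gamma> \<Longrightarrow> v \<in> \<Gamma> \<Longrightarrow> D' u v = D u v + S u v"
  shows "generalised_connection E D'" "metric_connection E G D'"
    and "u \<in> \<Gamma> \<Longrightarrow> v \<in> \<Gamma> \<Longrightarrow> w \<in> \<Gamma> \<Longrightarrow> gen_torsion E D' u v w p = gen_torsion E D u v w p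
      + q p (S u v p) (w p) + q p (S v w p) (u p) + q p (S w u p) (v p)"
proof -
  note con = connection_section[OF D(1)] connection_add[OF D(1)] connection_fscale[OF D(1)]
  have "q p (v p) (S u w p) = - q p (S u v p) (w p)" if "u \<in> \<Gamma>" "v \<in> \<Gamma>" "w \<in> \<Gamma>" for u v w p
    using skew(1)[OF that, of p] q.sym[OF section_fibre section_fibre, of v "S u w" p] that S(1) by simp
  then show "generalised_connection E D'"
    by (intro generalised_connectionI)
      (simp_all add: D' section_add section_fscale con S algebra_simps q.add_left q.add_right section_fibre
        connection_pairing[OF D(1)])
  have "G p (v p) (S u w p) = - G p (S u v p) (w p)" if "u \<in> \<Gamma>" "v \<in> \<Gamma>" "w \<in> \<Gamma>" for u v w p
    using skew(2)[OF that, of p] G_sym[OF section_fibre section_fibre, of v "S u w" p] that S(1) by simp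
  then show "metric_connection E G D'"
    unfolding metric_connection_def act_eq
    by (simp add: D' con S G_linear section_fibre metric_connectionD[OF D(2)])
  assume uvw: "u \<in> \<Gamma>" "v \<in> \<Gamma>" "w \<in> \<Gamma>"
  have eq: "D' u v p - D' v u p - br u v p = (D u v p - D v u p - br u v p) + (S u v p - S v u p)"
    using uvw by (simp add: D')
  then show "gen_torsion E D' u v w p = gen_torsion E D u v w p
      + q p (S u v p) (w p) + q p (S v w p) (u p) + q p (S w u p) (v p)"
    unfolding torsion_eq eq using uvw subspace_fibre skew(1)[OF uvw(2,1,3), of p]
    by (simp add: D' q.add_left q.diff_left section_fibre con S br_section subspace_diff)
qed

section \<open>The connection \<open>D\<^sup>0\<close>\<close>

text \<open>\<open>mixed\<close> and \<open>pure\<close> are the parts of the s-component of the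
  auxiliary derivative that come from the component of \<open>u\<close> in the opposite and in the
  same eigenbundle.\<close>

definition mixed :: "real \<Rightarrow> ('m \<Rightarrow> 'e) \<Rightarrow> ('m \<Rightarrow> 'e) \<Rightarrow> 'm \<Rightarrow> 'e" where
  "mixed s u v p = pr s p (br (proj E G (- s) u) (proj E G s v) p)"

definition pure :: "real \<Rightarrow> ('m \<Rightarrow> 'e) \<Rightarrow> ('m \<Rightarrow> 'e) \<Rightarrow> 'm \<Rightarrow> 'e" where
  "pure s u v = lifted_nab s (anchor_section E (proj E G s v)) u"

lemma D_tilde_eq: "D_tilde E G u v p = (\<Sum>s\<in>sgns. pure s u v p + mixed s u v p)"
  by (simp add: D_tilde_def pure_def mixed_def lifted_nab_def proj_eq)

lemma proj_fibre: "u \<in> \<Gamma> \<Longrightarrow> proj E G s u p \<in> F p"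
  by (simp add: section_fibre proj_section)

lemma proj_sum: "u p = proj E G s u p + proj E G (- s) u p"
  by (simp add: proj_eq pr_sum)

lemma anchor_proj: "u \<in> \<Gamma> \<Longrightarrow> anchor_section E (proj E G s u) \<in> \<XX>"
  by (intro anchor_section proj_section)

lemma anchor_proj_sum:
  assumes "u \<in> \<Gamma>"
  shows "\<pi> p (u p) f = \<pi> p (proj E G s u p) f + \<pi> p (proj E G (- s) u p) f"
proof -
  have "\<pi> p (u p) = \<pi> p (proj E G s u p) + \<pi> p (proj E G (- s) u p)"
    unfolding proj_sum[of u p s] by (rule anchor_add) (simp_all add: proj_fibre assms)
  then show ?thesis by simp
qed

lemma lift_anchor_proj: "s \<in> sgns \<Longrightarrow> v \<in> \<Gamma> \<Longrightarrow> lft s p (anchor_section E (proj E G s v) p) = proj E G s v p"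
  using lift_anchor[OF _ proj_eig] by (simp add: anchor_section_def)

text \<open>The Leibniz rule differentiates along one component of \<open>u\<close> only. The
  missing half is supplied by \<open>mixed\<close>, so each of the two is only part of a
  connection.\<close>

lemma pure:
  assumes s: "s \<in> sgns" and u: "u \<in> \<Gamma>" and v: "v \<in> \<Gamma>"
  shows pure_section: "pure s u v \<in> \<Gamma>" and pure_eig: "pure s u v p \<in> eig s p"
    and "w \<in> \<Gamma> \<Longrightarrow> pure s (u + w) v p = pure s u v p + pure s w v p"
    and "f \<in> C \<Longrightarrow> pure s (fscale f u) v p = f p *\<^sub>R pure s u v p"
    and "w \<in> \<Gamma> \<Longrightarrow> pure s u (v + w) p = pure s u v p + pure s u w p"
    and "f \<in> C \<Longrightarrow> pure s u (fscale f v) p = \<pi> p (proj E G s u p) f *\<^sub>R proj E G s v p + f p *\<^sub>R pure s u v p"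
proof -
  note A = anchor_proj
  show "pure s u v \<in> \<Gamma>" unfolding pure_def by (rule lifted_nab_section[OF s A[OF v] u])
  show "pure s u v p \<in> eig s p"
    unfolding pure_def lifted_nab_def by (intro lift_eig s vector_fieldD nab_field A u v)
  show "w \<in> \<Gamma> \<Longrightarrow> pure s (u + w) v p = pure s u v p + pure s w v p"
    "f \<in> C \<Longrightarrow> pure s (fscale f u) v p = f p *\<^sub>R pure s u v p"
    using tensorial_lifted_nab[OF s A[OF v]] u by (simp_all add: pure_def tensorial_def fscale_def)
  show "pure s u (v + w) p = pure s u v p + pure s u w p" if "w \<in> \<Gamma>"
    using s u v that by (simp add: pure_def lifted_nab_def proj_add anchor_section_add proj_section A
        nab_add_right lift_add vector_fieldD nab_field)
  have lfs: "lft s p (c *\<^sub>R x) = c *\<^sub>R lft s p x" if "x \<in> T p" for c x using lift_scale[OF s that] .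
  show "pure s u (fscale f v) p = \<pi> p (proj E G s u p) f *\<^sub>R proj E G s v p + f p *\<^sub>R pure s u v p" if f: "f \<in> C"
    using s u v f subspace_tangent_space[of p]
    by (simp add: pure_def lifted_nab_def proj_fscale anchor_section_fscale proj_section A
        nab_fscale_right lift_add lfs subspace_scale vector_fieldD nab_field lift_anchor_proj)
      (simp add: anchor_section_def)
qed

lemma mixed:
  assumes s: "s \<in> sgns" and u: "u \<in> \<Gamma>" and v: "v \<in> \<Gamma>"
  shows mixed_section: "mixed s u v \<in> \<Gamma>" and mixed_eig: "mixed s u v p \<in> eig s p"
    and "w \<in> \<Gamma> \<Longrightarrow> mixed s (u + w) v p = mixed s u v p + mixed s w v p"
    and "f \<in> C \<Longrightarrow> mixed s (fscale f u) v p = f p *\<^sub>R mixed s u v p"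
    and "w \<in> \<Gamma> \<Longrightarrow> mixed s u (v + w) p = mixed s u v p + mixed s u w p"
    and "f \<in> C \<Longrightarrow> mixed s u (fscale f v) p = \<pi> p (proj E G (- s) u p) f *\<^sub>R proj E G s v p + f p *\<^sub>R mixed s u v p"
proof -
  let ?u = "proj E G (- s) u" and ?v = "proj E G s v"
  have s': "- s \<in> sgns" using s by auto
  have uv: "?u \<in> \<Gamma>" "?v \<in> \<Gamma>" using u v by (auto intro: proj_section)
  note b = section_fibre[OF br_section[OF uv]]
  have "mixed s u v = proj E G s (br ?u ?v)" by (auto simp: mixed_def proj_eq)
  then show "mixed s u v \<in> \<Gamma>" using uv by (simp add: proj_section br_section)
  show "mixed s u v p \<in> eig s p" unfolding mixed_def by (rule pr_eig[OF s b])
  have orth: "q r (?u r) (?v r) = 0" for r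
    using eig_orthogonal[OF s', of "?u r" r "?v r"] proj_eig s s' u v by simp
  show "mixed s (u + w) v p = mixed s u v p + mixed s w v p" if "w \<in> \<Gamma>"
    using u v that by (simp add: mixed_def proj_add br_add proj_section pr_add section_fibre br_section)
  show "mixed s u (v + w) p = mixed s u v p + mixed s u w p" if "w \<in> \<Gamma>"
    using u v that by (simp add: mixed_def proj_add br_add proj_section pr_add section_fibre br_section)
  have pu: "pr s p (?u p) = 0" and pv: "pr s p (?v p) = ?v p"
    using s u v by (simp_all add: proj_eq pr_pr section_fibre)
  show "mixed s (fscale f u) v p = f p *\<^sub>R mixed s u v p" if "f \<in> C"
    unfolding mixed_def proj_fscale[OF u] br_fscale_left[OF uv that orth]
    using b subspace_fibre pu section_fibre[OF uv(1)] by (simp add: pr_diff pr_scale subspace_scale)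
  show "mixed s u (fscale f v) p = \<pi> p (?u p) f *\<^sub>R ?v p + f p *\<^sub>R mixed s u v p" if "f \<in> C"
    unfolding mixed_def proj_fscale[OF v] br_fscale[OF uv that]
    using b subspace_fibre pv section_fibre[OF uv(2)] by (simp add: pr_add pr_scale subspace_scale)
qed

text \<open>The derivative along \<open>u\<close> is split by eigenbundles: the half in the same
  eigenbundle is metricity of the Levi-Civita connection, the other half is invariance of the
  pairing under the bracket.\<close>

lemma pure_mixed_metric:
  assumes s: "s \<in> sgns" and u: "u \<in> \<Gamma>" and v: "v \<in> \<Gamma>" and w: "w \<in> \<Gamma>"
  shows "\<pi> p (u p) (\<lambda>r. q r (proj E G s v r) (proj E G s w r))
    = q p (pure s u v p + mixed s u v p) (proj E G s w p) + q p (proj E G s v p) (pure s u w p + mixed s u w p)"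
proof -
  let ?P = "proj E G s" and ?N = "proj E G (- s)"
  let ?X = "anchor_section E (?P u)" and ?V = "anchor_section E (?P v)" and ?W = "anchor_section E (?P w)"
  have ss: "s * s = 1" using s by auto
  have eq: "(\<lambda>r. q r (?P v r) (?P w r)) = (\<lambda>r. s * g r (?V r) (?W r))"
    using eig_pair[OF s proj_eig[OF s v] proj_eig[OF s w]] by (simp add: anchor_section_def)
  have nabp: "s * g p (nab ?X (anchor_section E (?P a)) p) (anchor_section E (?P b) p) = q p (pure s u a p) (?P b p)"
    if "a \<in> \<Gamma>" "b \<in> \<Gamma>" for a b
  proof -
    have "\<pi> p (pure s u a p) = nab ?X (anchor_section E (?P a)) p"
      unfolding pure_def lifted_nab_def
      by (rule anchor_lift[OF s]) (intro vector_fieldD nab_field anchor_proj u that)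
    then show ?thesis
      using eig_pair[OF s pure_eig[OF s u that(1)] proj_eig[OF s that(2)]] by (simp add: anchor_section_def)
  qed
  have gsym: "g p x y = g p y x" if "x \<in> T p" "y \<in> T p" for x y
    using base_metric_lift[of 1 x p y] base_metric_lift[of 1 y p x] that
      q.sym[OF lift_mem[of 1 x p] lift_mem[of 1 y p]] by simp
  have "\<pi> p (?P u p) (\<lambda>r. q r (?P v r) (?P w r)) = s * ?X p (\<lambda>r. g r (?V r) (?W r))"
    unfolding eq using tangent_linear(3)[OF anchor_mem[OF proj_fibre[OF u]]
        base_metric_smooth[OF anchor_proj[OF v] anchor_proj[OF w]]] by (simp add: anchor_section_def)
  also have "\<dots> = s * g p (nab ?X ?V p) (?W p) + s * g p (nab ?X ?W p) (?V p)"
    using nab_metric[OF anchor_proj[OF u] anchor_proj[OF v] anchor_proj[OF w], where p = p]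
      gsym[of "?V p" "nab ?X ?W p"] u v w
    by (simp add: vector_fieldD anchor_proj nab_field algebra_simps)
  also have "\<dots> = q p (pure s u v p) (?P w p) + q p (pure s u w p) (?P v p)"
    by (simp add: nabp v w)
  finally have 1: "\<pi> p (?P u p) (\<lambda>r. q r (?P v r) (?P w r))
      = q p (pure s u v p) (?P w p) + q p (pure s u w p) (?P v p)" .
  have m: "q p (br (?N u) (?P a) p) (?P b p) = q p (mixed s u a p) (?P b p)" if "a \<in> \<Gamma>" "b \<in> \<Gamma>" for a b
    unfolding mixed_def
    using pr_self_adjoint[OF section_fibre[OF br_section] proj_fibre, of "?N u" "?P a" b p s s] s u that
    by (simp add: proj_section proj_eq pr_pr section_fibre)
  have "\<pi> p (?N u p) (\<lambda>r. q r (?P v r) (?P w r))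
      = q p (br (?N u) (?P v) p) (?P w p) + q p (?P v p) (br (?N u) (?P w) p)"
    by (rule br_metric) (intro proj_section u v w)+
  also have "\<dots> = q p (mixed s u v p) (?P w p) + q p (mixed s u w p) (?P v p)"
    using m[OF v w] m[OF w v] q.sym[of "?P v p" p "br (?N u) (?P w) p"] u v w
    by (simp add: section_fibre br_section proj_section)
  finally have 2: "\<pi> p (?N u p) (\<lambda>r. q r (?P v r) (?P w r))
      = q p (mixed s u v p) (?P w p) + q p (mixed s u w p) (?P v p)" .
  show ?thesis
    unfolding anchor_proj_sum[OF u, of p _ s] 1 2
    using eig_fibre[OF pure_eig[OF s u]] eig_fibre[OF mixed_eig[OF s u]] proj_fibre u v w
      q.sym[of "?P v p" p "pure s u w p"] q.sym[of "?P v p" p "mixed s u w p"]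
    by (simp add: q.add_left q.add_right)
qed

lemma D_tilde_proj:
  assumes s: "s \<in> sgns" and u: "u \<in> \<Gamma>" and v: "v \<in> \<Gamma>"
  shows "pr s p (D_tilde E G u v p) = pure s u v p + mixed s u v p"
proof -
  have e: "pure t u v p + mixed t u v p \<in> eig t p" if "t \<in> sgns" for t
    using subspace_add[OF subspace_eig pure_eig[OF that u v] mixed_eig[OF that u v]] .
  have s': "- s \<in> sgns" using s by auto
  have "D_tilde E G u v p = (pure s u v p + mixed s u v p) + (pure (- s) u v p + mixed (- s) u v p)"
    using s by (auto simp: D_tilde_eq)
  then show ?thesis
    using pr_eq[OF s e[OF s]] pr_other[OF s' e[OF s']] e[OF s] e[OF s'] by (simp add: pr_add eig_fibre)
qed

lemma pair_split:
  "a \<in> F p \<Longrightarrow> b \<in> F p \<Longrightarrow> q p a b = (\<Sum>s\<in>sgns. q p (pr s p a) (pr s p b))"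
  using q.add_left[of b p "pr 1 p a" "pr (- 1) p a"] by (simp add: pr_pair pr_mem pr_sum)

lemma D_tilde_section:
  assumes "u \<in> \<Gamma>" "v \<in> \<Gamma>" shows "D_tilde E G u v \<in> \<Gamma>"
proof -
  have "D_tilde E G u v = (\<Sum>s\<in>sgns. pure s u v + mixed s u v)"
    by (rule ext) (simp add: D_tilde_eq)
  then show ?thesis using assms by (simp add: section_add pure_section mixed_section)
qed

lemma D_tilde_connection: "generalised_connection E (D_tilde E G)"
proof (rule generalised_connectionI[OF D_tilde_section])
  fix u v w p assume uvw: "u \<in> \<Gamma>" "v \<in> \<Gamma>" "w \<in> \<Gamma>"
  show "D_tilde E G (u + w) v p = D_tilde E G u v p + D_tilde E G w v p"
    "D_tilde E G u (v + w) p = D_tilde E G u v p + D_tilde E G u w p"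
    using uvw by (simp_all add: D_tilde_eq pure(3,5) mixed(3,5))
  have fib: "D_tilde E G a b p \<in> F p" if "a \<in> \<Gamma>" "b \<in> \<Gamma>" for a b
    by (intro section_fibre D_tilde_section that)
  have "(\<lambda>r. q r (v r) (w r)) = (\<lambda>r. q r (proj E G 1 v r) (proj E G 1 w r) + q r (proj E G (- 1) v r) (proj E G (- 1) w r))"
    using uvw by (simp add: pair_split section_fibre proj_eq)
  moreover have "(\<lambda>r. q r (proj E G s v r) (proj E G s w r)) \<in> C" for s
    using uvw by (intro pair_smooth proj_section)
  ultimately have "\<pi> p (u p) (\<lambda>r. q r (v r) (w r)) = (\<Sum>s\<in>sgns. \<pi> p (u p) (\<lambda>r. q r (proj E G s v r) (proj E G s w r)))"
    using tangent_linear(1)[OF anchor_mem[OF section_fibre[OF uvw(1)]]] by simp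
  also have "\<dots> = (\<Sum>s\<in>sgns. q p (pr s p (D_tilde E G u v p)) (pr s p (w p)) + q p (pr s p (v p)) (pr s p (D_tilde E G u w p)))"
    by (intro sum.cong refl) (use uvw in \<open>simp add: pure_mixed_metric[unfolded proj_eq] D_tilde_proj proj_eq\<close>)
  also have "\<dots> = q p (D_tilde E G u v p) (w p) + q p (v p) (D_tilde E G u w p)"
    unfolding sum.distrib using uvw fib by (simp add: pair_split[of _ p] section_fibre)
  finally show "\<pi> p (u p) (\<lambda>r. q r (v r) (w r)) = q p (D_tilde E G u v p) (w p) + q p (v p) (D_tilde E G u w p)" .
next
  fix u v f p assume uvf: "u \<in> \<Gamma>" "v \<in> \<Gamma>" "f \<in> C"
  then show "D_tilde E G (fscale f u) v p = f p *\<^sub>R D_tilde E G u v p"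
    by (simp add: D_tilde_eq pure(4) mixed(4) algebra_simps)
  have "pure s u (fscale f v) p + mixed s u (fscale f v) p
      = \<pi> p (u p) f *\<^sub>R proj E G s v p + f p *\<^sub>R (pure s u v p + mixed s u v p)" if "s \<in> sgns" for s
    using that uvf anchor_proj_sum[OF uvf(1), of p f s]
    by (simp add: pure(6) mixed(6) algebra_simps)
  then show "D_tilde E G u (fscale f v) p = \<pi> p (u p) f *\<^sub>R v p + f p *\<^sub>R D_tilde E G u v p"
    unfolding D_tilde_eq proj_sum[of v p 1] by (simp add: algebra_simps)
qed

lemma D_tilde_metric: "metric_connection E G (D_tilde E G)"
  unfolding metric_connection_def act_eq
proof (intro ballI allI)
  fix u v w p assume uvw: "u \<in> \<Gamma>" "v \<in> \<Gamma>" "w \<in> \<Gamma>"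
  have fib: "D_tilde E G a b p \<in> F p" if "a \<in> \<Gamma>" "b \<in> \<Gamma>" for a b
    by (intro section_fibre D_tilde_section that)
  have "(\<lambda>r. G r (v r) (w r)) = (\<lambda>r. q r (proj E G 1 v r) (proj E G 1 w r) - q r (proj E G (- 1) v r) (proj E G (- 1) w r))"
    using uvw by (simp add: G_eq section_fibre proj_eq)
  moreover have "(\<lambda>r. q r (proj E G s v r) (proj E G s w r)) \<in> C" for s
    using uvw by (intro pair_smooth proj_section)
  ultimately have "\<pi> p (u p) (\<lambda>r. G r (v r) (w r)) = (\<Sum>s\<in>sgns. s * \<pi> p (u p) (\<lambda>r. q r (proj E G s v r) (proj E G s w r)))"
    using tangent_linear(2)[OF anchor_mem[OF section_fibre[OF uvw(1)]]] by simp
  also have "\<dots> = (\<Sum>s\<in>sgns. s * q p (pr s p (D_tilde E G u v p)) (pr s p (w p)) + s * q p (pr s p (v p)) (pr s p (D_tilde E G u w p)))"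
    by (intro sum.cong refl) (use uvw in \<open>simp add: pure_mixed_metric[unfolded proj_eq] D_tilde_proj proj_eq distrib_left\<close>)
  also have "\<dots> = G p (D_tilde E G u v p) (w p) + G p (v p) (D_tilde E G u w p)"
    unfolding sum.distrib using uvw fib by (simp add: G_eq section_fibre)
  finally show "\<pi> p (u p) (\<lambda>r. G r (v r) (w r)) = G p (D_tilde E G u v p) (w p) + G p (v p) (D_tilde E G u w p)" .
qed

end

context exact_courant
begin

lemma torsion_cyclic:
  assumes "generalised_connection E D" "u \<in> \<Gamma>" "v \<in> \<Gamma>" "w \<in> \<Gamma>"
  shows "gen_torsion E D v w u p = gen_torsion E D u v w p"
  using torsion_skew12[OF assms, of p] torsion_skew23[OF assms(1,3,2,4), of p] by simp

lemma torsion_left: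
  assumes D: "generalised_connection E D" and uvw: "u \<in> \<Gamma>" "v \<in> \<Gamma>" "w \<in> \<Gamma>"
  shows "z \<in> \<Gamma> \<Longrightarrow> gen_torsion E D (u + z) v w p = gen_torsion E D u v w p + gen_torsion E D z v w p"
    and "f \<in> C \<Longrightarrow> gen_torsion E D (fscale f u) v w p = f p * gen_torsion E D u v w p"
  using uvw by (simp_all add: section_add section_fscale torsion_add[OF D] torsion_fscale[OF D]
      torsion_cyclic[OF D, symmetric, of _ v w])

lemma torsion_middle:
  assumes D: "generalised_connection E D" and uvw: "u \<in> \<Gamma>" "v \<in> \<Gamma>" "w \<in> \<Gamma>"
  shows "z \<in> \<Gamma> \<Longrightarrow> gen_torsion E D u (v + z) w p = gen_torsion E D u v w p + gen_torsion E D u z w p"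
    and "f \<in> C \<Longrightarrow> gen_torsion E D u (fscale f v) w p = f p * gen_torsion E D u v w p"
  using uvw by (simp_all add: section_add section_fscale torsion_left[OF D]
      torsion_cyclic[OF D, symmetric, of u _ w])

end

context gen_metric
begin

section \<open>The torsion of the auxiliary connection has no mixed components\<close>

lemma proj_proj:
  assumes "s \<in> sgns" "u \<in> \<Gamma>"
  shows "proj E G s (proj E G s u) = proj E G s u" "proj E G (- s) (proj E G s u) = 0"
    "proj E G s (proj E G (- s) u) = 0"
  using assms by (auto simp: proj_eq fun_eq_iff pr_pr section_fibre)

lemma G_eig: "b \<in> eig s p \<Longrightarrow> a \<in> F p \<Longrightarrow> G p a b = s * q p a b"
  using J_pair[of b p a] G_sym[of a p b] q.sym[of a p b] by (simp add: eig_iff q.scale_left)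

text \<open>Opposite eigenbundles are orthogonal for the pairing and for \<open>G\<close>.
  Differentiating both relations gives the sum and, up to sign, the difference of the same two
  terms, so both terms vanish.\<close>

lemma metric_connection_preserves:
  assumes D: "generalised_connection E D" "metric_connection E G D"
    and s: "s \<in> sgns" and uvw: "u \<in> \<Gamma>" "v \<in> \<Gamma>" "w \<in> \<Gamma>"
  shows "q p (D u (proj E G (- s) v) p) (proj E G s w p) = 0"
proof -
  let ?v = "proj E G (- s) v" and ?w = "proj E G s w"
  have s': "- s \<in> sgns" using s by auto
  have vw: "?v \<in> \<Gamma>" "?w \<in> \<Gamma>" using uvw by (auto intro: proj_section)
  note ev = proj_eig[OF s' uvw(2)] and ew = proj_eig[OF s uvw(3)]
  note fib = section_fibre[OF connection_section[OF D(1) uvw(1)]]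
  have zero: "\<pi> p (u p) (\<lambda>r. 0) = 0"
    by (rule tangent_linear(4)[OF anchor_mem[OF section_fibre[OF uvw(1)]]])
  have "q r (?v r) (?w r) = 0" for r
    using eig_orthogonal[OF s' ev, of "?w r" r] ew by simp
  then have 1: "q p (D u ?v p) (?w p) + q p (?v p) (D u ?w p) = 0"
    using connection_pairing[OF D(1) uvw(1) vw, of p] zero by simp
  have "G r (?v r) (?w r) = 0" for r
    using G_eig[OF ew section_fibre[OF vw(1)]] eig_orthogonal[OF s' ev, of "?w r" r] ew by simp
  then have "G p (D u ?v p) (?w p) + G p (?v p) (D u ?w p) = 0"
    using metric_connectionD[OF D(2) uvw(1) vw, of p] zero by simp
  then have "s * (q p (D u ?v p) (?w p) - q p (?v p) (D u ?w p)) = 0"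
    using G_eig[OF ew fib[OF vw(1)]] G_eig[OF ev fib[OF vw(2)]]
      G_sym[OF section_fibre[OF vw(1)] fib[OF vw(2)]] q.sym[OF section_fibre[OF vw(1)] fib[OF vw(2)]]
    by (simp add: algebra_simps)
  then show ?thesis using 1 s by auto
qed

abbreviation "Dt \<equiv> D_tilde E G"
abbreviation "\<tau> \<equiv> gen_torsion E Dt"

lemmas Dt = D_tilde_connection D_tilde_metric

text \<open>The auxiliary derivative of \<open>u\<close> along the opposite component is by
  construction the projected bracket and cancels the bracket in the torsion. The two other terms
  pair opposite eigenbundles and vanish since the connection preserves these.\<close>

lemma torsion_mixed:
  assumes s: "s \<in> sgns" and uvw: "u \<in> \<Gamma>" "v \<in> \<Gamma>" "w \<in> \<Gamma>"
  shows "\<tau> (proj E G (- s) w) (proj E G s u) (proj E G s v) p = 0"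
proof -
  let ?w = "proj E G (- s) w" and ?u = "proj E G s u" and ?v = "proj E G s v"
  have s': "- s \<in> sgns" using s by auto
  have G: "?w \<in> \<Gamma>" "?u \<in> \<Gamma>" "?v \<in> \<Gamma>" using uvw by (auto intro: proj_section)
  note fib = section_fibre[OF D_tilde_section] section_fibre[OF br_section] section_fibre
  have "pure s ?w ?u p = 0"
  proof -
    have "anchor_section E (proj E G s ?w) = fscale (\<lambda>_. 0) (anchor_section E ?w)"
      using proj_proj(3)[OF s uvw(3)] by (auto simp: anchor_section_def fscale_def anchor_zero fun_eq_iff)
    then have "nab (anchor_section E (proj E G s ?w)) X p = 0" if "X \<in> \<XX>" for X
      using nab_fscale_left[OF anchor_section[OF G(1)] that smooth_functions_const, of 0 p] by simp
    then show ?thesis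
      using linear_on_zero[OF lift_linear[OF s] subspace_tangent_space] G
      by (simp add: pure_def lifted_nab_def anchor_proj)
  qed
  moreover have "mixed s ?w ?u p = pr s p (br ?w ?u p)"
    using proj_proj(1)[OF s' uvw(3)] proj_proj(1)[OF s uvw(1)] by (simp add: mixed_def)
  ultimately have pr: "pr s p (Dt ?w ?u p) = pr s p (br ?w ?u p)"
    using D_tilde_proj[OF s G(1,2), of p] by simp
  have shift: "q p a (?v p) = q p (pr s p a) (?v p)" if "a \<in> F p" for a
    using pr_self_adjoint[OF that, of "?v p" s] pr_eq[OF s proj_eig[OF s uvw(2)]] G by (simp add: section_fibre)
  have "q p (Dt ?w ?u p) (?v p) = q p (br ?w ?u p) (?v p)"
    using shift[of "Dt ?w ?u p"] shift[of "br ?w ?u p"] G pr by (simp add: fib)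
  moreover have "q p (Dt ?u ?w p) (?v p) = 0"
    by (rule metric_connection_preserves[OF Dt s G(2) uvw(3,2)])
  moreover have "q p (Dt ?v ?w p) (?u p) = 0"
    by (rule metric_connection_preserves[OF Dt s G(3) uvw(3,1)])
  ultimately show ?thesis
    unfolding torsion_eq using G subspace_fibre by (simp add: q.diff_left fib subspace_diff)
qed

text \<open>Both components of \<open>u\<close> must be treated: in either case two arguments lie in
  one eigenbundle and the third in the other, and a cyclic permutation brings the term into the form
  of \<open>torsion_mixed\<close>.\<close>

lemma torsion_proj:
  assumes s: "s \<in> sgns" and uvw: "u \<in> \<Gamma>" "v \<in> \<Gamma>" "w \<in> \<Gamma>"
  shows "\<tau> u v (proj E G s w) p = \<tau> u (proj E G s v) (proj E G s w) p"
proof -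
  let ?P = "proj E G s" and ?N = "proj E G (- s)"
  have s': "- s \<in> sgns" using s by auto
  have split: "z = ?P z + ?N z" for z using proj_sum[of z _ s] by auto
  have G: "?P z \<in> \<Gamma>" "?N z \<in> \<Gamma>" if "z \<in> \<Gamma>" for z using that by (auto intro: proj_section)
  note cyc = torsion_cyclic[OF Dt(1)]
  have "\<tau> u (?N v) (?P w) p = \<tau> (?P u) (?N v) (?P w) p + \<tau> (?N u) (?N v) (?P w) p"
    by (subst split[of u]) (intro torsion_left(1)[OF Dt(1)] G uvw)
  also have "\<tau> (?P u) (?N v) (?P w) p = 0"
    using cyc[OF G(1) G(2) G(1), of u v w p] uvw torsion_mixed[OF s uvw(3,1,2), of p] by simp
  also have "\<tau> (?N u) (?N v) (?P w) p = 0"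
    using cyc[OF G(1) G(2) G(2), of w u v p] uvw torsion_mixed[OF s' uvw(1,2,3), of p] by simp
  finally have "\<tau> u (?N v) (?P w) p = 0" by simp
  moreover have "\<tau> u v (?P w) p = \<tau> u (?P v) (?P w) p + \<tau> u (?N v) (?P w) p"
    by (subst split[of v]) (intro torsion_middle(1)[OF Dt(1)] G uvw)
  ultimately show ?thesis by simp
qed

abbreviation "D0 \<equiv> D_zero E G"

text \<open>The right-hand side is linear over functions in \<open>w\<close>, so Riesz
  representation of sections makes the definite description in \<open>D_zero\<close>
  meaningful.\<close>

lemma D_zero:
  assumes "u \<in> \<Gamma>" "v \<in> \<Gamma>"
  shows D_zero_section: "D0 u v \<in> \<Gamma>"
    and D_zero_pairing: "w \<in> \<Gamma> \<Longrightarrow> q p (D0 u v p) (w p) = q p (Dt u v p) (w p) - (1/3) * \<tau> u v w p"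
proof -
  let ?e = "\<lambda>w p. q p (Dt u v p) (w p) - (1/3) * \<tau> u v w p"
  let ?Q = "\<lambda>z. z \<in> \<Gamma> \<and> (\<forall>w\<in>\<Gamma>. \<forall>p. pair_sections E z w p = pair_sections E (Dt u v) w p - (1/3) * \<tau> u v w p)"
  note fib = section_fibre[OF D_tilde_section[OF assms]]
  have "tensorial ?e"
    by (rule tensorialI)
      (use assms fib in \<open>simp_all add: q.add_right q.scale_right section_fibre fscale_apply
        torsion_add[OF Dt(1)] torsion_fscale[OF Dt(1)] algebra_simps\<close>)
  moreover have "?e w \<in> C" if "w \<in> \<Gamma>" for w
    using assms that
    by (intro smooth_functions_diff smooth_functions_mult smooth_functions_const pair_smooth
        torsion_smooth[OF Dt(1)] D_tilde_section)
  ultimately obtain z where z: "z \<in> \<Gamma>" "\<forall>w\<in>\<Gamma>. \<forall>p. q p (z p) (w p) = ?e w p"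
    using riesz_section[of ?e] by blast
  have "\<exists>!z. ?Q z"
  proof (rule ex1I[of _ z])
    show "?Q z" using z by (simp add: pair_sections_def)
    fix y assume y: "?Q y"
    have "y p = z p" for p
      by (rule pairing_eqI[of _ p]) (use y z in \<open>auto simp: section_fibre pair_sections_def\<close>)
    then show "y = z" by auto
  qed
  then have "?Q (D0 u v)" unfolding D_zero_def by (rule theI')
  then show "D0 u v \<in> \<Gamma>" "w \<in> \<Gamma> \<Longrightarrow> q p (D0 u v p) (w p) = q p (Dt u v p) (w p) - (1/3) * \<tau> u v w p"
    by (auto simp: pair_sections_def)
qed

definition correction :: "('m \<Rightarrow> 'e) \<Rightarrow> ('m \<Rightarrow> 'e) \<Rightarrow> 'm \<Rightarrow> 'e" where
  "correction u v = D0 u v - Dt u v"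

lemma correction:
  assumes "u \<in> \<Gamma>" "v \<in> \<Gamma>"
  shows correction_section: "correction u v \<in> \<Gamma>"
    and correction_pairing: "w \<in> \<Gamma> \<Longrightarrow> q p (correction u v p) (w p) = - (1/3) * \<tau> u v w p"
  using assms
  by (auto simp: correction_def section_diff D_zero_section D_tilde_section q.diff_left section_fibre D_zero_pairing)

lemma correction_eqI:
  assumes "u \<in> \<Gamma>" "v \<in> \<Gamma>" "b \<in> F p"
    and "\<And>w. w \<in> \<Gamma> \<Longrightarrow> q p b (w p) = - (1/3) * \<tau> u v w p"
  shows "correction u v p = b"
  by (rule pairing_eqI[of _ p]) (use assms in \<open>auto simp: correction_pairing correction_section section_fibre\<close>)

lemma correction_linear:
  assumes u: "u \<in> \<Gamma>" and v: "v \<in> \<Gamma>"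
  shows "w \<in> \<Gamma> \<Longrightarrow> correction (u + w) v p = correction u v p + correction w v p"
    and "w \<in> \<Gamma> \<Longrightarrow> correction u (v + w) p = correction u v p + correction u w p"
    and "f \<in> C \<Longrightarrow> correction (fscale f u) v p = f p *\<^sub>R correction u v p"
    and "f \<in> C \<Longrightarrow> correction u (fscale f v) p = f p *\<^sub>R correction u v p"
  using u v subspace_fibre
  by (auto intro!: correction_eqI simp: section_add section_fscale subspace_add subspace_scale section_fibre
      correction_section q.add_left q.scale_left correction_pairing torsion_left[OF Dt(1)]
      torsion_middle[OF Dt(1)] algebra_simps)

text \<open>\<open>G\<close> is a signed sum of the pairings of the components. By the absence of
  mixed torsion each summand sees both arguments only through the same eigenbundle, where skewness
  of the torsion applies.\<close>

lemma correction_G_skew: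
  assumes u: "u \<in> \<Gamma>" and v: "v \<in> \<Gamma>" and w: "w \<in> \<Gamma>"
  shows "G p (correction u v p) (w p) = - G p (correction u w p) (v p)"
proof -
  have expand: "G p (correction u a p) (b p) = - (1/3) * (\<Sum>s\<in>sgns. s * \<tau> u a (proj E G s b) p)"
    if "a \<in> \<Gamma>" "b \<in> \<Gamma>" for a b
  proof -
    have "G p (correction u a p) (b p) = (\<Sum>s\<in>sgns. s * q p (correction u a p) (proj E G s b p))"
      using u that pr_self_adjoint
      by (simp add: G_eq section_fibre correction_section pr_pair proj_eq)
    then show ?thesis using u that by (simp add: correction_pairing proj_section algebra_simps)
  qed
  have "\<tau> u w (proj E G s v) p = - \<tau> u v (proj E G s w) p" if s: "s \<in> sgns" for s
    using torsion_proj[OF s u v w, of p] torsion_proj[OF s u w v, of p]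
      torsion_skew23[OF Dt(1) u proj_section[OF v] proj_section[OF w], of s s p] by simp
  from this[of 1] this[of "- 1"] show ?thesis by (simp add: expand v w field_simps)
qed

lemma D_zero_levi_civita: "generalised_levi_civita E G D0"
proof -
  have D: "D0 u v = Dt u v + correction u v" for u v by (simp add: correction_def)
  have skew: "q p (correction u v p) (w p) = - q p (correction u w p) (v p)"
    if "u \<in> \<Gamma>" "v \<in> \<Gamma>" "w \<in> \<Gamma>" for u v w p
    using torsion_skew23[OF Dt(1) that, of p] that by (simp add: correction_pairing)
  note rules = Dt correction_section correction_linear skew correction_G_skew D
  have 1: "generalised_connection E D0"
    by (rule add_tensor(1)[where D = Dt and S = correction]) (assumption | rule rules)+
  have 2: "metric_connection E G D0"
    by (rule add_tensor(2)[where D = Dt and S = correction]) (assumption | rule rules)+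
  have 3: "gen_torsion E D0 u v w p = \<tau> u v w p + q p (correction u v p) (w p)
      + q p (correction v w p) (u p) + q p (correction w u p) (v p)"
    if "u \<in> \<Gamma>" "v \<in> \<Gamma>" "w \<in> \<Gamma>" for u v w p
    by (rule add_tensor(3)[where D = Dt and S = correction]) (assumption | rule rules that)+
  \<comment> \<open>The three cyclic summands of the correction are equal, each being minus one
    third of the torsion.\<close>
  have "gen_torsion E D0 u v w = 0" if "u \<in> \<Gamma>" "v \<in> \<Gamma>" "w \<in> \<Gamma>" for u v w
    using 3[OF that] torsion_cyclic[OF Dt(1) that] torsion_cyclic[OF Dt(1) that(2,3,1)] that
    by (simp add: fun_eq_iff correction_pairing)
  then show ?thesis unfolding generalised_levi_civita_def using 1 2 by blast
qed

lemma D_zero_connection: "generalised_connection E D0" and D_zero_metric: "metric_connection E G D0"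
  using D_zero_levi_civita by (auto simp: generalised_levi_civita_def)

text \<open>D^0 is the sum of the correction and of a pure and a mixed part for each sign. The
  correction is traceless because the torsion is skew in the argument traced over and the output;
  the mixed parts are traceless because they exchange nothing within one eigenbundle; the pure parts
  give the divergences of the anchors of the two components of \<open>v\<close>, which add
  up.\<close>

lemma divergence_D_zero:
  assumes v: "v \<in> \<Gamma>"
  shows "divergence_of E D0 v = metric_divergence E G v"
proof
  fix p
  let ?tr = "\<lambda>op. trace_on (F p) (value_at \<Gamma> op p)"
  have t_pure: "tensorial (\<lambda>u. pure s u v)" and t_mixed: "tensorial (\<lambda>u. mixed s u v)" if "s \<in> sgns" for s
    using that v by (auto intro!: tensorialI simp: pure(3,4) mixed(3,4))
  have t_corr: "tensorial (\<lambda>u. correction u v)"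
    using v by (intro tensorialI) (simp_all add: correction_linear)
  have t_pm: "tensorial (\<lambda>u. pure s u v + mixed s u v)" if "s \<in> sgns" for s
    using that v by (intro tensorialI) (auto simp: pure(3,4) mixed(3,4) algebra_simps)
  note tens = tensorial_connection[OF Dt(1) v] tensorial_connection[OF D_zero_connection v]
  have fib: "pure s u v p \<in> F p" "mixed s u v p \<in> F p" "(pure s u v + mixed s u v) p \<in> F p"
    "correction u v p \<in> F p" "Dt u v p \<in> F p" if "s \<in> sgns" "u \<in> \<Gamma>" for s u
    using that v by (auto intro!: section_fibre[OF pure_section] section_fibre[OF mixed_section]
        section_fibre[OF correction_section] section_fibre[OF D_tilde_section] subspace_add subspace_fibre)
  have "?tr (\<lambda>u. D0 u v) = ?tr (\<lambda>u. Dt u v) + ?tr (\<lambda>u. correction u v)"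
    by (rule trace_value_at_add[OF tens(2,1) t_corr]) (use fib[of 1] in \<open>auto simp: correction_def\<close>)
  also have "?tr (\<lambda>u. Dt u v) = ?tr (\<lambda>u. pure 1 u v + mixed 1 u v) + ?tr (\<lambda>u. pure (- 1) u v + mixed (- 1) u v)"
    by (rule trace_value_at_add[OF tens(1) t_pm t_pm]) (use fib in \<open>auto simp: D_tilde_eq\<close>)
  also have "?tr (\<lambda>u. pure 1 u v + mixed 1 u v) = ?tr (\<lambda>u. pure 1 u v) + ?tr (\<lambda>u. mixed 1 u v)"
    by (rule trace_value_at_add[OF t_pm t_pure t_mixed]) (use fib in auto)
  also have "?tr (\<lambda>u. pure (- 1) u v + mixed (- 1) u v) = ?tr (\<lambda>u. pure (- 1) u v) + ?tr (\<lambda>u. mixed (- 1) u v)"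
    by (rule trace_value_at_add[OF t_pm t_pure t_mixed]) (use fib in auto)
  also have "?tr (\<lambda>u. correction u v) = 0"
  proof (rule q.trace_skew[OF linear_on_value_at[OF t_corr] value_at_mem[OF t_corr]])
    fix x y assume "x \<in> F p" "y \<in> F p"
    then obtain u w where uw: "u \<in> \<Gamma>" "u p = x" "w \<in> \<Gamma>" "w p = y" using section_through by metis
    have val: "value_at \<Gamma> (\<lambda>u. correction u v) p (z p) = correction z v p" if "z \<in> \<Gamma>" for z
      by (rule value_at_section[OF t_corr that])
    have "q p (u p) (correction w v p) = - q p (w p) (correction u v p)"
      using q.sym[OF section_fibre[OF uw(1)] section_fibre[OF correction_section[OF uw(3) v]]]
        q.sym[OF section_fibre[OF uw(3)] section_fibre[OF correction_section[OF uw(1) v]]]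
        torsion_skew12[OF Dt(1) v uw(1,3), of p] torsion_skew23[OF Dt(1) v uw(1,3), of p]
        torsion_skew12[OF Dt(1) v uw(3,1), of p] uw(1,3) v
      by (simp add: correction_pairing)
    then show "q p x (value_at \<Gamma> (\<lambda>u. correction u v) p y) = - q p y (value_at \<Gamma> (\<lambda>u. correction u v) p x)"
      using val[OF uw(1)] val[OF uw(3)] uw by simp
  qed (use fib[of 1] in auto)
  also have mixed0: "?tr (\<lambda>u. mixed s u v) = 0" if s: "s \<in> sgns" for s
  proof -
    let ?f = "value_at \<Gamma> (\<lambda>u. mixed s u v) p"
    note val = value_at_section[OF t_mixed[OF s]]
    have mem: "?f a \<in> F p" if "a \<in> F p" for a
      by (rule value_at_mem[OF t_mixed[OF s] _ that]) (use fib s in auto)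
    \<comment> \<open>The mixed part takes values in the s-eigenbundle, so \<open>pr s\<close> may
      be composed on the left. Moved to the right, it restricts the map to that same eigenbundle,
      where it vanishes.\<close>
    have "trace_on (F p) ?f = trace_on (F p) (\<lambda>a. pr s p (?f a))"
    proof (rule q.trace_on_cong)
      fix a assume "a \<in> F p"
      then obtain u where u: "u \<in> \<Gamma>" "u p = a" using section_through by blast
      then show "?f a = pr s p (?f a)" using val[OF u(1), of p] pr_eq[OF s mixed_eig[OF s u(1) v]] by simp
    qed
    also have "\<dots> = trace_on (F p) (\<lambda>a. ?f (pr s p a))"
      by (rule trace_on_comp_commute[OF findim_fibre findim_fibre linear_on_value_at[OF t_mixed[OF s]] mem
            pr_linear pr_mem])
    also have "\<dots> = trace_on (F p) (\<lambda>a. 0)"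
    proof (rule q.trace_on_cong)
      fix a assume "a \<in> F p"
      then obtain u where u: "u \<in> \<Gamma>" "u p = a" using section_through by blast
      have "mixed s (proj E G s u) v p = pr s p (br 0 (proj E G s v) p)"
        using proj_proj(2)[OF s u(1)] by (simp add: mixed_def)
      moreover have "br 0 (proj E G s v) = 0"
        using br_add(2)[OF proj_section[OF v] section_zero section_zero, of s] by simp
      ultimately show "?f (pr s p a) = 0"
        using val[OF proj_section[OF u(1)], of p s] u(2) by (simp add: proj_eq pr_zero)
    qed
    finally show ?thesis by (simp add: q.trace_on_zero)
  qed
  also have tr_pure: "?tr (\<lambda>u. pure s u v) = metric_div (base E) g (anchor_section E (proj E G s v)) p"
    if "s \<in> sgns" for s
    unfolding pure_def by (rule trace_lifted_nab[OF that anchor_proj[OF v]])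
  finally have "?tr (\<lambda>u. D0 u v) = (\<Sum>s\<in>sgns. metric_div (base E) g (anchor_section E (proj E G s v)) p)"
    using mixed0 by (simp add: tr_pure)
  also have "\<dots> = metric_div (base E) g (anchor_section E (proj E G 1 v) + anchor_section E (proj E G (- 1) v)) p"
    using metric_div_add[OF anchor_proj[OF v] anchor_proj[OF v], of 1 "- 1" p] by simp
  also have "anchor_section E (proj E G 1 v) + anchor_section E (proj E G (- 1) v)
      = anchor_section E (proj E G 1 v + proj E G (- 1) v)"
    by (rule anchor_section_add[symmetric]) (intro proj_section v)+
  also have "proj E G 1 v + proj E G (- 1) v = v"
    by (rule ext) (simp add: proj_sum[of v _ 1])
  finally show "divergence_of E D0 v p = metric_divergence E G v p"
    by (simp add: divergence_of_def metric_divergence_def)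
qed

end

section \<open>The first prolongation\<close>

lemma linear_on_fun_add: "linear_on V f \<Longrightarrow> linear_on V g \<Longrightarrow> linear_on V (\<lambda>x. f x + g x)"
  and linear_on_fun_diff: "linear_on V f \<Longrightarrow> linear_on V g \<Longrightarrow> linear_on V (\<lambda>x. f x - g x)"
  by (simp_all add: linear_on_def algebra_simps)

lemma linear_on_scaleR_left: "linear_on V h \<Longrightarrow> linear_on V (\<lambda>x. h x *\<^sub>R z)"
  by (simp add: linear_on_def algebra_simps)

lemma linear_on_mult_left: "linear_on V h \<Longrightarrow> linear_on V (\<lambda>x. c * h x :: real)"
  and linear_on_mult_right: "linear_on V h \<Longrightarrow> linear_on V (\<lambda>x. h x * c :: real)"
  by (simp_all add: linear_on_def algebra_simps)

context gen_metric
begin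

abbreviation "\<Sigma> \<equiv> so_prolongation E G"

lemma prolongation:
  assumes "K \<in> \<Sigma> p"
  shows "a \<in> F p \<Longrightarrow> b \<in> F p \<Longrightarrow> K a b \<in> F p"
    and "a \<in> F p \<Longrightarrow> linear_on (F p) (K a)"
    and "b \<in> F p \<Longrightarrow> linear_on (F p) (\<lambda>a. K a b)"
    and "a \<in> F p \<Longrightarrow> b \<in> F p \<Longrightarrow> c \<in> F p \<Longrightarrow> q p (K a c) b = - q p (K a b) c"
    and "a \<in> F p \<Longrightarrow> b \<in> F p \<Longrightarrow> c \<in> F p \<Longrightarrow> G p (K a b) c = - G p b (K a c)"
    and "a \<in> F p \<Longrightarrow> b \<in> F p \<Longrightarrow> c \<in> F p \<Longrightarrow> q p (K a b) c + q p (K b c) a + q p (K c a) b = 0"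
proof -
  note K = assms[unfolded so_prolongation_def mem_Collect_eq]
  show mem: "K a b \<in> F p" if "a \<in> F p" "b \<in> F p" for a b using K that by blast
  show "a \<in> F p \<Longrightarrow> linear_on (F p) (K a)" "b \<in> F p \<Longrightarrow> linear_on (F p) (\<lambda>a. K a b)"
    using K by (auto simp: bilinear_on_def)
  show "q p (K a b) c + q p (K b c) a + q p (K c a) b = 0" if "a \<in> F p" "b \<in> F p" "c \<in> F p"
    using K that by blast
  have "G p (K a b) c + G p b (K a c) = 0" if "a \<in> F p" "b \<in> F p" "c \<in> F p" using K that by blast
  then show "a \<in> F p \<Longrightarrow> b \<in> F p \<Longrightarrow> c \<in> F p \<Longrightarrow> G p (K a b) c = - G p b (K a c)" by fastforce
  have "q p (K a b) c + q p b (K a c) = 0" if "a \<in> F p" "b \<in> F p" "c \<in> F p" using K that by blast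
  then show "a \<in> F p \<Longrightarrow> b \<in> F p \<Longrightarrow> c \<in> F p \<Longrightarrow> q p (K a c) b = - q p (K a b) c"
    using q.sym[of b p "K a c"] mem by fastforce
qed

lemma prolongationI:
  assumes mem: "\<And>a b. a \<in> F p \<Longrightarrow> b \<in> F p \<Longrightarrow> K a b \<in> F p"
    and "\<And>a b c. a \<in> F p \<Longrightarrow> b \<in> F p \<Longrightarrow> c \<in> F p \<Longrightarrow> K a (b + c) = K a b + K a c"
    and "\<And>a b c. a \<in> F p \<Longrightarrow> b \<in> F p \<Longrightarrow> c \<in> F p \<Longrightarrow> K (b + c) a = K b a + K c a"
    and "\<And>a b r. a \<in> F p \<Longrightarrow> b \<in> F p \<Longrightarrow> K a (r *\<^sub>R b) = r *\<^sub>R K a b"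
    and "\<And>a b r. a \<in> F p \<Longrightarrow> b \<in> F p \<Longrightarrow> K (r *\<^sub>R a) b = r *\<^sub>R K a b"
    and skew: "\<And>a b c. a \<in> F p \<Longrightarrow> b \<in> F p \<Longrightarrow> c \<in> F p \<Longrightarrow> q p (K a c) b = - q p (K a b) c"
    and G_skew: "\<And>a b c. a \<in> F p \<Longrightarrow> b \<in> F p \<Longrightarrow> c \<in> F p \<Longrightarrow> G p (K a c) b = - G p (K a b) c"
    and cyc: "\<And>a b c. a \<in> F p \<Longrightarrow> b \<in> F p \<Longrightarrow> c \<in> F p \<Longrightarrow> q p (K a b) c + q p (K b c) a + q p (K c a) b = 0"
  shows "K \<in> \<Sigma> p"
  unfolding so_prolongation_def mem_Collect_eq bilinear_on_def
proof (intro conjI ballI linear_onI)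
  fix a b c assume abc: "a \<in> F p" "b \<in> F p" "c \<in> F p"
  show "q p (K a b) c + q p b (K a c) = 0" using skew[OF abc] q.sym[OF abc(2) mem[OF abc(1,3)]] by simp
  show "G p (K a b) c + G p b (K a c) = 0" using G_skew[OF abc] G_sym[OF abc(2) mem[OF abc(1,3)]] by simp
  show "q p (K a b) c + q p (K b c) a + q p (K c a) b = 0" by (rule cyc[OF abc])
qed (simp_all add: assms(1-5))

text \<open>An endomorphism skew for both the pairing and \<open>G\<close> commutes with
  \<open>J\<close>.\<close>

lemma prolongation_eig:
  assumes K: "K \<in> \<Sigma> p" and a: "a \<in> F p" and b: "b \<in> eig s p"
  shows "K a b \<in> eig s p"
proof -
  note b' = eig_fibre[OF b]
  have mem: "K a b \<in> F p" by (rule prolongation(1)[OF K a b'])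
  have "J p (K a b) = s *\<^sub>R K a b"
  proof (rule q.eqI)
    show "J p (K a b) \<in> F p" "s *\<^sub>R K a b \<in> F p" using mem subspace_fibre by (simp_all add: J_mem subspace_scale)
    fix c assume c: "c \<in> F p"
    have "q p (J p (K a b)) c = - G p b (K a c)"
      using J_pair[OF mem c] prolongation(5)[OF K a b' c] by simp
    also have "\<dots> = - s * q p (K a c) b"
      using G_eig[OF b prolongation(1)[OF K a c]] G_sym[OF b' prolongation(1)[OF K a c]] by simp
    also have "\<dots> = q p (s *\<^sub>R K a b) c"
      using prolongation(4)[OF K a b' c] mem c by (simp add: q.scale_left)
    finally show "q p (J p (K a b)) c = q p (s *\<^sub>R K a b) c" .
  qed
  then show ?thesis using mem by (simp add: eig_iff)
qed

lemma eig_zeroI: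
  assumes s: "s \<in> sgns" and x: "x \<in> eig s p" and c: "\<And>c. c \<in> eig s p \<Longrightarrow> q p x c = 0"
  shows "x = 0"
proof (rule q.eqI)
  show "x \<in> F p" "0 \<in> F p" using x subspace_fibre by (auto simp: eig_fibre subspace_0)
  fix y assume y: "y \<in> F p"
  have "q p x y = q p (pr s p x) y" using pr_eq[OF s x] by simp
  also have "\<dots> = q p x (pr s p y)" using x y by (simp add: pr_self_adjoint eig_fibre)
  finally show "q p x y = q p 0 y" using c[OF pr_eig[OF s y]] y by (simp add: q.zero_left)
qed

text \<open>Of the three terms of the cyclic identity two pair opposite eigenbundles and vanish, so
  the third does as well. The prolongation is therefore a sum of one piece for each
  eigenbundle.\<close>

lemma prolongation_mixed:
  assumes K: "K \<in> \<Sigma> p" and s: "s \<in> sgns" and a: "a \<in> eig (- s) p" and b: "b \<in> eig s p"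
  shows "K a b = 0"
proof (rule eig_zeroI[OF s prolongation_eig[OF K eig_fibre[OF a] b]])
  fix c assume c: "c \<in> eig s p"
  note fib = eig_fibre[OF a] eig_fibre[OF b] eig_fibre[OF c]
  have "q p (K b c) a = 0" using eig_orthogonal[OF s prolongation_eig[OF K fib(2) c] a] .
  moreover have "q p (K c a) b = 0"
    using eig_orthogonal[of "- s", OF _ prolongation_eig[OF K fib(3) a]] s b by auto
  ultimately show "q p (K a b) c = 0" using prolongation(6)[OF K fib] by simp
qed

section \<open>The complement of the kernel of the trace map\<close>

text \<open>On each eigenbundle this is the tensor of vectorial type known from metric connections
  with vectorial torsion: the wedge of \<open>z\<close> and \<open>a\<close>, acting on
  \<open>b\<close>.\<close>

definition chi :: "'m \<Rightarrow> 'e \<Rightarrow> 'e \<Rightarrow> 'e \<Rightarrow> 'e" where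
  "chi p z a b = (\<Sum>s\<in>sgns. q p (pr s p a) (pr s p b) *\<^sub>R pr s p z - q p (pr s p z) (pr s p b) *\<^sub>R pr s p a)"

lemma chi_mem: "z \<in> F p \<Longrightarrow> a \<in> F p \<Longrightarrow> b \<in> F p \<Longrightarrow> chi p z a b \<in> F p"
  unfolding chi_def
  by (intro subspace_sum subspace_diff subspace_scale subspace_fibre pr_mem)

lemma pr_chi:
  assumes z: "z \<in> F p" and a: "a \<in> F p" and b: "b \<in> F p" and s: "s \<in> sgns"
  shows "pr s p (chi p z a b) = q p (pr s p a) (pr s p b) *\<^sub>R pr s p z - q p (pr s p z) (pr s p b) *\<^sub>R pr s p a"
proof -
  let ?t = "\<lambda>s. q p (pr s p a) (pr s p b) *\<^sub>R pr s p z - q p (pr s p z) (pr s p b) *\<^sub>R pr s p a"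
  have t: "?t r \<in> F p" for r
    using z a b by (intro subspace_diff subspace_scale subspace_fibre pr_mem)
  have "chi p z a b = ?t s + ?t (- s)" using s by (auto simp: chi_def)
  moreover have "pr s p (?t s) = ?t s" "pr s p (?t (- s)) = 0"
    using pr_pr[OF s] z a b subspace_fibre by (simp_all add: pr_diff pr_scale pr_mem subspace_scale)
  ultimately show ?thesis using pr_add[OF t t, of s s "- s"] by simp
qed

lemma chi_pairing:
  assumes "z \<in> F p" "a \<in> F p" "b \<in> F p" "c \<in> F p"
  shows "q p (chi p z a b) c = (\<Sum>s\<in>sgns. q p (pr s p a) (pr s p b) * q p (pr s p z) (pr s p c)
      - q p (pr s p z) (pr s p b) * q p (pr s p a) (pr s p c))"
    and "G p (chi p z a b) c = (\<Sum>s\<in>sgns. s * (q p (pr s p a) (pr s p b) * q p (pr s p z) (pr s p c)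
      - q p (pr s p z) (pr s p b) * q p (pr s p a) (pr s p c)))"
proof -
  have "q p (pr s p (chi p z a b)) (pr s p c) = q p (pr s p a) (pr s p b) * q p (pr s p z) (pr s p c)
      - q p (pr s p z) (pr s p b) * q p (pr s p a) (pr s p c)" if "s \<in> sgns" for s
    unfolding pr_chi[OF assms(1-3) that]
    using assms subspace_fibre by (simp add: q.diff_left q.scale_left pr_mem subspace_scale)
  then show "q p (chi p z a b) c = (\<Sum>s\<in>sgns. q p (pr s p a) (pr s p b) * q p (pr s p z) (pr s p c)
      - q p (pr s p z) (pr s p b) * q p (pr s p a) (pr s p c))"
    "G p (chi p z a b) c = (\<Sum>s\<in>sgns. s * (q p (pr s p a) (pr s p b) * q p (pr s p z) (pr s p c)
      - q p (pr s p z) (pr s p b) * q p (pr s p a) (pr s p c)))"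
    unfolding pair_split[OF chi_mem[OF assms(1-3)] assms(4)] G_eq[OF chi_mem[OF assms(1-3)] assms(4)]
    by (auto intro!: sum.cong)
qed

lemma pr_pair_sym: "a \<in> F p \<Longrightarrow> b \<in> F p \<Longrightarrow> q p (pr s p a) (pr s p b) = q p (pr s p b) (pr s p a)"
  by (simp add: q.sym pr_mem)

lemma chi_linear:
  assumes z: "z \<in> F p" and a: "a \<in> F p" and b: "b \<in> F p"
  shows "c \<in> F p \<Longrightarrow> chi p z a (b + c) = chi p z a b + chi p z a c"
    and "c \<in> F p \<Longrightarrow> chi p z (a + c) b = chi p z a b + chi p z c b"
    and "chi p z a (r *\<^sub>R b) = r *\<^sub>R chi p z a b"
    and "chi p z (r *\<^sub>R a) b = r *\<^sub>R chi p z a b"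
  using assms
  by (simp_all add: chi_def pr_add pr_scale q.add_left q.add_right q.scale_left q.scale_right pr_mem algebra_simps)

lemma chi_prolongation:
  assumes z: "z \<in> F p" shows "chi p z \<in> \<Sigma> p"
proof (rule prolongationI)
  fix a b c assume abc: "a \<in> F p" "b \<in> F p" "c \<in> F p"
  note sym = pr_pair_sym[OF abc(2,1)] pr_pair_sym[OF abc(3,1)] pr_pair_sym[OF abc(3,2)]
  show "q p (chi p z a c) b = - q p (chi p z a b) c"
    using abc z by (simp add: chi_pairing algebra_simps)
  show "G p (chi p z a c) b = - G p (chi p z a b) c"
    using abc z by (simp add: chi_pairing algebra_simps)
  show "q p (chi p z a b) c + q p (chi p z b c) a + q p (chi p z c a) b = 0"
    using abc z by (simp add: chi_pairing sym algebra_simps)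
qed (use z in \<open>auto simp: chi_mem chi_linear\<close>)

text \<open>The projection factors through the tangent space as lift after anchor; in the opposite
  order the composition is the identity.\<close>

lemma trace_pr:
  assumes s: "s \<in> sgns"
  shows "trace_on (F p) (pr s p) = card (some_basis (T p))"
proof -
  have "trace_on (F p) (pr s p) = trace_on (F p) (\<lambda>a. lft s p (\<pi> p (pr s p a)))"
    by (rule q.trace_on_cong) (simp add: lift_anchor[OF s pr_eig[OF s]])
  also have "\<dots> = trace_on (T p) (\<lambda>x. \<pi> p (pr s p (lft s p x)))"
    by (rule trace_on_comp_commute[OF findim_fibre findim_tangent _ _ lift_linear[OF s] lift_mem[OF s]])
      (auto intro!: linear_onI simp: pr_add pr_scale anchor_add anchor_scale pr_mem anchor_mem)
  also have "\<dots> = trace_on (T p) (\<lambda>x. x)"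
    by (rule T.trace_on_cong) (use s in \<open>simp add: pr_lift anchor_lift\<close>)
  finally show ?thesis by (simp add: T.trace_on_id)
qed

text \<open>The identity is the sum of the two projections. The equation ties the dimension of each
  tangent space to the constant \<open>rk E\<close>, which lets 1 / (1 - n) be a constant scalar for
  sections.\<close>

lemma rank_eq: "2 * card (some_basis (T p)) = rk E"
proof -
  obtain U e where U: "(U, e) \<in> frames E" "p \<in> U" by (rule frame_at)
  have "trace_on (F p) (\<lambda>a. a) = (\<Sum>i<rk E. frame_coef e p (e i p) i)"
    using coef_sum[OF U] frame_mem[OF U] linear_on_coef[OF U]
    by (intro q.trace_on_family[where eps = "\<lambda>i x. frame_coef e p x i"])
      (auto simp: linear_on_def[of "F p" "\<lambda>a. a"])
  also have "\<dots> = (\<Sum>i<rk E. 1)"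
  proof (intro sum.cong refl)
    fix i assume "i \<in> {..<rk E}"
    then show "frame_coef e p (e i p) i = 1"
      using coef_eqI[OF U, of "e i p" "\<lambda>j. if j = i then 1 else 0" i]
      by (simp add: if_distrib[of "\<lambda>c. c *\<^sub>R _"] cong: if_cong)
  qed
  finally have "trace_on (F p) (\<lambda>a. a) = rk E" by simp
  moreover have "trace_on (F p) (\<lambda>a. a) = trace_on (F p) (\<lambda>a. pr 1 p a + pr (- 1) p a)"
    by (simp add: pr_sum)
  ultimately have "real (rk E) = 2 * card (some_basis (T p))"
    using q.trace_on_add[of p "pr 1 p" "pr (- 1) p"] trace_pr[of 1 p] trace_pr[of "- 1" p] by (simp add: pr_mem)
  then show ?thesis by linarith
qed

abbreviation "n \<equiv> real (rk E) / 2"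

text \<open>On each eigenbundle the first term is a rank-one map in \<open>a\<close> with trace the
  pairing of \<open>z\<close> and \<open>b\<close>; the second is minus this pairing times the
  projection, whose trace is n.\<close>

lemma trace_chi:
  assumes z: "z \<in> F p" and b: "b \<in> F p"
  shows "trace_map E p (chi p z) b = (1 - n) * q p z b"
proof -
  let ?t = "\<lambda>s a. q p (pr s p a) (pr s p b) *\<^sub>R pr s p z + (- q p (pr s p z) (pr s p b)) *\<^sub>R pr s p a"
  have mem: "?t s a \<in> F p" if "a \<in> F p" for s a
    using that z by (intro subspace_add subspace_scale subspace_fibre pr_mem)
  have tr: "trace_on (F p) (?t s) = (1 - n) * q p (pr s p z) (pr s p b)" if s: "s \<in> sgns" for s
  proof -
    have "trace_on (F p) (?t s) = trace_on (F p) (\<lambda>a. q p (pr s p a) (pr s p b) *\<^sub>R pr s p z)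
        + trace_on (F p) (\<lambda>a. (- q p (pr s p z) (pr s p b)) *\<^sub>R pr s p a)"
      using z by (intro q.trace_on_add subspace_scale subspace_fibre pr_mem)
    also have "trace_on (F p) (\<lambda>a. q p (pr s p a) (pr s p b) *\<^sub>R pr s p z) = q p (pr s p (pr s p z)) (pr s p b)"
      using z b by (intro q.trace_on_rank_one pr_mem linear_onI)
        (auto simp: pr_add pr_scale q.add_left q.scale_left pr_mem)
    also have "trace_on (F p) (\<lambda>a. (- q p (pr s p z) (pr s p b)) *\<^sub>R pr s p a) = - q p (pr s p z) (pr s p b) * n"
      using trace_pr[OF s, of p] rank_eq[of p, symmetric] by (subst q.trace_on_scale) (auto simp: pr_mem)
    finally show ?thesis using pr_pr(1)[OF s z] by (simp add: algebra_simps)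
  qed
  have "trace_map E p (chi p z) b = trace_on (F p) (\<lambda>a. \<Sum>s\<in>sgns. ?t s a)"
    unfolding trace_map_def chi_def by simp
  also have "\<dots> = (\<Sum>s\<in>sgns. trace_on (F p) (?t s))"
    by (rule q.trace_on_sum) (use mem in auto)
  also have "\<dots> = (1 - n) * q p z b"
    unfolding pair_split[OF z b] sum_distrib_left by (intro sum.cong refl tr)
  finally show ?thesis .
qed

text \<open>
  A basis and its dual basis form such a pair in either order; the two orders give the two
  arguments of \<^const>\<open>tensor_product\<close> the same role.
\<close>

definition dual_pair :: "'m \<Rightarrow> ('e \<Rightarrow> 'e) \<Rightarrow> ('e \<Rightarrow> 'e) \<Rightarrow> bool" where
  "dual_pair p e f \<longleftrightarrow> (\<forall>a\<in>some_basis (F p). e a \<in> F p \<and> f a \<in> F p) \<and>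
     (\<forall>x\<in>F p. x = (\<Sum>a\<in>some_basis (F p). q p (e a) x *\<^sub>R f a)) \<and>
     (\<forall>h. linear_on (F p) h \<longrightarrow> (\<forall>x\<in>F p. h x \<in> F p) \<longrightarrow>
       trace_on (F p) h = (\<Sum>a\<in>some_basis (F p). q p (e a) (h (f a))))"

definition contraction :: "'m \<Rightarrow> ('e \<Rightarrow> 'e) \<Rightarrow> ('e \<Rightarrow> 'e) \<Rightarrow> ('e \<Rightarrow> 'e \<Rightarrow> 'e) \<Rightarrow> ('e \<Rightarrow> 'e \<Rightarrow> 'e) \<Rightarrow> real" where
  "contraction p e f S K = (\<Sum>a\<in>some_basis (F p). \<Sum>b\<in>some_basis (F p). q p (S (e a) (e b)) (K (f a) (f b)))"

lemma dual_pair_basis: "dual_pair p (\<lambda>a. a) (q.dual p)" "dual_pair p (q.dual p) (\<lambda>a. a)"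
  unfolding dual_pair_def
  using q.expand_basis[of _ p] q.expand_dual[of _ p] q.trace_eq_basis[of p] q.trace_eq_dual[of p]
  by (auto simp: q.some_basis_mem q.dual(1))

lemma tensor_product_eq: "tensor_product E p S K = contraction p (\<lambda>a. a) (q.dual p) S K"
  by (simp add: tensor_product_def contraction_def Let_def q.dual_def)

lemma contraction_swap:
  assumes "S \<in> \<Sigma> p" "K \<in> \<Sigma> p"
  shows "contraction p (\<lambda>a. a) (q.dual p) S K = contraction p (q.dual p) (\<lambda>a. a) K S"
  unfolding contraction_def
  by (intro sum.cong refl q.sym prolongation(1)[OF assms(1)] prolongation(1)[OF assms(2)])
    (auto simp: q.some_basis_mem q.dual(1))

lemma dual_pair_mem: "dual_pair p e f \<Longrightarrow> a \<in> some_basis (F p) \<Longrightarrow> e a \<in> F p \<and> f a \<in> F p"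
  and dual_pair_expand: "dual_pair p e f \<Longrightarrow> x \<in> F p \<Longrightarrow> (\<Sum>a\<in>some_basis (F p). q p (e a) x *\<^sub>R f a) = x"
  and dual_pair_trace: "dual_pair p e f \<Longrightarrow> linear_on (F p) h \<Longrightarrow> (\<And>x. x \<in> F p \<Longrightarrow> h x \<in> F p)
    \<Longrightarrow> (\<Sum>a\<in>some_basis (F p). q p (e a) (h (f a))) = trace_on (F p) h"
  by (auto simp: dual_pair_def)

lemma contract_basis:
  assumes ef: "dual_pair p e f" and h: "linear_on (F p) h" and x: "x \<in> F p"
  shows "(\<Sum>b\<in>some_basis (F p). q p x (e b) * h (f b)) = h x"
proof -
  have "(\<Sum>b\<in>some_basis (F p). q p x (e b) * h (f b)) = (\<Sum>b\<in>some_basis (F p). q p (e b) x *\<^sub>R h (f b))"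
    using dual_pair_mem[OF ef] x by (intro sum.cong) (auto simp: q.sym)
  also have "\<dots> = h (\<Sum>b\<in>some_basis (F p). q p (e b) x *\<^sub>R f b)"
    using dual_pair_mem[OF ef] by (intro linear_on_lincomb[OF h subspace_fibre, symmetric]) auto
  finally show ?thesis unfolding dual_pair_expand[OF ef x] .
qed

lemma linear_on_pair: "linear_on V h \<Longrightarrow> (\<And>x. x \<in> V \<Longrightarrow> h x \<in> F p) \<Longrightarrow> c \<in> F p \<Longrightarrow> linear_on V (\<lambda>x. q p c (h x))"
  by (intro linear_onI) (auto simp: linear_on_add linear_on_scale q.add_right q.scale_right)

text \<open>Summing over the second index turns both terms of \<chi> into evaluations of
  \<open>K\<close>. They are equal because \<open>K\<close> is skew, which produces the factor 2;
  since \<open>K\<close> preserves eigenbundles the projections recombine, and the remaining sum is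
  the trace of \<open>K\<close>.\<close>

lemma contraction_chi:
  assumes ef: "dual_pair p e f" and K: "K \<in> \<Sigma> p" and z: "z \<in> F p"
  shows "contraction p e f (chi p z) K = - 2 * trace_map E p K z"
proof -
  let ?B = "some_basis (F p)"
  note mem = dual_pair_mem[OF ef] and Km = prolongation(1)[OF K]
  have fixed_a: "(\<Sum>b\<in>?B. q p (chi p z (e a) (e b)) (K (f a) (f b))) = - 2 * q p (e a) (K (f a) z)" if a: "a \<in> ?B" for a
  proof -
    have ea: "e a \<in> F p" and fa: "f a \<in> F p" using mem[OF a] by auto
    have lin: "linear_on (F p) (\<lambda>x. q p c (K (f a) x))" if "c \<in> F p" for c
      by (rule linear_on_pair[OF prolongation(2)[OF K fa] Km[OF fa] that])
    have "(\<Sum>b\<in>?B. q p (chi p z (e a) (e b)) (K (f a) (f b)))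
      = (\<Sum>b\<in>?B. \<Sum>s\<in>sgns. q p (pr s p (e a)) (e b) * q p (pr s p z) (K (f a) (f b))
          - q p (pr s p z) (e b) * q p (pr s p (e a)) (K (f a) (f b)))"
      using mem ea fa z by (intro sum.cong refl) (auto simp: chi_pairing Km pr_pair)
    also have "\<dots> = (\<Sum>s\<in>sgns. (\<Sum>b\<in>?B. q p (pr s p (e a)) (e b) * q p (pr s p z) (K (f a) (f b)))
          - (\<Sum>b\<in>?B. q p (pr s p z) (e b) * q p (pr s p (e a)) (K (f a) (f b))))"
      by (subst sum.swap) (simp only: sum_subtractf)
    also have "\<dots> = (\<Sum>s\<in>sgns. q p (pr s p z) (K (f a) (pr s p (e a))) - q p (pr s p (e a)) (K (f a) (pr s p z)))"
      using z ea by (intro sum.cong refl) (simp only: contract_basis[OF ef lin] pr_mem)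
    also have "\<dots> = (\<Sum>s\<in>sgns. - 2 * q p (e a) (K (f a) (pr s p z)))"
    proof (intro sum.cong refl)
      fix s assume s: "s \<in> sgns"
      note zs = pr_mem[OF z, of s] and es = pr_mem[OF ea, of s]
      have "q p (pr s p z) (K (f a) (pr s p (e a))) = - q p (pr s p (e a)) (K (f a) (pr s p z))"
        using prolongation(4)[OF K fa zs es] q.sym[OF zs Km[OF fa es]] q.sym[OF es Km[OF fa zs]] by simp
      moreover have "q p (pr s p (e a)) (K (f a) (pr s p z)) = q p (e a) (K (f a) (pr s p z))"
        using pr_self_adjoint[OF ea Km[OF fa zs]] pr_eq[OF s prolongation_eig[OF K fa pr_eig[OF s z]]] by simp
      ultimately show "q p (pr s p z) (K (f a) (pr s p (e a))) - q p (pr s p (e a)) (K (f a) (pr s p z))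
        = - 2 * q p (e a) (K (f a) (pr s p z))" by simp
    qed
    also have "\<dots> = - 2 * q p (e a) (K (f a) (pr 1 p z + pr (- 1) p z))"
      using linear_on_add[OF lin[OF ea] pr_mem[OF z] pr_mem[OF z], of 1 "- 1"] by simp
    finally show ?thesis by (simp add: pr_sum)
  qed
  have "contraction p e f (chi p z) K = - 2 * (\<Sum>a\<in>?B. q p (e a) (K (f a) z))"
    unfolding contraction_def sum_distrib_left by (intro sum.cong refl fixed_a)
  also have "(\<Sum>a\<in>?B. q p (e a) (K (f a) z)) = trace_map E p K z"
    unfolding trace_map_def by (rule dual_pair_trace[OF ef prolongation(3)[OF K z] Km[OF _ z]])
  finally show ?thesis .
qed

text \<open>
  Three times the projection of the decomposable tensor \<open>\<alpha> \<otimes> \<beta> \<otimes> \<gamma>\<close> to the prolongation: skew-symmetrise in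
  the last two arguments, then remove the totally skew part.
\<close>

definition test_tensor :: "'m \<Rightarrow> 'e \<Rightarrow> 'e \<Rightarrow> 'e \<Rightarrow> 'e \<Rightarrow> 'e \<Rightarrow> 'e" where
  "test_tensor p \<alpha> \<beta> \<gamma> u v =
     (2 * q p \<alpha> u * q p \<beta> v + q p \<beta> u * q p \<alpha> v) *\<^sub>R \<gamma>
     - (2 * q p \<alpha> u * q p \<gamma> v + q p \<gamma> u * q p \<alpha> v) *\<^sub>R \<beta>
     + (q p \<gamma> u * q p \<beta> v - q p \<beta> u * q p \<gamma> v) *\<^sub>R \<alpha>"

lemma test_tensor_pairing:
  assumes "\<alpha> \<in> F p" "\<beta> \<in> F p" "\<gamma> \<in> F p" "w \<in> F p"
  shows "q p (test_tensor p \<alpha> \<beta> \<gamma> u v) w =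
     (2 * q p \<alpha> u * q p \<beta> v + q p \<beta> u * q p \<alpha> v) * q p \<gamma> w
     - (2 * q p \<alpha> u * q p \<gamma> v + q p \<gamma> u * q p \<alpha> v) * q p \<beta> w
     + (q p \<gamma> u * q p \<beta> v - q p \<beta> u * q p \<gamma> v) * q p \<alpha> w"
  using assms subspace_fibre unfolding test_tensor_def
  by (simp only: q.add_left q.diff_left q.scale_left subspace_add subspace_diff subspace_scale)

lemma test_tensor_prolongation:
  assumes s: "s \<in> sgns" and abc: "\<alpha> \<in> eig s p" "\<beta> \<in> eig s p" "\<gamma> \<in> eig s p"
  shows "test_tensor p \<alpha> \<beta> \<gamma> \<in> \<Sigma> p"
proof -
  note fib = abc[THEN eig_fibre]
  have e: "test_tensor p \<alpha> \<beta> \<gamma> u v \<in> eig s p" for u v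
    unfolding test_tensor_def by (intro subspace_add subspace_diff subspace_scale subspace_eig abc)
  note pairing = test_tensor_pairing[OF fib]
  have Gp: "G p (test_tensor p \<alpha> \<beta> \<gamma> u v) w = s * q p (test_tensor p \<alpha> \<beta> \<gamma> u v) w" if "w \<in> F p" for u v w
    using G_eig[OF e that] G_sym[OF eig_fibre[OF e] that] q.sym[OF eig_fibre[OF e] that] by simp
  have skew: "q p (test_tensor p \<alpha> \<beta> \<gamma> u w) v = - q p (test_tensor p \<alpha> \<beta> \<gamma> u v) w"
    if "v \<in> F p" "w \<in> F p" for u v w
    unfolding pairing[OF that(1)] pairing[OF that(2)] by (simp add: algebra_simps)
  \<comment> \<open>\<open>a1\<close> to \<open>c3\<close> stand for the pairings of the three given
    vectors with the three arguments; the cyclic condition becomes a polynomial identity.\<close>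
  have cyclic: "((2 * a1 * b2 + b1 * a2) * c3 - (2 * a1 * c2 + c1 * a2) * b3 + (c1 * b2 - b1 * c2) * a3)
    + ((2 * a2 * b3 + b2 * a3) * c1 - (2 * a2 * c3 + c2 * a3) * b1 + (c2 * b3 - b2 * c3) * a1)
    + ((2 * a3 * b1 + b3 * a1) * c2 - (2 * a3 * c1 + c3 * a1) * b2 + (c3 * b1 - b3 * c1) * a2) = 0"
    for a1 a2 a3 b1 b2 b3 c1 c2 c3 :: real
    by (simp add: algebra_simps)
  have lin: "linear_on (F p) (test_tensor p \<alpha> \<beta> \<gamma> u)" "linear_on (F p) (\<lambda>u. test_tensor p \<alpha> \<beta> \<gamma> u v)" for u v
    unfolding test_tensor_def[abs_def]
    by (intro linear_on_fun_add linear_on_fun_diff linear_on_scaleR_left linear_on_mult_left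
        linear_on_mult_right q.q_right fib)+
  show ?thesis
  proof (rule prolongationI)
    fix a b c assume abc: "a \<in> F p" "b \<in> F p" "c \<in> F p"
    show "test_tensor p \<alpha> \<beta> \<gamma> a (b + c) = test_tensor p \<alpha> \<beta> \<gamma> a b + test_tensor p \<alpha> \<beta> \<gamma> a c"
      by (rule linear_on_add[OF lin(1) abc(2,3)])
    show "test_tensor p \<alpha> \<beta> \<gamma> (b + c) a = test_tensor p \<alpha> \<beta> \<gamma> b a + test_tensor p \<alpha> \<beta> \<gamma> c a"
      by (rule linear_on_add[OF lin(2) abc(2,3)])
    show "G p (test_tensor p \<alpha> \<beta> \<gamma> a c) b = - G p (test_tensor p \<alpha> \<beta> \<gamma> a b) c"
      unfolding Gp[OF abc(2)] Gp[OF abc(3)] skew[OF abc(2,3)] by simp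
    show "q p (test_tensor p \<alpha> \<beta> \<gamma> a c) b = - q p (test_tensor p \<alpha> \<beta> \<gamma> a b) c"
      by (rule skew[OF abc(2,3)])
    show "q p (test_tensor p \<alpha> \<beta> \<gamma> a b) c + q p (test_tensor p \<alpha> \<beta> \<gamma> b c) a + q p (test_tensor p \<alpha> \<beta> \<gamma> c a) b = 0"
      unfolding pairing[OF abc(1)] pairing[OF abc(2)] pairing[OF abc(3)] by (rule cyclic)
  next
    fix a b r assume ab: "a \<in> F p" "b \<in> F p"
    show "test_tensor p \<alpha> \<beta> \<gamma> a (r *\<^sub>R b) = r *\<^sub>R test_tensor p \<alpha> \<beta> \<gamma> a b"
      by (rule linear_on_scale[OF lin(1) ab(2)])
    show "test_tensor p \<alpha> \<beta> \<gamma> (r *\<^sub>R a) b = r *\<^sub>R test_tensor p \<alpha> \<beta> \<gamma> a b"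
      by (rule linear_on_scale[OF lin(2) ab(1)])
  qed (rule eig_fibre[OF e])
qed

text \<open>Contracting a decomposable tensor with \<open>K\<close> evaluates \<open>K\<close>.
  Skewness of \<open>K\<close> combines the six evaluations into 4 times the wanted one minus 2
  times its two cyclic shifts, and the cyclic identity turns the latter into 2 more.\<close>

lemma contraction_test_tensor:
  assumes ef: "dual_pair p e f" and K: "K \<in> \<Sigma> p" and abc: "\<alpha> \<in> F p" "\<beta> \<in> F p" "\<gamma> \<in> F p"
  shows "contraction p e f (test_tensor p \<alpha> \<beta> \<gamma>) K = 6 * q p (K \<alpha> \<beta>) \<gamma>"
proof -
  let ?B = "some_basis (F p)"
  note mem = dual_pair_mem[OF ef] and Km = prolongation(1)[OF K]
  let ?k = "\<lambda>x y z. q p z (K x y)"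
  have contract: "(\<Sum>a\<in>?B. \<Sum>b\<in>?B. q p x (e a) * q p y (e b) * ?k (f a) (f b) z) = ?k x y z"
    if "x \<in> F p" "y \<in> F p" "z \<in> F p" for x y z
  proof -
    have "(\<Sum>a\<in>?B. \<Sum>b\<in>?B. q p x (e a) * q p y (e b) * ?k (f a) (f b) z) = (\<Sum>a\<in>?B. q p x (e a) * ?k (f a) y z)"
    proof (intro sum.cong refl)
      fix a assume "a \<in> ?B"
      then have fa: "f a \<in> F p" using mem by blast
      have "(\<Sum>b\<in>?B. q p y (e b) * ?k (f a) (f b) z) = ?k (f a) y z"
        by (rule contract_basis[OF ef linear_on_pair[OF prolongation(2)[OF K fa] Km[OF fa] that(3)] that(2)])
      then show "(\<Sum>b\<in>?B. q p x (e a) * q p y (e b) * ?k (f a) (f b) z) = q p x (e a) * ?k (f a) y z"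
        by (simp only: mult.assoc flip: sum_distrib_left)
    qed
    also have "\<dots> = ?k x y z"
      by (rule contract_basis[OF ef linear_on_pair[OF prolongation(3)[OF K that(2)] Km[OF _ that(2)] that(3)] that(1)])
    finally show ?thesis .
  qed
  let ?t = "\<lambda>x y z a b. q p x (e a) * q p y (e b) * ?k (f a) (f b) z"
  have "contraction p e f (test_tensor p \<alpha> \<beta> \<gamma>) K = (\<Sum>a\<in>?B. \<Sum>b\<in>?B.
      2 * ?t \<alpha> \<beta> \<gamma> a b + ?t \<beta> \<alpha> \<gamma> a b - 2 * ?t \<alpha> \<gamma> \<beta> a b - ?t \<gamma> \<alpha> \<beta> a b
      + ?t \<gamma> \<beta> \<alpha> a b - ?t \<beta> \<gamma> \<alpha> a b)"
    unfolding contraction_def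
  proof (intro sum.cong refl)
    fix a b assume "a \<in> ?B" "b \<in> ?B"
    then have "K (f a) (f b) \<in> F p" using mem Km by blast
    then show "q p (test_tensor p \<alpha> \<beta> \<gamma> (e a) (e b)) (K (f a) (f b))
      = 2 * ?t \<alpha> \<beta> \<gamma> a b + ?t \<beta> \<alpha> \<gamma> a b - 2 * ?t \<alpha> \<gamma> \<beta> a b - ?t \<gamma> \<alpha> \<beta> a b
      + ?t \<gamma> \<beta> \<alpha> a b - ?t \<beta> \<gamma> \<alpha> a b"
      by (simp only: test_tensor_pairing[OF abc]) (simp only: ring_distribs mult_ac)
  qed
  also have "\<dots> = 2 * ?k \<alpha> \<beta> \<gamma> + ?k \<beta> \<alpha> \<gamma> - 2 * ?k \<alpha> \<gamma> \<beta> - ?k \<gamma> \<alpha> \<beta> + ?k \<gamma> \<beta> \<alpha> - ?k \<beta> \<gamma> \<alpha>"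
    by (simp only: sum.distrib sum_subtractf contract abc flip: sum_distrib_left)
  also have "\<dots> = 6 * q p (K \<alpha> \<beta>) \<gamma>"
  proof -
    have sym: "?k x y z = q p (K x y) z" if "x \<in> F p" "y \<in> F p" "z \<in> F p" for x y z
      using that by (simp add: q.sym Km)
    show ?thesis
      using prolongation(4)[OF K abc] prolongation(4)[OF K abc(2,1,3)] prolongation(4)[OF K abc(3,1,2)]
        prolongation(6)[OF K abc] abc by (simp add: sym)
  qed
  finally show ?thesis .
qed

text \<open>Test tensors detect all components of \<open>K\<close> within one eigenbundle; the
  components with arguments in opposite eigenbundles are zero for every element of the
  prolongation.\<close>

lemma contraction_nondegenerate:
  assumes ef: "dual_pair p e f" and K: "K \<in> \<Sigma> p"
    and perp: "\<And>L. L \<in> \<Sigma> p \<Longrightarrow> contraction p e f L K = 0"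
    and ab: "a \<in> F p" "b \<in> F p"
  shows "K a b = 0"
proof -
  have pure: "K x y = 0" if s: "s \<in> sgns" and xy: "x \<in> eig s p" "y \<in> eig s p" for s x y
  proof (rule eig_zeroI[OF s prolongation_eig[OF K eig_fibre[OF xy(1)] xy(2)]])
    fix c assume c: "c \<in> eig s p"
    show "q p (K x y) c = 0"
      using contraction_test_tensor[OF ef K eig_fibre[OF xy(1)] eig_fibre[OF xy(2)] eig_fibre[OF c]]
        perp[OF test_tensor_prolongation[OF s xy c]] by simp
  qed
  have zero: "K (pr s p a) (pr t p b) = 0" if "s \<in> sgns" "t \<in> sgns" for s t
  proof (cases "s = t")
    case True
    then show ?thesis using pure that ab by (simp add: pr_eig)
  next
    case False
    then have "s = - t" using that by auto
    then show ?thesis using prolongation_mixed[OF K that(2)] pr_eig that ab by auto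
  qed
  have "K a b = K (pr 1 p a + pr (- 1) p a) (pr 1 p b + pr (- 1) p b)" by (simp add: pr_sum)
  also have "\<dots> = 0"
    using zero ab subspace_fibre
    by (simp add: linear_on_add[OF prolongation(2)[OF K]] linear_on_add[OF prolongation(3)[OF K]] pr_mem subspace_add)
  finally show ?thesis .
qed

lemma prolongation_diff:
  assumes K: "K \<in> \<Sigma> p" and L: "L \<in> \<Sigma> p"
  shows "(\<lambda>a b. K a b - L a b) \<in> \<Sigma> p"
proof (rule prolongationI)
  note KL = prolongation[OF K] prolongation[OF L]
  show "K a b - L a b \<in> F p" if "a \<in> F p" "b \<in> F p" for a b
    using KL(1,7) that subspace_fibre by (simp add: subspace_diff)
  fix a b c assume abc: "a \<in> F p" "b \<in> F p" "c \<in> F p"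
  show "K a (b + c) - L a (b + c) = K a b - L a b + (K a c - L a c)"
    using linear_on_add[OF KL(2)[OF abc(1)] abc(2,3)] linear_on_add[OF KL(8)[OF abc(1)] abc(2,3)] by simp
  show "K (b + c) a - L (b + c) a = K b a - L b a + (K c a - L c a)"
    using linear_on_add[OF KL(3)[OF abc(1)] abc(2,3)] linear_on_add[OF KL(9)[OF abc(1)] abc(2,3)] by simp
  show "q p (K a c - L a c) b = - q p (K a b - L a b) c"
    using KL(4)[OF abc] KL(10)[OF abc] KL(1,7)[OF abc(1,2)] KL(1,7)[OF abc(1,3)] abc
    by (simp add: q.diff_left)
  show "q p (K a b - L a b) c + q p (K b c - L b c) a + q p (K c a - L c a) b = 0"
    using KL(6)[OF abc] KL(12)[OF abc] KL(1,7) abc by (simp add: q.diff_left)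
  show "G p (K a c - L a c) b = - G p (K a b - L a b) c"
  proof -
    have Gd: "G p (x - y) w = G p x w - G p y w" if "x \<in> F p" "y \<in> F p" "w \<in> F p" for x y w
      using linear_on_diff[OF bilinear_onD(2)[OF G_bilinear that(3)] subspace_fibre that(1,2)] .
    have "G p (K a c) b = - G p (K a b) c"
      using KL(5)[OF abc(1,3,2)] G_sym[OF abc(3) KL(1)[OF abc(1,2)]] by simp
    moreover have "G p (L a c) b = - G p (L a b) c"
      using KL(11)[OF abc(1,3,2)] G_sym[OF abc(3) KL(7)[OF abc(1,2)]] by simp
    ultimately show ?thesis using KL(1,7) abc by (simp add: Gd)
  qed
next
  note KL = prolongation[OF K] prolongation[OF L]
  fix a b r assume ab: "a \<in> F p" "b \<in> F p"
  show "K a (r *\<^sub>R b) - L a (r *\<^sub>R b) = r *\<^sub>R (K a b - L a b)"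
    using linear_on_scale[OF KL(2)[OF ab(1)] ab(2)] linear_on_scale[OF KL(8)[OF ab(1)] ab(2)]
    by (simp add: scaleR_diff_right)
  show "K (r *\<^sub>R a) b - L (r *\<^sub>R a) b = r *\<^sub>R (K a b - L a b)"
    using linear_on_scale[OF KL(3)[OF ab(2)] ab(1)] linear_on_scale[OF KL(9)[OF ab(2)] ab(1)]
    by (simp add: scaleR_diff_right)
qed

lemma trace_map_diff:
  assumes K: "K \<in> \<Sigma> p" and L: "L \<in> \<Sigma> p" and b: "b \<in> F p"
  shows "trace_map E p (\<lambda>a b. K a b - L a b) b = trace_map E p K b - trace_map E p L b"
proof -
  have "trace_on (F p) (\<lambda>a. (K a b - L a b) + L a b) = trace_on (F p) (\<lambda>a. K a b - L a b) + trace_on (F p) (\<lambda>a. L a b)"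
    by (rule q.trace_on_add) (auto intro: prolongation(1)[OF prolongation_diff[OF K L]] prolongation(1)[OF L] b)
  then show ?thesis by (simp add: trace_map_def)
qed

lemma tensor_product_diff_left:
  assumes "S \<in> \<Sigma> p" "S' \<in> \<Sigma> p" "K \<in> \<Sigma> p"
  shows "tensor_product E p (\<lambda>a b. S a b - S' a b) K = tensor_product E p S K - tensor_product E p S' K"
  unfolding tensor_product_eq contraction_def sum_subtractf[symmetric]
  by (intro sum.cong refl) (simp add: q.diff_left prolongation(1)[OF assms(1)] prolongation(1)[OF assms(2)]
      prolongation(1)[OF assms(3)] q.some_basis_mem q.dual(1))

lemma tensor_product_diff_right:
  assumes "S \<in> \<Sigma> p" "K \<in> \<Sigma> p" "K' \<in> \<Sigma> p"
  shows "tensor_product E p S (\<lambda>a b. K a b - K' a b) = tensor_product E p S K - tensor_product E p S K'"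
  unfolding tensor_product_eq contraction_def sum_subtractf[symmetric]
  by (intro sum.cong refl) (simp add: q.diff_right prolongation(1)[OF assms(1)] prolongation(1)[OF assms(2)]
      prolongation(1)[OF assms(3)] q.some_basis_mem q.dual(1))

text \<open>Any \<open>L\<close> in the prolongation differs from a suitable \<chi> by an element of
  the kernel. \<open>K\<close> is perpendicular to the kernel by assumption and to \<chi> because
  its own trace vanishes, hence to every \<open>L\<close>.\<close>

lemma kernel_perp_zero:
  assumes n: "n \<noteq> 1" and K: "K \<in> trace_kernel E G p"
    and perp: "\<And>L. L \<in> trace_kernel E G p \<Longrightarrow> tensor_product E p K L = 0"
    and ab: "a \<in> F p" "b \<in> F p"
  shows "K a b = 0"
proof -
  have KS: "K \<in> \<Sigma> p" and trK: "\<And>b. b \<in> F p \<Longrightarrow> trace_map E p K b = 0"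
    using K by (auto simp: trace_kernel_def)
  show ?thesis
  proof (rule contraction_nondegenerate[OF dual_pair_basis(2) KS _ ab])
    fix L assume L: "L \<in> \<Sigma> p"
    \<comment> \<open>The representative \<open>z\<close> of this functional makes the trace of
      \<open>chi p z\<close> equal to that of \<open>L\<close>; this is where 1 - n must be
      invertible.\<close>
    have lin: "linear_on (F p) (\<lambda>b. trace_map E p L b / (1 - n))"
    proof (rule linear_onI)
      fix x y r assume xy: "x \<in> F p" "y \<in> F p"
      have "trace_map E p L (x + y) = trace_on (F p) (\<lambda>a. L a x + L a y)"
        unfolding trace_map_def
        by (rule q.trace_on_cong) (use linear_on_add[OF prolongation(2)[OF L] xy] in auto)
      then show "trace_map E p L (x + y) / (1 - n) = trace_map E p L x / (1 - n) + trace_map E p L y / (1 - n)"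
        using q.trace_on_add[of p "\<lambda>a. L a x" "\<lambda>a. L a y"] prolongation(1)[OF L] xy
        by (simp add: trace_map_def add_divide_distrib)
    next
      fix x r assume x: "x \<in> F p"
      have "trace_map E p L (r *\<^sub>R x) = trace_on (F p) (\<lambda>a. r *\<^sub>R L a x)"
        unfolding trace_map_def
        by (rule q.trace_on_cong) (use linear_on_scale[OF prolongation(2)[OF L] x] in auto)
      then show "trace_map E p L (r *\<^sub>R x) / (1 - n) = r *\<^sub>R (trace_map E p L x / (1 - n))"
        using q.trace_on_scale[of p "\<lambda>a. L a x" r] prolongation(1)[OF L] x by (simp add: trace_map_def)
    qed
    obtain z where z: "z \<in> F p" "\<And>b. b \<in> F p \<Longrightarrow> q p z b = trace_map E p L b / (1 - n)"
      using q.riesz[OF lin] by blast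
    note chi = chi_prolongation[OF z(1)]
    have "(\<lambda>a b. L a b - chi p z a b) \<in> trace_kernel E G p"
      using prolongation_diff[OF L chi] trace_map_diff[OF L chi] trace_chi[OF z(1)] z(2) n
      by (auto simp: trace_kernel_def)
    then have "tensor_product E p K L = tensor_product E p K (chi p z)"
      using perp tensor_product_diff_right[OF KS L chi] by fastforce
    also have "\<dots> = contraction p (q.dual p) (\<lambda>a. a) (chi p z) K"
      unfolding tensor_product_eq by (rule contraction_swap[OF KS chi])
    also have "\<dots> = 0"
      unfolding contraction_chi[OF dual_pair_basis(2) KS z(1)] using trK[OF z(1)] by simp
    finally show "contraction p (q.dual p) (\<lambda>a. a) L K = 0"
      unfolding tensor_product_eq contraction_swap[OF KS L] .
  qed
qed

section \<open>The canonical connection\<close>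

lemma divergence_difference:
  assumes D: "generalised_connection E D" and S: "difference_tensor E D D0 S" "S p \<in> \<Sigma> p" and v: "v \<in> \<Gamma>"
  shows "divergence_of E D v p = metric_divergence E G v p + trace_map E p (S p) (v p)"
proof -
  note t = tensorial_connection[OF D v] tensorial_connection[OF D_zero_connection v]
  note vp = section_fibre[OF v, of p]
  have eq: "value_at \<Gamma> (\<lambda>u. D u v) p a = value_at \<Gamma> (\<lambda>u. D0 u v) p a + S p a (v p)" if a: "a \<in> F p" for a
  proof -
    obtain u where u: "u \<in> \<Gamma>" "u p = a" using section_through[OF a] by blast
    have "D u v p - D0 u v p = S p (u p) (v p)" using S(1) u(1) v unfolding difference_tensor_def by blast
    then show ?thesis using value_at_section[OF t(1) u(1), of p] value_at_section[OF t(2) u(1), of p] u(2)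
      by (simp add: algebra_simps)
  qed
  have "divergence_of E D v p = trace_on (F p) (\<lambda>a. value_at \<Gamma> (\<lambda>u. D0 u v) p a + S p a (v p))"
    unfolding divergence_of_def by (rule q.trace_on_cong[OF eq])
  also have "\<dots> = trace_on (F p) (value_at \<Gamma> (\<lambda>u. D0 u v) p) + trace_on (F p) (\<lambda>a. S p a (v p))"
  proof (rule q.trace_on_add)
    show "value_at \<Gamma> (\<lambda>u. D0 u v) p a \<in> F p" if "a \<in> F p" for a
      by (rule value_at_mem[OF t(2) _ that]) (intro section_fibre D_zero_section v)
  qed (rule prolongation(1)[OF S(2) _ vp])
  also have "trace_on (F p) (value_at \<Gamma> (\<lambda>u. D0 u v) p) = metric_divergence E G v p"
    using fun_cong[OF divergence_D_zero[OF v], of p] by (simp add: divergence_of_def)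
  finally show ?thesis by (simp add: trace_map_def)
qed

lemma canonical_D_zero: "canonical_connection E G (metric_divergence E G) D0"
  unfolding canonical_connection_def
proof (intro conjI ballI exI allI)
  show "difference_tensor E D0 D0 (\<lambda>p a b. 0)" by (simp add: difference_tensor_def)
  fix p
  have "G p 0 c = 0" if "c \<in> F p" for c
    using linear_on_zero[OF bilinear_onD(2)[OF G_bilinear that] subspace_fibre] .
  then show "(\<lambda>a b. 0) \<in> \<Sigma> p"
    using subspace_fibre by (intro prolongationI) (auto simp: subspace_0 q.zero_left)
  fix K assume "K \<in> trace_kernel E G p"
  then have "K \<in> \<Sigma> p" by (simp add: trace_kernel_def)
  then show "tensor_product E p (\<lambda>a b. 0) K = 0"
    unfolding tensor_product_eq contraction_def
    by (simp add: q.zero_left prolongation(1) q.some_basis_mem q.dual(1))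
qed (auto simp: D_zero_levi_civita divergence_D_zero)

text \<open>The difference of the two difference tensors has zero trace because the divergences
  agree, and it is perpendicular to the kernel as each of them is. So it lies in the kernel and in
  its complement at once.\<close>

lemma canonical_unique:
  assumes n: "n \<noteq> 1"
    and D: "canonical_connection E G dv D" and D': "canonical_connection E G dv D'"
    and uv: "u \<in> \<Gamma>" "v \<in> \<Gamma>"
  shows "D' u v = D u v"
proof
  fix p
  obtain S where S: "difference_tensor E D D0 S" "S p \<in> \<Sigma> p"
    "\<forall>K\<in>trace_kernel E G p. tensor_product E p (S p) K = 0"
    using D unfolding canonical_connection_def by blast
  obtain S' where S': "difference_tensor E D' D0 S'" "S' p \<in> \<Sigma> p"
    "\<forall>K\<in>trace_kernel E G p. tensor_product E p (S' p) K = 0"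
    using D' unfolding canonical_connection_def by blast
  have con: "generalised_connection E D" "generalised_connection E D'"
    using D D' by (auto simp: canonical_connection_def generalised_levi_civita_def)
  have dv: "divergence_of E D v = dv v" "divergence_of E D' v = dv v" if "v \<in> \<Gamma>" for v
    using D D' that unfolding canonical_connection_def by blast+
  let ?K = "\<lambda>a b. S p a b - S' p a b"
  have K: "?K \<in> \<Sigma> p" by (rule prolongation_diff[OF S(2) S'(2)])
  have "trace_map E p ?K b = 0" if b: "b \<in> F p" for b
  proof -
    obtain v where v: "v \<in> \<Gamma>" "v p = b" using section_through[OF b] by blast
    show ?thesis
      using divergence_difference[OF con(1) S(1,2) v(1)] divergence_difference[OF con(2) S'(1,2) v(1)]
        dv[OF v(1)] trace_map_diff[OF S(2) S'(2) b] v(2) by simp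
  qed
  then have ker: "?K \<in> trace_kernel E G p" using K by (simp add: trace_kernel_def)
  have "tensor_product E p ?K L = 0" if "L \<in> trace_kernel E G p" for L
    using tensor_product_diff_left[OF S(2) S'(2), of L] S(3) S'(3) that by (simp add: trace_kernel_def)
  from kernel_perp_zero[OF n ker this section_fibre[OF uv(1)] section_fibre[OF uv(2)]]
  have "S p (u p) (v p) = S' p (u p) (v p)" by simp
  moreover have "D u v p - D0 u v p = S p (u p) (v p)" "D' u v p - D0 u v p = S' p (u p) (v p)"
    using S(1) S'(1) uv unfolding difference_tensor_def by blast+
  ultimately show "D' u v p = D u v p" by (simp add: algebra_simps)
qed

text \<open>Two divergence operators share the same Leibniz term, so their difference is tensorial
  and is represented by a section. A multiple of this section determines the \<chi> to be added to
  D^0.\<close>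

lemma canonical_exists:
  assumes n: "n \<noteq> 1" and dv: "divergence_operator E dv"
  shows "\<exists>D. canonical_connection E G dv D"
proof -
  let ?div0 = "metric_divergence E G"
  let ?e = "\<lambda>v p. dv v p - ?div0 v p"
  have smooth: "dv v \<in> C" if "v \<in> \<Gamma>" "divergence_operator E dv" for dv v
    using that by (simp add: divergence_operator_def)
  have add: "dv (u + v) p = dv u p + dv v p" if "u \<in> \<Gamma>" "v \<in> \<Gamma>" "divergence_operator E dv" for dv u v p
    using that linear_on_add[of \<Gamma> dv u v] by (simp add: divergence_operator_def)
  have leibniz: "dv (fscale f v) p = \<pi> p (v p) f + f p * dv v p"
    if "f \<in> C" "v \<in> \<Gamma>" "divergence_operator E dv" for dv f v p
  proof -
    have "dv (fscale f v) = act E v f + fscale f (dv v)"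
      using that unfolding divergence_operator_def by blast
    then show ?thesis by (simp add: act_eq fscale_def)
  qed
  note div0 = divergence_operator_metric
  have "tensorial ?e"
    by (rule tensorialI) (use dv div0 in \<open>auto simp: add leibniz algebra_simps\<close>)
  moreover have "?e v \<in> C" if "v \<in> \<Gamma>" for v
    by (intro smooth_functions_diff smooth that dv div0)
  ultimately obtain e where e: "e \<in> \<Gamma>" "\<And>v p. v \<in> \<Gamma> \<Longrightarrow> q p (e p) (v p) = ?e v p"
    using riesz_section[of ?e] by blast
  \<comment> \<open>The factor compensates the 1 - n in \<open>trace_chi\<close>.\<close>
  define z where "z = (1 / (1 - n)) *\<^sub>R e"
  have z: "z \<in> \<Gamma>" unfolding z_def by (rule section_scaleR[OF e(1)])
  have zp: "(1 - n) * q p (z p) (v p) = ?e v p" if "v \<in> \<Gamma>" for v p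
  proof -
    have "z p = (1 / (1 - n)) *\<^sub>R e p" by (simp add: z_def scaleR_fun_def)
    then show ?thesis
      using e(2)[OF that] n section_fibre[OF e(1)] section_fibre[OF that] by (simp add: q.scale_left)
  qed
  define S where "S u v = (\<lambda>p. chi p (z p) (u p) (v p))" for u v :: "'m \<Rightarrow> 'e"
  define D where "D u v = D0 u v + S u v" for u v
  note fib = section_fibre and chi = chi_prolongation[OF section_fibre[OF z]]
  have S_section: "S u v \<in> \<Gamma>" if uv: "u \<in> \<Gamma>" "v \<in> \<Gamma>" for u v
  proof -
    \<comment> \<open>Writes \<chi> as a combination of projected sections with smooth coefficients,
      which shows that it depends smoothly on the point.\<close>
    let ?t = "\<lambda>s. fscale (\<lambda>r. q r (proj E G s u r) (proj E G s v r)) (proj E G s z)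
        - fscale (\<lambda>r. q r (proj E G s z r) (proj E G s v r)) (proj E G s u)"
    have "S u v = ?t 1 + ?t (- 1)"
      by (rule ext) (simp add: S_def chi_def fscale_apply proj_eq)
    moreover have "?t s \<in> \<Gamma>" for s
      by (intro section_diff section_fscale pair_smooth proj_section uv z)
    ultimately show ?thesis by (simp add: section_add)
  qed
  have S_add: "S (u + w) v p = S u v p + S w v p" "S u (v + w) p = S u v p + S u w p"
    if "u \<in> \<Gamma>" "v \<in> \<Gamma>" "w \<in> \<Gamma>" for u v w p
    using that z by (simp_all add: S_def chi_linear fib)
  have S_fscale: "S (fscale f u) v p = f p *\<^sub>R S u v p" "S u (fscale f v) p = f p *\<^sub>R S u v p"
    if "u \<in> \<Gamma>" "v \<in> \<Gamma>" "f \<in> C" for u v f p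
    using that z by (simp_all add: S_def fscale_apply chi_linear fib)
  have S_skew: "q p (S u v p) (w p) = - q p (S u w p) (v p)"
    and S_G: "G p (S u v p) (w p) = - G p (S u w p) (v p)"
    and S_cyc: "q p (S u v p) (w p) + q p (S v w p) (u p) + q p (S w u p) (v p) = 0"
    if "u \<in> \<Gamma>" "v \<in> \<Gamma>" "w \<in> \<Gamma>" for u v w p
    using prolongation(4)[OF chi fib[OF that(1)] fib[OF that(2)] fib[OF that(3)]]
      prolongation(5)[OF chi fib[OF that(1)] fib[OF that(2)] fib[OF that(3)]]
      prolongation(6)[OF chi fib[OF that(1)] fib[OF that(2)] fib[OF that(3)]]
      G_sym[OF fib[OF that(2)] fib[OF S_section[OF that(1,3)]]]
    by (simp_all add: S_def)
  note rules = D_zero_connection D_zero_metric S_section S_add S_fscale S_skew S_G D_def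
  have 1: "generalised_connection E D"
    by (rule add_tensor(1)[where D = D0 and S = S]) (assumption | rule rules)+
  have 2: "metric_connection E G D"
    by (rule add_tensor(2)[where D = D0 and S = S]) (assumption | rule rules)+
  have 3: "gen_torsion E D u v w p = gen_torsion E D0 u v w p + q p (S u v p) (w p)
      + q p (S v w p) (u p) + q p (S w u p) (v p)"
    if "u \<in> \<Gamma>" "v \<in> \<Gamma>" "w \<in> \<Gamma>" for u v w p
    by (rule add_tensor(3)[where D = D0 and S = S]) (assumption | rule rules that)+
  have "gen_torsion E D0 u v w = 0" if "u \<in> \<Gamma>" "v \<in> \<Gamma>" "w \<in> \<Gamma>" for u v w
    using D_zero_levi_civita that unfolding generalised_levi_civita_def by blast
  then have "gen_torsion E D u v w = 0" if "u \<in> \<Gamma>" "v \<in> \<Gamma>" "w \<in> \<Gamma>" for u v w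
    using 3[OF that] S_cyc[OF that] that by (simp add: fun_eq_iff)
  then have lc: "generalised_levi_civita E G D"
    unfolding generalised_levi_civita_def using 1 2 by blast
  have diff: "difference_tensor E D D0 (\<lambda>p. chi p (z p))"
    by (simp add: difference_tensor_def D_def S_def)
  have "divergence_of E D v = dv v" if v: "v \<in> \<Gamma>" for v
  proof
    fix p
    show "divergence_of E D v p = dv v p"
      using divergence_difference[OF 1 diff chi v] trace_chi[OF fib[OF z] fib[OF v], of p] zp[OF v, of p] by simp
  qed
  moreover have "tensor_product E p (chi p (z p)) K = 0" if "K \<in> trace_kernel E G p" for p K
  proof -
    have "K \<in> \<Sigma> p" "trace_map E p K (z p) = 0" using that fib[OF z] by (auto simp: trace_kernel_def)
    then show ?thesis
      unfolding tensor_product_eq using contraction_chi[OF dual_pair_basis(1) _ fib[OF z]] by simp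
  qed
  ultimately have "canonical_connection E G dv D"
    unfolding canonical_connection_def using lc diff chi by blast
  then show ?thesis by blast
qed

end

theorem theorem2p1:
  fixes E :: "('m::{t2_space, second_countable_topology}, 'a::euclidean_space, 'e::real_vector) courant"
    and G :: "'m \<Rightarrow> 'e \<Rightarrow> 'e \<Rightarrow> real"
  assumes "2 \<le> DIM('a)"
    and "exact_courant_algebroid E"
    and "generalised_metric E G"
  shows "(\<forall>dv. divergence_operator E dv \<longrightarrow>
            (\<exists>D. canonical_connection E G dv D \<and>
                 (\<forall>D'. canonical_connection E G dv D' \<longrightarrow>
                    (\<forall>u\<in>sections E. \<forall>v\<in>sections E. D' u v = D u v)))) \<and>
         divergence_operator E (metric_divergence E G) \<and>
         canonical_connection E G (metric_divergence E G) (D_zero E G)"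
proof -
  interpret gen_metric E G
    using assms(2,3) by unfold_locales
  \<comment> \<open>Any point will do, here \<open>undefined\<close>, because \<open>rk E\<close> is
    the same at all points. Dimension at least 2 gives rank at least 4, that is, n at least
    2.\<close>
  have "DIM('a) \<le> card (some_basis (tangent_space (base E) undefined))"
    by (rule dim_tangent_space[OF findim_tangent])
  then have "4 \<le> rk E" using rank_eq[of undefined] assms(1) by linarith
  then have "real (rk E) / 2 \<noteq> 1" by simp
  then show ?thesis
    using canonical_exists canonical_unique divergence_operator_metric canonical_D_zero by metis
qed

end
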